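(* Let $n$ and $r$ be integers with $3 \leq r < n$, let $t=\lfloor (n-1)/2 \rfloor$, and let $H$ be an $n$-vertex $r$-uniform hypergraph. If either (a) $r\leq t$ and $\delta(H) \geq \binom{t}{r-1} +1$, or (b) $r\geq n/2$ and $\delta(H) \geq r$, then $H$ contains a hamiltonian Berge cycle, i.e. a Berge cycle of length $n$.
   Context: A hypergraph is a family of (distinct) subsets, called edges, of a vertex set; it is $r$-uniform if every edge has exactly $r$ vertices. The degree of a vertex is the number of edges containing it, and $\delta(H)$ is the minimum degree. A Berge cycle of length $\ell$ is a list $v_1, e_1, v_2, \ldots, v_\ell, e_\ell, v_1$ of $\ell$ distinct vertices and $\ell$ distinct edges with $\{v_i, v_{i+1}\} \subseteq e_i$ for all $i$ (indices modulo $\ell$). *)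

theory Defs
  imports Complex_Main
begin

definition hypergraph :: "'a set \<Rightarrow> 'a set set \<Rightarrow> bool" where
  "hypergraph V E \<longleftrightarrow> (\<forall>e\<in>E. e \<subseteq> V)"

definition uniform_hypergraph :: "nat \<Rightarrow> 'a set \<Rightarrow> 'a set set \<Rightarrow> bool" where
  "uniform_hypergraph r V E \<longleftrightarrow> hypergraph V E \<and> (\<forall>e\<in>E. finite e \<and> card e = r)"

definition hdegree :: "'a set set \<Rightarrow> 'a \<Rightarrow> nat" where
  "hdegree E v = card {e \<in> E. v \<in> e}"

(* Meaningful only for a finite nonempty vertex set. *)
definition min_hdegree :: "'a set \<Rightarrow> 'a set set \<Rightarrow> nat" where
  "min_hdegree V E = Min (hdegree E ` V)"

(* The cycle v_1, e_1, ..., v_l, e_l, v_1 is given by the list vs of its vertices and the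
   list es of its edges, both indexed from 0. *)
definition berge_cycle :: "'a set \<Rightarrow> 'a set set \<Rightarrow> nat \<Rightarrow> 'a list \<Rightarrow> 'a set list \<Rightarrow> bool" where
  "berge_cycle V E l vs es \<longleftrightarrow>
     length vs = l \<and> length es = l \<and>
     distinct vs \<and> distinct es \<and>
     set vs \<subseteq> V \<and> set es \<subseteq> E \<and>
     (\<forall>i<l. {vs ! i, vs ! ((i + 1) mod l)} \<subseteq> es ! i)"

definition hamiltonian_berge_cycle :: "'a set \<Rightarrow> 'a set set \<Rightarrow> 'a list \<Rightarrow> 'a set list \<Rightarrow> bool" where
  "hamiltonian_berge_cycle V E vs es \<longleftrightarrow> berge_cycle V E (card V) vs es"

end

theory Submission
  imports Defs
begin

text \<open>Adding edges preserves the hypotheses, so the hypergraph may be assumed saturated: it has no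
hamiltonian cycle, but a hamiltonian Berge path $v_1, e_1, \ldots, e_{n-1}, v_n$. Call the edges
outside the path free. If an end of the path lies together with $v_{i+1}$ in a free edge, or lies in
$e_i$, then the path can be rotated at $i$. Let $X$ and $Y$ be the sets of rotation indices of $v_1$
and $v_n$; as in Dirac's theorem, free indices of one end are not rotation indices of the other.
For $r \ge n/2$ this and counting suffice.

For $r \le t$ one first excludes cycles of length $n - 1$: a vertex $w$ outside such a cycle can
neither be inserted nor exchanged for a vertex of the cycle, and its degree then leaves only a few
tight configurations, which die by inspecting further exchanges. Hence $X$ and $Y + 1$ are disjoint
as well. Since an end with at most $t - 1$ free neighbours lies in at least $t$ path edges, double
counting yields a path both of whose ends have $t$ free neighbours, and these must fill the first
and the last $t$ indices. The $t + 1$ vertices of one half provide only $\binom{t}{r-1}$ edges at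
its end, so each end also lies in a path edge of its own half that reaches into the other half;
rotating at both ends frees these two edges, and they close a hamiltonian cycle.\<close>

text \<open>Unlike in a graph, a path edge contains r - 2 vertices besides its two consecutive ones.
  A rotation along a free edge releases a path edge, and the further vertices of the released edge
  become new free neighbours. Many contradictions below come from an edge released in this way, so
  the edges are tracked as closely as the vertices. For r <= t the bound is one more than the degree
  in a complete hypergraph on t + 1 vertices. Two of these, disjoint or sharing one vertex, are not
  hamiltonian, and the end of the argument has to break exactly this picture. For r < t the binomial
  is at least quadratic in t, which leaves room in the counts. For r = t it is only t, and the
  number of edges decides: at least four edges lie outside any path or cycle with n - 1 edges, while
  most of the assumed structures admit fewer. The exceptions are the origin of the special cases r =
  t = 3, n = 8 and r = t = 4, n = 10. For r >= n/2 the degree r gives |E| >= n, hence a free edge,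
  and rotations have to bring free edges to both ends.\<close>

locale unif =
  fixes V :: "'a set" and E :: "'a set set" and n r :: nat
  assumes finV: "finite V" and cardV: "card V = n" and r3: "3 \<le> r" and rn: "r < n"
    and EV: "\<And>e. e \<in> E \<Longrightarrow> e \<subseteq> V" and Er: "\<And>e. e \<in> E \<Longrightarrow> card e = r"
begin

text \<open>Paths are indexed as $v_1, e_1, \ldots, e_{n-1}, v_n$; values of the functions outside these ranges are
irrelevant.\<close>

definition ham_path :: "(nat \<Rightarrow> 'a) \<Rightarrow> (nat \<Rightarrow> 'a set) \<Rightarrow> bool" where
  "ham_path v e \<longleftrightarrow> bij_betw v {1..n} V \<and> inj_on e {1..<n} \<and> e ` {1..<n} \<subseteq> E \<and>
     (\<forall>i\<in>{1..<n}. v i \<in> e i \<and> v (Suc i) \<in> e i)"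

definition free_edges :: "(nat \<Rightarrow> 'a set) \<Rightarrow> 'a set set" where
  "free_edges e = E - e ` {1..<n}"

text \<open>Rotation at $i$: the path becomes $v_i, \ldots, v_1, v_{i+1}, \ldots, v_n$, where \<open>f\<close> joins
$v_1$ and $v_{i+1}$.\<close>

definition rotv :: "nat \<Rightarrow> (nat \<Rightarrow> 'a) \<Rightarrow> nat \<Rightarrow> 'a" where
  "rotv i v j = (if j \<le> i then v (i + 1 - j) else v j)"

definition rote :: "nat \<Rightarrow> 'a set \<Rightarrow> (nat \<Rightarrow> 'a set) \<Rightarrow> nat \<Rightarrow> 'a set" where
  "rote i f e j = (if j < i then e (i - j) else if j = i then f else e j)"

definition revv :: "(nat \<Rightarrow> 'a) \<Rightarrow> nat \<Rightarrow> 'a" where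
  "revv v j = v (n + 1 - j)"

definition reve :: "(nat \<Rightarrow> 'a set) \<Rightarrow> nat \<Rightarrow> 'a set" where
  "reve e j = e (n - j)"

text \<open>All four sets contain indices of path edges: $i$ belongs to \<open>NI\<close> if $v_{i+1}$, and to \<open>NK\<close> if
$v_i$, is joined to the respective end by a free edge, so that reversal acts on each of them by
$i \mapsto n - i$.\<close>

definition NI :: "(nat \<Rightarrow> 'a) \<Rightarrow> (nat \<Rightarrow> 'a set) \<Rightarrow> nat set" where
  "NI v e = {i \<in> {1..<n}. \<exists>f\<in>free_edges e. v 1 \<in> f \<and> v (Suc i) \<in> f}"
definition BI :: "(nat \<Rightarrow> 'a) \<Rightarrow> (nat \<Rightarrow> 'a set) \<Rightarrow> nat set" where
  "BI v e = {i \<in> {1..<n}. v 1 \<in> e i}"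
definition NK :: "(nat \<Rightarrow> 'a) \<Rightarrow> (nat \<Rightarrow> 'a set) \<Rightarrow> nat set" where
  "NK v e = {i \<in> {1..<n}. \<exists>f\<in>free_edges e. v n \<in> f \<and> v i \<in> f}"
definition BK :: "(nat \<Rightarrow> 'a) \<Rightarrow> (nat \<Rightarrow> 'a set) \<Rightarrow> nat set" where
  "BK v e = {i \<in> {1..<n}. v n \<in> e i}"

section \<open>Hamiltonian Berge paths under rotation and reversal\<close>

lemma finE: "finite E"
  using finV EV by (meson PowI finite_Pow_iff finite_subset subsetI)

lemma n4: "4 \<le> n" using r3 rn by simp

lemma hpD:
  assumes "ham_path v e"
  shows "bij_betw v {1..n} V" "inj_on e {1..<n}" "e ` {1..<n} \<subseteq> E"
    "\<And>i. 1 \<le> i \<Longrightarrow> i < n \<Longrightarrow> v i \<in> e i" "\<And>i. 1 \<le> i \<Longrightarrow> i < n \<Longrightarrow> v (Suc i) \<in> e i"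
    "\<And>i. 1 \<le> i \<Longrightarrow> i < n \<Longrightarrow> e i \<in> E" "\<And>i. 1 \<le> i \<Longrightarrow> i \<le> n \<Longrightarrow> v i \<in> V"
    "\<And>i j. 1 \<le> i \<Longrightarrow> i \<le> n \<Longrightarrow> 1 \<le> j \<Longrightarrow> j \<le> n \<Longrightarrow> v i = v j \<longleftrightarrow> i = j"
    "\<And>i j. 1 \<le> i \<Longrightarrow> i < n \<Longrightarrow> 1 \<le> j \<Longrightarrow> j < n \<Longrightarrow> e i = e j \<longleftrightarrow> i = j"
proof -
  show "bij_betw v {1..n} V" "inj_on e {1..<n}" "e ` {1..<n} \<subseteq> E"
    "\<And>i. 1 \<le> i \<Longrightarrow> i < n \<Longrightarrow> v i \<in> e i" "\<And>i. 1 \<le> i \<Longrightarrow> i < n \<Longrightarrow> v (Suc i) \<in> e i"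
    "\<And>i. 1 \<le> i \<Longrightarrow> i < n \<Longrightarrow> e i \<in> E"
    using assms unfolding ham_path_def by auto
  show "\<And>i. 1 \<le> i \<Longrightarrow> i \<le> n \<Longrightarrow> v i \<in> V"
    using assms unfolding ham_path_def bij_betw_def by auto
  show "\<And>i j. 1 \<le> i \<Longrightarrow> i \<le> n \<Longrightarrow> 1 \<le> j \<Longrightarrow> j \<le> n \<Longrightarrow> v i = v j \<longleftrightarrow> i = j"
    using assms unfolding ham_path_def bij_betw_def by (auto dest: inj_onD)
  show "\<And>i j. 1 \<le> i \<Longrightarrow> i < n \<Longrightarrow> 1 \<le> j \<Longrightarrow> j < n \<Longrightarrow> e i = e j \<longleftrightarrow> i = j"
    using assms unfolding ham_path_def by (auto dest: inj_onD)
qed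

lemma hp_idx:
  assumes "ham_path v e" "x \<in> V"
  obtains i where "1 \<le> i" "i \<le> n" "x = v i"
  using hpD(1)[OF assms(1)] assms(2) unfolding bij_betw_def by auto

text \<open>Rotation and reversal renumber positions by involutions, so \<open>p\<close> serves as
  its own inverse.\<close>

lemma bij_betw_comp_perm:
  assumes "bij_betw v A W" "\<And>j. j \<in> A \<Longrightarrow> p j \<in> A" "\<And>j. j \<in> A \<Longrightarrow> p (p j) = j"
    "\<And>j. j \<in> A \<Longrightarrow> v' j = v (p j)"
  shows "bij_betw v' A W"
proof -
  have "bij_betw p A A"
    by (rule bij_betw_byWitness[where f' = p]) (use assms in auto)
  then have "bij_betw (v \<circ> p) A W" using assms(1) bij_betw_trans by blast
  then show ?thesis using assms(4) by (metis bij_betw_cong comp_apply)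
qed

text \<open>The hypothesis on \<open>f\<close> admits a free edge as well as \<open>e i\<close>
  itself, so one proof covers both kinds of rotation. The formula for the free edges covers both
  too: with \<open>f = e i\<close> nothing changes.\<close>

lemma hp_rot:
  assumes h: "ham_path v e" and i: "1 \<le> i" "i < n" and f: "f \<in> E" "f \<notin> e ` ({1..<n} - {i})"
    and v: "v 1 \<in> f" "v (Suc i) \<in> f"
  shows "ham_path (rotv i v) (rote i f e)" "free_edges (rote i f e) = insert (e i) (free_edges e) - {f}"
proof -
  note H = hpD[OF h]
  have b: "bij_betw (rotv i v) {1..n} V"
    by (rule bij_betw_comp_perm[OF H(1), where p = "\<lambda>j. if j \<le> i then i + 1 - j else j"])
       (use i in \<open>auto simp: rotv_def\<close>)
  have b': "bij_betw e {1..<n} (e ` {1..<n})" using H(2) by (simp add: bij_betw_def)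
  have b2: "bij_betw (\<lambda>j. if j < i then e (i - j) else e j) {1..<n} (e ` {1..<n})"
    by (rule bij_betw_comp_perm[OF b', where p = "\<lambda>j. if j < i then i - j else j"]) (use i in auto)
  \<comment> \<open>\<open>g\<close> permutes the old edges and fixes position \<open>i\<close>; the
    rotated edge sequence is \<open>g\<close> with the entry at \<open>i\<close> replaced by
    \<open>f\<close>.\<close>
  define g where "g = (\<lambda>j. if j < i then e (i - j) else e j)"
  have ig: "inj_on g {1..<n}" and gim: "g ` {1..<n} = e ` {1..<n}"
    using b2 unfolding g_def[symmetric] bij_betw_def by auto
  have gi: "g i = e i" unfolding g_def by simp
  have gim': "g ` ({1..<n} - {i}) = e ` ({1..<n} - {i})"
  proof -
    have "g ` ({1..<n} - {i}) = g ` {1..<n} - {g i}" using ig i by (auto simp: inj_on_def)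
    also have "\<dots> = e ` {1..<n} - {e i}" using gim gi by simp
    also have "\<dots> = e ` ({1..<n} - {i})" using H(2) i by (auto simp: inj_on_def)
    finally show ?thesis .
  qed
  have re: "rote i f e = g(i := f)" by (auto simp: rote_def g_def fun_eq_iff)
  have inj: "inj_on (rote i f e) {1..<n}"
  proof -
    have "f \<notin> g ` ({1..<n} - {i})" using f(2) gim' by simp
    then have "inj_on (g(i := f)) (insert i ({1..<n} - {i}))"
      using ig by (subst inj_on_insert) (auto simp: inj_on_def)
    then show ?thesis unfolding re using i by (simp add: insert_absorb)
  qed
  have spl: "{1..<n} = insert i ({1..<n} - {i})" using i by auto
  have im: "rote i f e ` {1..<n} = insert f (e ` ({1..<n} - {i}))"
  proof -
    have "rote i f e ` {1..<n} = insert f (rote i f e ` ({1..<n} - {i}))"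
      using i unfolding re by (subst spl) auto
    also have "rote i f e ` ({1..<n} - {i}) = g ` ({1..<n} - {i})" unfolding re by auto
    finally show ?thesis using gim' by simp
  qed
  have inc: "\<forall>j\<in>{1..<n}. rotv i v j \<in> rote i f e j \<and> rotv i v (Suc j) \<in> rote i f e j"
  proof
    fix j assume j: "j \<in> {1..<n}"
    consider "j < i" | "j = i" | "j > i" by linarith
    then show "rotv i v j \<in> rote i f e j \<and> rotv i v (Suc j) \<in> rote i f e j"
    proof cases
      case 1
      then have "Suc (i - j) = i + 1 - j" "i + 1 - Suc j = i - j" by auto
      with 1 H(4)[of "i - j"] H(5)[of "i - j"] i show ?thesis by (simp add: rotv_def rote_def)
    next
      case 2 then show ?thesis using v by (simp add: rotv_def rote_def)
    next
      case 3 then show ?thesis using H(4)[of j] H(5)[of j] j by (simp add: rotv_def rote_def)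
    qed
  qed
  show "ham_path (rotv i v) (rote i f e)"
    unfolding ham_path_def using b inj inc im f(1) H(3) by auto
  have "e ` {1..<n} = insert (e i) (e ` ({1..<n} - {i}))" by (subst spl) auto
  moreover have "e i \<notin> e ` ({1..<n} - {i})" using H(2) i by (auto simp: inj_on_def)
  moreover have "e i \<in> E" using H i by auto
  ultimately show "free_edges (rote i f e) = insert (e i) (free_edges e) - {f}"
    unfolding free_edges_def im by auto
qed

lemma hp_rot_free:
  assumes "ham_path v e" "1 \<le> i" "i < n" "f \<in> free_edges e" "v 1 \<in> f" "v (Suc i) \<in> f"
  shows "ham_path (rotv i v) (rote i f e)" "free_edges (rote i f e) = insert (e i) (free_edges e) - {f}"
proof -
  have f: "f \<in> E" "f \<notin> e ` ({1..<n} - {i})" using assms(4) by (auto simp: free_edges_def)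
  show "ham_path (rotv i v) (rote i f e)" "free_edges (rote i f e) = insert (e i) (free_edges e) - {f}"
    by (fact hp_rot[OF assms(1-3) f assms(5,6)])+
qed

lemma hp_rot_same:
  assumes h: "ham_path v e" and "1 \<le> i" "i < n" "v 1 \<in> e i"
  shows "ham_path (rotv i v) (rote i (e i) e)" "free_edges (rote i (e i) e) = free_edges e"
proof -
  note H = hpD[OF h]
  have 1: "e i \<notin> e ` ({1..<n} - {i})" using H(2) assms by (auto simp: inj_on_def)
  show "ham_path (rotv i v) (rote i (e i) e)"
    using hp_rot[OF h assms(2,3) _ 1 assms(4)] H assms by auto
  show "free_edges (rote i (e i) e) = free_edges e"
    using hp_rot(2)[OF h assms(2,3) _ 1 assms(4)] H assms by (auto simp: free_edges_def)
qed

lemma hp_rev: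
  assumes h: "ham_path v e"
  shows "ham_path (revv v) (reve e)" "free_edges (reve e) = free_edges e"
proof -
  note H = hpD[OF h]
  have b: "bij_betw (revv v) {1..n} V"
    by (rule bij_betw_comp_perm[OF H(1), where p = "\<lambda>j. n + 1 - j"]) (auto simp: revv_def)
  have b': "bij_betw e {1..<n} (e ` {1..<n})" using H(2) by (simp add: bij_betw_def)
  have b2: "bij_betw (reve e) {1..<n} (e ` {1..<n})"
    by (rule bij_betw_comp_perm[OF b', where p = "\<lambda>j. n - j"]) (auto simp: reve_def)
  have inc: "\<forall>j\<in>{1..<n}. revv v j \<in> reve e j \<and> revv v (Suc j) \<in> reve e j"
  proof
    fix j assume j: "j \<in> {1..<n}"
    then have "Suc (n - j) = n + 1 - j" "n + 1 - Suc j = n - j" by auto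
    with H(4)[of "n - j"] H(5)[of "n - j"] j
    have "v (n - j) \<in> e (n - j)" "v (n + 1 - j) \<in> e (n - j)" by auto
    with \<open>n + 1 - Suc j = n - j\<close> show "revv v j \<in> reve e j \<and> revv v (Suc j) \<in> reve e j"
      by (simp add: revv_def reve_def)
  qed
  show "ham_path (revv v) (reve e)"
    unfolding ham_path_def using b b2 inc H(3) by (auto simp: bij_betw_def)
  show "free_edges (reve e) = free_edges e" using b2 unfolding free_edges_def bij_betw_def by auto
qed

lemma NI_rev: "ham_path v e \<Longrightarrow> NI (revv v) (reve e) = (\<lambda>i. n - i) ` NK v e"
  "ham_path v e \<Longrightarrow> BI (revv v) (reve e) = (\<lambda>i. n - i) ` BK v e"
  "ham_path v e \<Longrightarrow> NK (revv v) (reve e) = (\<lambda>i. n - i) ` NI v e"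
  "ham_path v e \<Longrightarrow> BK (revv v) (reve e) = (\<lambda>i. n - i) ` BI v e"
proof -
  have *: "A = (\<lambda>i. n - i) ` B" if "A \<subseteq> {1..<n}" "B \<subseteq> {1..<n}"
    "\<And>i. i \<in> {1..<n} \<Longrightarrow> i \<in> A \<longleftrightarrow> n - i \<in> B" for A B :: "nat set"
  proof
    show "A \<subseteq> (\<lambda>i. n - i) ` B"
    proof
      fix x assume x: "x \<in> A"
      then have "n - x \<in> B" "x = n - (n - x)" using that by force+
      then show "x \<in> (\<lambda>i. n - i) ` B" by blast
    qed
    show "(\<lambda>i. n - i) ` B \<subseteq> A"
    proof
      fix x assume "x \<in> (\<lambda>i. n - i) ` B"
      then obtain y where y: "y \<in> B" "x = n - y" by blast
      then have "y \<in> {1..<n}" using that by auto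
      then have "x \<in> {1..<n}" "n - x = y" using y by auto
      then show "x \<in> A" using that(3)[of x] y by simp
    qed
  qed
  have n1: "1 < n" using n4 by simp
  assume h: "ham_path v e"
  note F = hp_rev(2)[OF h]
  show "NI (revv v) (reve e) = (\<lambda>i. n - i) ` NK v e"
    using n1 by (intro *) (auto simp: NI_def NK_def F revv_def reve_def)
  show "BI (revv v) (reve e) = (\<lambda>i. n - i) ` BK v e"
    using n1 by (intro *) (auto simp: BI_def BK_def F revv_def reve_def)
  show "NK (revv v) (reve e) = (\<lambda>i. n - i) ` NI v e"
    using n1 by (intro *) (auto simp: NI_def NK_def F revv_def reve_def Suc_diff_le)
  show "BK (revv v) (reve e) = (\<lambda>i. n - i) ` BI v e"
    using n1 by (intro *) (auto simp: BI_def BK_def F revv_def reve_def)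
qed

lemma idx_sub: "NI v e \<subseteq> {1..<n}" "BI v e \<subseteq> {1..<n}" "NK v e \<subseteq> {1..<n}" "BK v e \<subseteq> {1..<n}"
  by (auto simp: NI_def BI_def NK_def BK_def)

lemma idx_fin [simp]: "finite (NI v e)" "finite (BI v e)" "finite (NK v e)" "finite (BK v e)"
  by (auto simp: NI_def BI_def NK_def BK_def)

lemma card_flip: "A \<subseteq> {1..<n} \<Longrightarrow> card ((\<lambda>i. n - i) ` A) = card A"
  by (rule card_image) (auto simp: inj_on_def dest!: subsetD)

lemma card_rev:
  assumes "ham_path v e"
  shows "card (NI (revv v) (reve e)) = card (NK v e)" "card (BI (revv v) (reve e)) = card (BK v e)"
    "card (NK (revv v) (reve e)) = card (NI v e)" "card (BK (revv v) (reve e)) = card (BI v e)"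
  unfolding NI_rev[OF assms]
  by (fact card_flip[OF idx_sub(3)] card_flip[OF idx_sub(4)] card_flip[OF idx_sub(1)] card_flip[OF idx_sub(2)])+

lemma hdegree_split:
  assumes "ham_path v e"
  shows "hdegree E x = card {f \<in> free_edges e. x \<in> f} + card {i \<in> {1..<n}. x \<in> e i}"
proof -
  note H = hpD[OF assms]
  have "{f \<in> E. x \<in> f} = {f \<in> free_edges e. x \<in> f} \<union> e ` {i \<in> {1..<n}. x \<in> e i}"
    using H(3) unfolding free_edges_def by auto
  moreover have "{f \<in> free_edges e. x \<in> f} \<inter> e ` {i \<in> {1..<n}. x \<in> e i} = {}" unfolding free_edges_def by auto
  moreover have "card (e ` {i \<in> {1..<n}. x \<in> e i}) = card {i \<in> {1..<n}. x \<in> e i}"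
    by (rule card_image) (rule inj_on_subset[OF H(2)], auto)
  moreover have "finite {f \<in> free_edges e. x \<in> f}" "finite (e ` {i \<in> {1..<n}. x \<in> e i})"
    using finE by (auto simp: free_edges_def)
  ultimately show ?thesis unfolding hdegree_def by (simp add: card_Un_disjoint)
qed

lemma Fr_sub: "f \<in> free_edges e \<Longrightarrow> f \<in> E" by (simp add: free_edges_def)

lemma path_edge_not_free: "1 \<le> i \<Longrightarrow> i < n \<Longrightarrow> e i \<notin> free_edges e"
  by (auto simp: free_edges_def)

text \<open>Deleting \<open>x\<close> embeds the star in the (r-1)-subsets of \<open>A\<close>. This
  turns a restriction on the neighbours of a vertex into a degree bound.\<close>

lemma card_star_le:
  assumes "finite A" "\<And>f. f \<in> G \<Longrightarrow> f \<in> E \<and> x \<in> f \<and> f - {x} \<subseteq> A"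
  shows "card G \<le> card A choose (r - 1)"
proof -
  have "inj_on (\<lambda>f. f - {x}) G" using assms(2) by (intro inj_onI) (metis insert_Diff)
  then have "card G = card ((\<lambda>f. f - {x}) ` G)" by (simp add: card_image)
  also have "\<dots> \<le> card {B. B \<subseteq> A \<and> card B = r - 1}"
  proof (rule card_mono)
    show "finite {B. B \<subseteq> A \<and> card B = r - 1}" using assms(1) by simp
    show "(\<lambda>f. f - {x}) ` G \<subseteq> {B. B \<subseteq> A \<and> card B = r - 1}"
    proof
      fix B assume "B \<in> (\<lambda>f. f - {x}) ` G"
      then obtain f where f: "f \<in> G" "B = f - {x}" by blast
      have "card B = r - 1" using f assms(2)[OF f(1)] Er by (simp add: card_Diff_singleton)
      then show "B \<in> {B. B \<subseteq> A \<and> card B = r - 1}" using f assms(2)[OF f(1)] by simp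
    qed
  qed
  also have "\<dots> = card A choose (r - 1)" using n_subsets[OF assms(1)] by simp
  finally show ?thesis .
qed

lemma card_free_start:
  assumes h: "ham_path v e"
  shows "card {f \<in> free_edges e. v 1 \<in> f} \<le> card (NI v e) choose (r - 1)"
proof -
  have "card {f \<in> free_edges e. v 1 \<in> f} \<le> card ((\<lambda>i. v (Suc i)) ` NI v e) choose (r - 1)"
  proof (rule card_star_le[where x = "v 1"])
    fix f assume f: "f \<in> {f \<in> free_edges e. v 1 \<in> f}"
    have "y \<in> (\<lambda>i. v (Suc i)) ` NI v e" if y: "y \<in> f" "y \<noteq> v 1" for y
    proof -
      have "y \<in> V" using EV f y Fr_sub by blast
      then obtain j where j: "1 \<le> j" "j \<le> n" "y = v j" using hp_idx[OF h] by blast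
      with y have "j \<noteq> 1" by auto
      with j have "Suc (j - 1) = j" "j - 1 \<in> {1..<n}" by auto
      moreover from this have "j - 1 \<in> NI v e" using f y j unfolding NI_def by auto
      ultimately show ?thesis using j by (metis image_eqI)
    qed
    then show "f \<in> E \<and> v 1 \<in> f \<and> f - {v 1} \<subseteq> (\<lambda>i. v (Suc i)) ` NI v e"
      using f Fr_sub by auto
  qed simp
  also have "card ((\<lambda>i. v (Suc i)) ` NI v e) \<le> card (NI v e)" by (simp add: card_image_le)
  then have "card ((\<lambda>i. v (Suc i)) ` NI v e) choose (r - 1) \<le> card (NI v e) choose (r - 1)"
    by (rule binomial_right_mono)
  finally show ?thesis .
qed

lemma sum_hdegree: "(\<Sum>x\<in>V. hdegree E x) = r * card E"
proof -
  have "(\<Sum>x\<in>V. hdegree E x) = (\<Sum>x\<in>V. \<Sum>e\<in>E. if x \<in> e then 1 else 0)"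
    unfolding hdegree_def using finE by (intro sum.cong refl) (simp add: sum.If_cases Int_def)
  also have "\<dots> = (\<Sum>e\<in>E. \<Sum>x\<in>V. if x \<in> e then 1 else 0)" by (rule sum.swap)
  also have "\<dots> = (\<Sum>e\<in>E. r)"
  proof (rule sum.cong[OF refl])
    fix e assume e: "e \<in> E"
    then have "V \<inter> {x. x \<in> e} = e" using EV by auto
    then show "(\<Sum>x\<in>V. if x \<in> e then 1 else 0) = r" using finV Er[OF e] by (simp add: sum.If_cases)
  qed
  finally show ?thesis by (simp add: mult.commute)
qed

end

section \<open>Non-hamiltonian hypergraphs: incompatible indices of the two ends\<close>

locale nonham = unif +
  assumes nonham: "\<nexists>vs es. hamiltonian_berge_cycle V E vs es"
begin

text \<open>In this context non-hamiltonicity itself enters only here; every later contradiction is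
  reduced to this one.\<close>

lemma no_closing_edge:
  assumes h: "ham_path v e" and f: "f \<in> free_edges e" "v 1 \<in> f"
  shows "v n \<notin> f"
proof
  assume vn: "v n \<in> f"
  note H = hpD[OF h]
  define vs where "vs = map v [1..<Suc n]"
  define es where "es = map e [1..<n] @ [f]"
  have n: "1 < n" using n4 by simp
  have "hamiltonian_berge_cycle V E vs es"
    unfolding hamiltonian_berge_cycle_def berge_cycle_def
  proof (intro conjI allI impI)
    show "length vs = card V" "length es = card V" unfolding vs_def es_def using cardV n by auto
    have "set [1..<Suc n] = {1..n}" by auto
    then show "distinct vs" unfolding vs_def distinct_map
      using H(1) by (simp add: bij_betw_def del: upt_Suc)
    show "distinct es" unfolding es_def using H(2) f unfolding distinct_append distinct_map free_edges_def
      by auto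
    show "set vs \<subseteq> V" unfolding vs_def using H(7) by auto
    show "set es \<subseteq> E" unfolding es_def using H(3) f Fr_sub by auto
    fix i assume i: "i < card V"
    have vs_nth: "j < n \<Longrightarrow> vs ! j = v (Suc j)" for j unfolding vs_def by (simp del: upt_Suc)
    show "{vs ! i, vs ! ((i + 1) mod card V)} \<subseteq> es ! i"
    proof (cases "i + 1 = n")
      case True
      then have "es ! i = f" unfolding es_def using n by (subst nth_append) auto
      moreover have "vs ! i = v n" "vs ! ((i + 1) mod card V) = v 1"
        using vs_nth[of i] vs_nth[of 0] True cardV n by auto
      ultimately show ?thesis using vn f by auto
    next
      case False
      then have i': "i + 1 < n" using i cardV by simp
      then have "es ! i = e (Suc i)" unfolding es_def by (subst nth_append) auto
      then show ?thesis using vs_nth[of i] vs_nth[of "i + 1"] i' cardV H(4)[of "Suc i"] H(5)[of "Suc i"]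
        by auto
    qed
  qed
  then show False using nonham by blast
qed

text \<open>Rotating at \<open>i\<close> makes v_i the first vertex and keeps v_n, so a free edge
  through v_i and v_n would close the rotated path. The rotation has not consumed that edge, because
  a free edge at v_1 misses v_n.\<close>

lemma XK_disjoint: 
  assumes h: "ham_path v e" and i: "i \<in> NI v e \<union> BI v e"
  shows "i \<notin> NK v e"
proof
  assume "i \<in> NK v e"
  then obtain g where g: "g \<in> free_edges e" "v n \<in> g" "v i \<in> g" by (auto simp: NK_def)
  have i1: "1 \<le> i" "i < n" using i by (auto simp: NI_def BI_def)
  from i show False
  proof
    assume "i \<in> NI v e"
    then obtain f where f: "f \<in> free_edges e" "v 1 \<in> f" "v (Suc i) \<in> f" by (auto simp: NI_def)
    note R = hp_rot_free[OF h i1 f]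
    have "g \<noteq> f" using no_closing_edge[OF h f(1,2)] g by auto
    then have "g \<in> free_edges (rote i f e)" using R g by auto
    from no_closing_edge[OF R(1) this] g i1 show False by (simp add: rotv_def)
  next
    assume "i \<in> BI v e"
    then have "v 1 \<in> e i" by (simp add: BI_def)
    note R = hp_rot_same[OF h i1 this]
    have "g \<in> free_edges (rote i (e i) e)" using R g by auto
    from no_closing_edge[OF R(1) this] g i1 show False by (simp add: rotv_def)
  qed
qed

text \<open>Here the closing edge is e_i, released by rotating along a free edge. For
  \<open>i\<close> in \<open>BI\<close> the rotation along e_i releases nothing, which is why
  \<open>BI\<close> and \<open>BK\<close> may still meet.\<close>

lemma NI_BK_disjoint:
  assumes h: "ham_path v e" and i: "i \<in> NI v e"
  shows "i \<notin> BK v e"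
proof
  assume "i \<in> BK v e"
  then have g: "v n \<in> e i" and i1: "1 \<le> i" "i < n" by (auto simp: BK_def)
  from i obtain f where f: "f \<in> free_edges e" "v 1 \<in> f" "v (Suc i) \<in> f" by (auto simp: NI_def)
  note R = hp_rot_free[OF h i1 f]
  have "e i \<noteq> f" using path_edge_not_free[OF i1] f by blast
  then have "e i \<in> free_edges (rote i f e)" using R(2) by blast
  from no_closing_edge[OF R(1) this] g i1 hpD(4)[OF h i1] show False by (simp add: rotv_def)
qed

end

context unif
begin

lemma card_path_edges: "ham_path v e \<Longrightarrow> card (e ` {1..<n}) = n - 1"
  using hpD(2) by (simp add: card_image)

lemma card_Fr: "ham_path v e \<Longrightarrow> card (free_edges e) + (n - 1) = card E"
  using card_path_edges[of v e] hpD(3)[of v e] finE unfolding free_edges_def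
  by (metis card_Diff_subset card_mono finite_imageI finite_atLeastLessThan le_add_diff_inverse2)

lemma finite_edge: "f \<in> E \<Longrightarrow> finite f"
  using EV finV finite_subset by blast

lemma edge_start_card:
  assumes h: "ham_path v e" and f: "f \<in> E" "v 1 \<in> f"
  shows "f = insert (v 1) ((\<lambda>i. v (Suc i)) ` {i \<in> {1..<n}. v (Suc i) \<in> f})"
    "card {i \<in> {1..<n}. v (Suc i) \<in> f} = r - 1"
proof -
  note H = hpD[OF h]
  let ?I = "{i \<in> {1..<n}. v (Suc i) \<in> f}"
  show eq: "f = insert (v 1) ((\<lambda>i. v (Suc i)) ` ?I)"
  proof
    show "f \<subseteq> insert (v 1) ((\<lambda>i. v (Suc i)) ` ?I)"
    proof
      fix y assume y: "y \<in> f"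
      then obtain j where j: "1 \<le> j" "j \<le> n" "y = v j" using hp_idx[OF h] EV f by blast
      show "y \<in> insert (v 1) ((\<lambda>i. v (Suc i)) ` ?I)"
      proof (cases "j = 1")
        case False
        then have "Suc (j - 1) = j" "j - 1 \<in> {1..<n}" using j by auto
        then have "j - 1 \<in> ?I" using y j by auto
        moreover have "y = v (Suc (j - 1))" using \<open>Suc (j - 1) = j\<close> j by simp
        ultimately show ?thesis by (intro insertI2 image_eqI)
      qed (use j in simp)
    qed
  qed (use f in auto)
  have inj: "inj_on (\<lambda>i. v (Suc i)) ?I"
    using H(8) by (auto simp: inj_on_def)
  have "v 1 \<notin> (\<lambda>i. v (Suc i)) ` ?I"
  proof
    assume "v 1 \<in> (\<lambda>i. v (Suc i)) ` ?I"
    then obtain i where "i \<in> {1..<n}" "v 1 = v (Suc i)" by blast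
    then show False using H(8)[of 1 "Suc i"] by auto
  qed
  moreover have "finite ((\<lambda>i. v (Suc i)) ` ?I)" by simp
  ultimately have "card (insert (v 1) ((\<lambda>i. v (Suc i)) ` ?I)) = Suc (card ?I)"
    using card_image[OF inj] by simp
  then have "card f = Suc (card ?I)" using eq by simp
  then show "card ?I = r - 1" using Er f by simp
qed

lemma hdegree_start_eq:
  "ham_path v e \<Longrightarrow> hdegree E (v 1) = card {f \<in> free_edges e. v 1 \<in> f} + card (BI v e)"
  using hdegree_split[of v e "v 1"] by (simp add: BI_def)

lemma card_v_image: "ham_path v e \<Longrightarrow> A \<subseteq> {1..n} \<Longrightarrow> card (v ` A) = card A"
  using hpD(1) by (metis bij_betw_def card_image inj_on_subset)

lemma v_mem_image:
  "ham_path v e \<Longrightarrow> 1 \<le> i \<Longrightarrow> i \<le> n \<Longrightarrow> A \<subseteq> {1..n} \<Longrightarrow> v i \<in> v ` A \<longleftrightarrow> i \<in> A"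
  by (rule inj_on_image_mem_iff[OF bij_betw_imp_inj_on[OF hpD(1)]]) auto

lemma BI_sub: "BI v e \<subseteq> {1..n}" by (auto simp: BI_def)

lemma edge_end_card:
  assumes h: "ham_path v e" and f: "f \<in> E" "v n \<in> f"
  shows "f = insert (v n) (v ` {i \<in> {1..<n}. v i \<in> f})"
    "card {i \<in> {1..<n}. v i \<in> f} = r - 1"
proof -
  note H = hpD[OF h]
  let ?I = "{i \<in> {1..<n}. v i \<in> f}"
  show eq: "f = insert (v n) (v ` ?I)"
  proof
    show "f \<subseteq> insert (v n) (v ` ?I)"
    proof
      fix y assume y: "y \<in> f"
      then obtain j where j: "1 \<le> j" "j \<le> n" "y = v j" using hp_idx[OF h] EV f by blast
      then show "y \<in> insert (v n) (v ` ?I)" using y by (cases "j = n") auto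
    qed
  qed (use f in auto)
  have c: "card (v ` ?I) = card ?I" by (rule card_v_image[OF h]) auto
  have "v n \<notin> v ` ?I"
  proof
    assume "v n \<in> v ` ?I"
    then obtain i where "i \<in> {1..<n}" "v n = v i" by blast
    then show False using H(8)[of n i] by auto
  qed
  moreover have "finite (v ` ?I)" by simp
  ultimately have "card (insert (v n) (v ` ?I)) = Suc (card ?I)" using c by simp
  then have "card f = Suc (card ?I)" using eq by simp
  then show "card ?I = r - 1" using Er f by simp
qed

end

context nonham
begin

text \<open>In the conditions \<open>k\<close> the letter \<open>h\<close> stands for an edge. It is
  free after the rotation and contains the new start v_i, so \<open>l\<close> becomes a free index
  of the start; positions beyond \<open>i\<close> and free edges at v_n are unaffected.\<close>

lemma rot_free_NK:
  assumes h: "ham_path v e" and i: "1 \<le> i" "i < n" and f: "f \<in> free_edges e" "v 1 \<in> f" "v (Suc i) \<in> f"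
    and k: "h \<in> insert (e i) (free_edges e)" "h \<noteq> f" "v i \<in> h" "v (Suc l) \<in> h" "i < l" "l < n"
  shows "l \<notin> NK v e"
proof
  assume "l \<in> NK v e"
  then obtain g where g: "g \<in> free_edges e" "v n \<in> g" "v l \<in> g" by (auto simp: NK_def)
  note R = hp_rot_free[OF h i f]
  have "g \<noteq> f" using no_closing_edge[OF h f(1,2)] g by auto
  then have g': "g \<in> free_edges (rote i f e)" using R(2) g by auto
  have k': "h \<in> free_edges (rote i f e)" using R(2) k by auto
  have "l \<in> NI (rotv i v) (rote i f e)"
    using k' k i by (auto simp: NI_def rotv_def intro!: bexI[of _ h])
  moreover have "l \<in> NK (rotv i v) (rote i f e)"
    using g' g k i by (auto simp: NK_def rotv_def intro!: bexI[of _ g])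
  ultimately show False using XK_disjoint[OF R(1)] by blast
qed

text \<open>Rotating at 1 moves no vertex; it only replaces \<open>e 1\<close> by \<open>f\<close>
  between v_1 and v_2. After this exchange the vertices of \<open>e 1\<close> are free neighbours of
  v_1.\<close>

lemma swap_first:
  assumes h: "ham_path v e" and f: "f \<in> free_edges e" "v 1 \<in> f" "v 2 \<in> f"
    and l: "1 \<le> l" "l < n" "v (Suc l) \<in> e 1"
  shows "l \<notin> NK v e"
proof (cases "l = 1")
  case True
  have "1 \<in> BI v e" using hpD(4)[OF h, of 1] n4 by (auto simp: BI_def)
  then show ?thesis using XK_disjoint[OF h] True by blast
next
  case False
  have "e 1 \<noteq> f" using f path_edge_not_free[of 1 e] n4 by auto
  then show ?thesis
    using rot_free_NK[OF h, of 1 f "e 1" l] f l False hpD(4)[OF h, of 1] n4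
    by (auto simp: numeral_2_eq_2)
qed

lemma NI_NK_disjoint: "ham_path v e \<Longrightarrow> NI v e \<inter> NK v e = {}"
  using XK_disjoint by blast

lemma one_in_BI: "ham_path v e \<Longrightarrow> 1 \<in> BI v e" "ham_path v e \<Longrightarrow> n - 1 \<in> BK v e"
  using hpD(4)[of v e 1] hpD(5)[of v e "n - 1"] n4 by (auto simp: BI_def BK_def)

end

section \<open>Large rank\<close>

locale large_rank = nonham +
  assumes nr: "n \<le> 2 * r" and deg: "\<And>x. x \<in> V \<Longrightarrow> r \<le> hdegree E x"
begin

lemma card_E: "n \<le> card E"
proof -
  have "n * r \<le> (\<Sum>x\<in>V. hdegree E x)"
    using sum_bounded_below[of V r "hdegree E"] deg cardV by simp
  then have "n * r \<le> card E * r" using sum_hdegree by (simp add: mult.commute)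
  then show ?thesis using r3 by simp
qed

lemma Fr_nonempty: "ham_path v e \<Longrightarrow> \<exists>f. f \<in> free_edges e"
  using card_Fr[of v e] card_E n4 by (metis One_nat_def add_0 card.empty diff_less ex_in_conv
      less_le_trans not_less order_less_le_trans zero_less_one zero_less_numeral)

text \<open>If neither end has a free edge, all of the at least r edges at v_1 lie on the path, and
  rotations along them bring r different vertices to the front while the free edges stay the same. A
  free edge has too many vertices to avoid these r and v_n when n <= 2r.\<close>

lemma end_free:
  assumes h: "ham_path v e"
  shows "\<exists>v' e'. ham_path v' e' \<and> (\<exists>g\<in>free_edges e'. v' n \<in> g)"
proof (cases "(\<exists>f\<in>free_edges e. v 1 \<in> f) \<or> (\<exists>g\<in>free_edges e. v n \<in> g)")
  case True
  then show ?thesis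
  proof
    assume "\<exists>f\<in>free_edges e. v 1 \<in> f"
    then have "ham_path (revv v) (reve e) \<and> (\<exists>g\<in>free_edges (reve e). revv v n \<in> g)"
      using hp_rev[OF h] by (simp add: revv_def)
    then show ?thesis by blast
  qed (use h in blast)
next
  case False
  obtain f where f: "f \<in> free_edges e" using Fr_nonempty[OF h] by blast
  have "{f \<in> free_edges e. v 1 \<in> f} = {}" using False by auto
  then have "card {f \<in> free_edges e. v 1 \<in> f} = 0" by (metis card.empty)
  then have "r \<le> card (BI v e)"
    using hdegree_start_eq[OF h] deg[of "v 1"] hpD(7)[OF h, of 1] n4 by linarith
  show ?thesis
  proof (cases "\<exists>i\<in>BI v e. v i \<in> f")
    case True
    then obtain i where i: "i \<in> BI v e" "v i \<in> f" by blast
    then have i': "1 \<le> i" "i < n" "v 1 \<in> e i" by (auto simp: BI_def)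
    note R = hp_rot_same[OF h i']
    note RR = hp_rev[OF R(1)]
    have "revv (rotv i v) n = v i" using i' by (simp add: revv_def rotv_def)
    then show ?thesis using RR R(2) f i by metis
  next
    case no: False
    have "f \<subseteq> V - insert (v n) (v ` BI v e)"
      using f False no EV Fr_sub by blast
    then have "r \<le> card (V - insert (v n) (v ` BI v e))"
      using Er[OF Fr_sub[OF f]] finV by (metis card_mono finite_Diff)
    also have "insert (v n) (v ` BI v e) = v ` insert n (BI v e)" by simp
    also have "card (V - v ` insert n (BI v e)) = n - card (v ` insert n (BI v e))"
      using finV cardV hpD(7)[OF h] n4 by (subst card_Diff_subset) (auto simp: BI_def)
    also have "card (v ` insert n (BI v e)) = Suc (card (BI v e))"
      using n4 by (subst card_v_image[OF h]) (auto simp: BI_def)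
    finally show ?thesis using \<open>r \<le> card (BI v e)\<close> nr r3 by linarith
  qed
qed

text \<open>Fix the free edge \<open>g\<close> at v_n. While the start has no free edge, it lies in
  at least r path edges, whose indices avoid the r - 1 indices of \<open>g\<close>. This forces n =
  2r and makes \<open>BI\<close> the exact complement. The same rigidity holds for all paths with
  these free edges and this end, and rotations contradict it.\<close>

lemma both_free:
  assumes h: "ham_path v e" and g: "g \<in> free_edges e" "v n \<in> g"
  shows "\<exists>v' e'. ham_path v' e' \<and> (\<exists>f\<in>free_edges e'. v' 1 \<in> f) \<and> (\<exists>g\<in>free_edges e'. v' n \<in> g)"
proof (rule ccontr)
  assume no: "\<not> ?thesis"
  have gE: "g \<in> E" using g Fr_sub by blast
  have key: "BI v' e' = {1..<n} - {j \<in> {1..<n}. v' j \<in> g} \<and> n = 2 * r"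
    if h': "ham_path v' e'" "free_edges e' = free_edges e" "v' n = v n" for v' e'
  proof -
    let ?K = "{j \<in> {1..<n}. v' j \<in> g}"
    have "?K \<subseteq> NK v' e'" using h' g by (auto simp: NK_def)
    then have sub: "BI v' e' \<subseteq> {1..<n} - ?K"
      using XK_disjoint[OF h'(1)] by (auto simp: BI_def)
    have "\<not> (\<exists>f\<in>free_edges e'. v' 1 \<in> f)" using no h' g by metis
    then have "{f \<in> free_edges e'. v' 1 \<in> f} = {}" by auto
    then have "card {f \<in> free_edges e'. v' 1 \<in> f} = 0" by (metis card.empty)
    then have b: "r \<le> card (BI v' e')"
      using hdegree_start_eq[OF h'(1)] deg[of "v' 1"] hpD(7)[OF h'(1), of 1] n4 by linarith
    have c: "card ({1..<n} - ?K) = n - 1 - (r - 1)"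
      using edge_end_card(2)[OF h'(1) gE] g h' by (subst card_Diff_subset) auto
    then have "n = 2 * r" "card ({1..<n} - ?K) \<le> card (BI v' e')"
      using b card_mono[OF _ sub] nr r3 by auto
    then show ?thesis using sub by (metis card_seteq finite_Diff finite_atLeastLessThan)
  qed
  have k0: "BI v e = {1..<n} - {j \<in> {1..<n}. v j \<in> g}" and n2r: "n = 2 * r"
    using key[OF h refl refl] by auto
  define T where "T = v ` BI v e"
  have "card (BI v e) = n - 1 - (r - 1)"
    unfolding k0 using edge_end_card(2)[OF h gE g(2)] by (subst card_Diff_subset) auto
  moreover have "card T = card (BI v e)"
    unfolding T_def by (rule card_v_image[OF h]) (auto simp: BI_def)
  ultimately have cT: "card T = r" using n2r r3 by simp
  have 1: "1 \<in> BI v e" using one_in_BI[OF h] by simp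
  \<comment> \<open>Rotating at a smaller index of \<open>BI\<close> leaves position j in place, so
    by rigidity \<open>e j\<close> contains every vertex of \<open>T\<close>. As \<open>T\<close>
    has r elements, \<open>e j = T\<close>; but \<open>e j\<close> also contains v_(j+1), so j + 1
    would lie in \<open>BI\<close>.\<close>
  define j where "j = Max (BI v e)"
  have jB: "j \<in> BI v e" unfolding j_def using 1 by (intro Max_in) auto
  have jmax: "i \<in> BI v e \<Longrightarrow> i \<le> j" for i unfolding j_def by simp
  have j: "1 \<le> j" "j < n" using jB by (auto simp: BI_def)
  have "T \<subseteq> e j"
  proof
    fix x assume "x \<in> T"
    then obtain i where i: "i \<in> BI v e" "x = v i" unfolding T_def by blast
    show "x \<in> e j"
    proof (cases "i = j")
      case True then show ?thesis using hpD(4)[OF h] i j by simp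
    next
      case False
      then have ij: "i < j" using jmax[OF i(1)] by simp
      have i': "1 \<le> i" "i < n" "v 1 \<in> e i" using i by (auto simp: BI_def)
      note R = hp_rot_same[OF h i']
      have k: "BI (rotv i v) (rote i (e i) e) = {1..<n} - {j \<in> {1..<n}. rotv i v j \<in> g}"
        using key[OF R] i' by (auto simp: rotv_def[of i v n])
      have "j \<notin> {j \<in> {1..<n}. v j \<in> g}" using k0 jB by blast
      then have "j \<in> BI (rotv i v) (rote i (e i) e)"
        unfolding k using j ij by (simp add: rotv_def)
      then show ?thesis using ij i i' by (simp add: BI_def rotv_def rote_def)
    qed
  qed
  then have "e j = T" using cT Er[of "e j"] hpD(6)[OF h j] finite_edge
    by (metis card_subset_eq)
  then have s: "v (Suc j) \<in> T" using hpD(5)[OF h j] by simp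
  then have "Suc j \<in> BI v e"
    unfolding T_def using v_mem_image[OF h _ _ BI_sub] j by auto
  then show False using jmax by fastforce
qed

text \<open>\<open>NI\<close> is exactly the index set of \<open>f\<close>, and it contains 1.
  Exchanging \<open>f\<close> and \<open>e 1\<close> shows that the indices of \<open>e 1\<close>
  avoid \<open>NK\<close> as well; so they lie in \<open>NI\<close> and
  \<open>e 1 = f\<close>.\<close>

lemma tight_false:
  assumes h: "ham_path v e" and f: "f \<in> free_edges e" "v 1 \<in> f" and t: "NI v e \<union> NK v e = {1..<n}"
    and c: "card (NI v e) = r - 1"
  shows False
proof -
  have fE: "f \<in> E" using f Fr_sub by blast
  let ?I = "\<lambda>f. {i \<in> {1..<n}. v (Suc i) \<in> f}"
  have "?I f \<subseteq> NI v e" using f by (auto simp: NI_def)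
  then have If: "?I f = NI v e" using edge_start_card(2)[OF h fE f(2)] c by (metis card_subset_eq idx_fin(1))
  have 1: "1 \<in> NI v e" using t XK_disjoint[OF h] one_in_BI[OF h] n4 by fastforce
  have f2: "v 2 \<in> f" using 1 If by (auto simp: numeral_2_eq_2)
  have "?I (e 1) \<subseteq> NI v e" using swap_first[OF h f f2] t by auto
  then have "?I (e 1) \<subseteq> ?I f" using If by simp
  moreover have e1: "e 1 \<in> E" "v 1 \<in> e 1" using hpD[OF h] n4 by auto
  ultimately have "e 1 \<subseteq> f"
    using edge_start_card(1)[OF h e1] edge_start_card(1)[OF h fE f(2)] by blast
  then have "e 1 = f" using Er e1 fE finite_edge by (metis card_subset_eq)
  then show False using f path_edge_not_free[of 1 e] n4 by simp
qed

text \<open>The tight argument with one index \<open>q\<close> left over: \<open>e 1\<close> differs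
  from \<open>f\<close>, and \<open>q\<close> is the only index by which it can differ.\<close>

lemma spare_in_first:
  assumes h: "ham_path v e" and f: "f \<in> free_edges e" "v 1 \<in> f"
    and t: "{1..<n} - (NI v e \<union> NK v e) = {q}"
    and c: "card (NI v e) = r - 1" and 1: "1 \<in> NI v e"
  shows "v 2 \<in> f" "v (Suc q) \<in> e 1"
proof -
  have fE: "f \<in> E" using f Fr_sub by blast
  let ?I = "\<lambda>f. {i \<in> {1..<n}. v (Suc i) \<in> f}"
  have "?I f \<subseteq> NI v e" using f by (auto simp: NI_def)
  then have If: "?I f = NI v e" using edge_start_card(2)[OF h fE f(2)] c by (metis card_subset_eq idx_fin(1))
  show f2: "v 2 \<in> f" using 1 If by (auto simp: numeral_2_eq_2)
  show "v (Suc q) \<in> e 1"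
  proof (rule ccontr)
    assume q: "v (Suc q) \<notin> e 1"
    have "?I (e 1) \<subseteq> NI v e"
    proof
      fix x assume x: "x \<in> ?I (e 1)"
      then have "x \<notin> NK v e" "x \<noteq> q" using swap_first[OF h f f2] q by auto
      then show "x \<in> NI v e" using t x by blast
    qed
    then have "?I (e 1) \<subseteq> ?I f" using If by simp
    moreover have e1: "e 1 \<in> E" "v 1 \<in> e 1" using hpD[OF h] n4 by auto
    ultimately have "e 1 \<subseteq> f"
      using edge_start_card(1)[OF h e1] edge_start_card(1)[OF h fE f(2)] by blast
    then have "e 1 = f" using Er e1 fE finite_edge by (metis card_subset_eq)
    then show False using f path_edge_not_free[of 1 e] n4 by simp
  qed
qed

lemma no_ham_path:
  assumes h0: "ham_path v0 e0"
  shows False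
proof -
  obtain v e f g where h: "ham_path v e" and f: "f \<in> free_edges e" "v 1 \<in> f" and g: "g \<in> free_edges e" "v n \<in> g"
    using end_free[OF h0] both_free by metis
  have fE: "f \<in> E" "g \<in> E" using f g Fr_sub by auto
  note hr = hp_rev[OF h]
  have fr: "f \<in> free_edges (reve e)" "g \<in> free_edges (reve e)" "revv v n \<in> f" "revv v 1 \<in> g"
    using f g hr by (auto simp: revv_def)
  have "{i \<in> {1..<n}. v (Suc i) \<in> f} \<subseteq> NI v e" "{i \<in> {1..<n}. v i \<in> g} \<subseteq> NK v e"
    using f g by (auto simp: NI_def NK_def)
  then have c1: "r - 1 \<le> card (NI v e)" "r - 1 \<le> card (NK v e)"
    using edge_start_card(2)[OF h fE(1) f(2)] edge_end_card(2)[OF h fE(2) g(2)]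
    by (metis card_mono idx_fin(1), metis card_mono idx_fin(3))
  have d: "NI v e \<inter> NK v e = {}" by (rule NI_NK_disjoint[OF h])
  have un: "NI v e \<union> NK v e \<subseteq> {1..<n}" using idx_sub by blast
  have cs: "card (NI v e \<union> NK v e) = card (NI v e) + card (NK v e)"
    using d by (simp add: card_Un_disjoint)
  have c2: "card (NI v e) + card (NK v e) \<le> n - 1"
    using card_mono[OF _ un] cs by simp
  have flip: "(\<lambda>i. n - i) ` {1..<n} = {1..<n}"
  proof
    show "{1..<n} \<subseteq> (\<lambda>i. n - i) ` {1..<n}"
    proof
      fix x assume "x \<in> {1..<n}"
      then have "x = n - (n - x)" "n - x \<in> {1..<n}" by auto
      then show "x \<in> (\<lambda>i. n - i) ` {1..<n}" by blast
    qed
  qed auto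
  show False
  proof (cases "card (NI v e) + card (NK v e) = n - 1")
    case True
    then have t: "NI v e \<union> NK v e = {1..<n}" using un cs by (simp add: card_subset_eq)
    have "card (NI v e) = r - 1 \<or> card (NK v e) = r - 1" using True c1 nr by linarith
    then show False
    proof
      assume "card (NI v e) = r - 1"
      then show False using tight_false[OF h f t] by simp
    next
      assume c: "card (NK v e) = r - 1"
      have "NI (revv v) (reve e) \<union> NK (revv v) (reve e) = {1..<n}"
        unfolding NI_rev[OF h] using t flip by (metis image_Un sup_commute)
      then show False using tight_false[OF hr(1) fr(2,4)] c card_rev[OF h] by simp
    qed
  next
    case False
    \<comment> \<open>The sum is at least 2(r - 1), and now at most n - 2 <= 2r - 2.\<close>
    then have c3: "card (NI v e) = r - 1" "card (NK v e) = r - 1" "n = 2 * r"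
      using c1 c2 nr by linarith+
    have "card ({1..<n} - (NI v e \<union> NK v e)) = n - 1 - (r - 1 + (r - 1))"
      using un cs c3(1,2) by (subst card_Diff_subset) auto
    then have "card ({1..<n} - (NI v e \<union> NK v e)) = 1" using c3(3) r3 by simp
    then obtain q where q: "{1..<n} - (NI v e \<union> NK v e) = {q}" by (meson card_1_singletonE)
    then have qn: "1 \<le> q" "q < n" by auto
    have "inj_on (\<lambda>i. n - i) {1..<n}" by (auto simp: inj_on_def)
    from inj_on_image_set_diff[OF this Diff_subset un]
    have "(\<lambda>i. n - i) ` ({1..<n} - (NI v e \<union> NK v e)) = {1..<n} - (\<lambda>i. n - i) ` (NI v e \<union> NK v e)"
      unfolding flip .
    then have qr: "{1..<n} - (NI (revv v) (reve e) \<union> NK (revv v) (reve e)) = {n - q}"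
      unfolding NI_rev[OF h] q by (auto simp: image_Un)
    have B: "1 \<notin> NK v e" "n - 1 \<notin> NI v e"
      using XK_disjoint[OF h] NI_BK_disjoint[OF h] one_in_BI[OF h] by blast+
    have first: "v 2 \<in> f" "v (Suc q) \<in> e 1" if "q \<noteq> 1"
    proof -
      have "1 \<in> NI v e" using q B that n4 by fastforce
      then show "v 2 \<in> f" "v (Suc q) \<in> e 1" using spare_in_first[OF h f q c3(1)] by auto
    qed
    have last: "v (n - 1) \<in> g" "v q \<in> e (n - 1)" if "q \<noteq> n - 1"
    proof -
      have "n - 1 \<in> {1..<n} - (NI v e \<union> NK v e) \<or> n - 1 \<in> NK v e" using B n4 by auto
      then have "n - 1 \<in> NK v e" unfolding q using that by auto
      then have "n - (n - 1) \<in> NI (revv v) (reve e)" unfolding NI_rev[OF h] by blast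
      then have "1 \<in> NI (revv v) (reve e)" using n4 by simp
      from spare_in_first[OF hr(1) fr(2,4) qr _ this] card_rev[OF h] c3
      have "revv v 2 \<in> g" "revv v (Suc (n - q)) \<in> reve e 1" by auto
      then show "v (n - 1) \<in> g" "v q \<in> e (n - 1)" using qn by (auto simp: revv_def reve_def)
    qed
    consider "q = 1" | "q = n - 1" | "q \<noteq> 1" "q \<noteq> n - 1" by blast
    then show False
    proof cases
      case 1
      then have l: "v (n - 1) \<in> g" "v 1 \<in> e (n - 1)" using last n4 by auto
      then have "n - 1 \<in> BI v e" "n - 1 \<in> NK v e" using g n4 by (auto simp: BI_def NK_def)
      then show False using XK_disjoint[OF h] by blast
    next
      case 2
      then have l: "v 2 \<in> f" "v n \<in> e 1" using first n4 by auto
      then have "1 \<in> BK v e" "1 \<in> NI v e" using f n4 by (auto simp: BK_def NI_def numeral_2_eq_2)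
      then show False using NI_BK_disjoint[OF h] by blast
    next
      case 3
      note F = first[OF 3(1)] and L = last[OF 3(2)]
      have nn: "1 < n" using n4 by simp
      have F2: "v (Suc 1) \<in> f" using F by (simp add: numeral_2_eq_2)
      \<comment> \<open>Both exchanges are carried out: \<open>f\<close> against \<open>e 1\<close>
        and, after reversal, \<open>g\<close> against \<open>e (n - 1)\<close>. No vertex moves, and
        the two released edges join v_1 to v_(q+1) and v_n to v_q. The common index reads n - q
        because the final path is reversed.\<close>
      define v1 e1 where "v1 = rotv 1 v" and "e1 = rote 1 f e"
      have v1: "v1 j = v j" if "1 \<le> j" for j using that unfolding v1_def rotv_def by auto
      have R: "ham_path v1 e1" "free_edges e1 = insert (e 1) (free_edges e) - {f}"
        using hp_rot_free[OF h order_refl nn f F2] unfolding v1_def e1_def by auto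
      have gf: "g \<noteq> f" using no_closing_edge[OF h f] g by auto
      note S = hp_rev[OF R(1)]
      have g1: "g \<in> free_edges (reve e1)" "revv v1 1 \<in> g" "revv v1 (Suc 1) \<in> g"
        using S R g gf v1 L n4 by (auto simp: revv_def)
      note T = hp_rot_free[OF S(1) order_refl nn g1]
      have ee: "reve e1 1 = e (n - 1)" using n4 by (auto simp: reve_def e1_def rote_def)
      define v2 e2 where "v2 = rotv 1 (revv v1)" and "e2 = rote 1 g (reve e1)"
      have v2: "v2 j = v (n + 1 - j)" if "1 \<le> j" "j \<le> n" for j
        using that v1[of "n + 1 - j"] unfolding v2_def rotv_def revv_def by auto
      have F2: "free_edges e2 = insert (e (n - 1)) (insert (e 1) (free_edges e) - {f}) - {g}"
        using T(2) S(2) R(2) ee unfolding e2_def by simp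
      have nf: "e 1 \<noteq> f" "e 1 \<noteq> g" "e (n - 1) \<noteq> g"
        using f g path_edge_not_free[of 1 e] path_edge_not_free[of "n - 1" e] n4 by auto
      have "e 1 \<in> free_edges e2" "e (n - 1) \<in> free_edges e2" using F2 nf by auto
      moreover have "v2 n \<in> e 1" "v2 (n - q) \<in> e 1" "v2 1 \<in> e (n - 1)" "v2 (Suc (n - q)) \<in> e (n - 1)"
        using v2[of n] v2[of "n - q"] v2[of 1] v2[of "Suc (n - q)"] F L qn
          hpD(4)[OF h, of 1] hpD(5)[OF h, of "n - 1"] n4 by auto
      moreover have "n - q \<in> {1..<n}" using qn by auto
      ultimately have "n - q \<in> NI v2 e2" "n - q \<in> NK v2 e2" unfolding NI_def NK_def by blast+
      then show False using NI_NK_disjoint[OF T(1)] unfolding v2_def e2_def by blast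
    qed
  qed
qed

end

section \<open>Cycles missing one vertex\<close>

declare One_nat_def [simp del]

context unif
begin

text \<open>A near-cycle misses exactly the vertex \<open>w\<close>; positions on it are counted from 0 modulo $n - 1$.\<close>

definition sc :: "nat \<Rightarrow> nat" where "sc i = Suc i mod (n - 1)"

definition near_cycle :: "'a \<Rightarrow> (nat \<Rightarrow> 'a) \<Rightarrow> (nat \<Rightarrow> 'a set) \<Rightarrow> bool" where
  "near_cycle w u c \<longleftrightarrow> w \<in> V \<and> bij_betw u {..<n - 1} (V - {w}) \<and> inj_on c {..<n - 1} \<and>
     c ` {..<n - 1} \<subseteq> E \<and> (\<forall>i<n - 1. u i \<in> c i \<and> u (sc i) \<in> c i)"

definition off_cycle :: "(nat \<Rightarrow> 'a set) \<Rightarrow> 'a set set" where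
  "off_cycle c = E - c ` {..<n - 1}"

lemma cycD:
  assumes "near_cycle w u c"
  shows "w \<in> V" "bij_betw u {..<n - 1} (V - {w})" "inj_on c {..<n - 1}" "c ` {..<n - 1} \<subseteq> E"
    "\<And>i. i < n - 1 \<Longrightarrow> u i \<in> c i" "\<And>i. i < n - 1 \<Longrightarrow> u (sc i) \<in> c i"
    "\<And>i. i < n - 1 \<Longrightarrow> c i \<in> E" "\<And>i. i < n - 1 \<Longrightarrow> u i \<in> V" "\<And>i. i < n - 1 \<Longrightarrow> u i \<noteq> w"
    "\<And>i j. i < n - 1 \<Longrightarrow> j < n - 1 \<Longrightarrow> u i = u j \<longleftrightarrow> i = j"
    "\<And>i j. i < n - 1 \<Longrightarrow> j < n - 1 \<Longrightarrow> c i = c j \<longleftrightarrow> i = j"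
proof -
  show b: "w \<in> V" "bij_betw u {..<n - 1} (V - {w})" "inj_on c {..<n - 1}" "c ` {..<n - 1} \<subseteq> E"
    "\<And>i. i < n - 1 \<Longrightarrow> u i \<in> c i" "\<And>i. i < n - 1 \<Longrightarrow> u (sc i) \<in> c i"
    "\<And>i. i < n - 1 \<Longrightarrow> c i \<in> E"
    using assms unfolding near_cycle_def by auto
  have "u i \<in> V - {w}" if "i < n - 1" for i using b(2) that unfolding bij_betw_def by blast
  then show "\<And>i. i < n - 1 \<Longrightarrow> u i \<in> V" "\<And>i. i < n - 1 \<Longrightarrow> u i \<noteq> w" by auto
  show "\<And>i j. i < n - 1 \<Longrightarrow> j < n - 1 \<Longrightarrow> u i = u j \<longleftrightarrow> i = j"
    using bij_betw_imp_inj_on[OF b(2)] by (auto dest: inj_onD)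
  show "\<And>i j. i < n - 1 \<Longrightarrow> j < n - 1 \<Longrightarrow> c i = c j \<longleftrightarrow> i = j"
    using b(3) by (auto dest: inj_onD)
qed

lemma sc_lt [simp]: "sc i < n - 1" using n4 by (simp add: sc_def)

lemma sc_simps: "Suc i < n - 1 \<Longrightarrow> sc i = Suc i" "Suc i = n - 1 \<Longrightarrow> sc i = 0"
  by (auto simp: sc_def)

lemma sc_cases: "i < n - 1 \<Longrightarrow> sc i = (if Suc i = n - 1 then 0 else Suc i)"
  using sc_simps by (metis Suc_lessI)

lemma sc_inj: "i < n - 1 \<Longrightarrow> j < n - 1 \<Longrightarrow> sc i = sc j \<longleftrightarrow> i = j"
  by (auto simp: sc_cases split: if_splits)

lemma sc_surj: "j < n - 1 \<Longrightarrow> \<exists>i<n - 1. sc i = j"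
proof (cases j)
  case 0
  have "n - 2 < n - 1" "sc (n - 2) = 0" using n4 by (auto simp: sc_cases)
  then show ?thesis using 0 by blast
next
  case (Suc i)
  assume "j < n - 1"
  then have "i < n - 1" "sc i = j" using Suc by (auto simp: sc_cases)
  then show ?thesis by blast
qed

lemma sc_neq: "i < n - 1 \<Longrightarrow> sc i \<noteq> i" "i < n - 1 \<Longrightarrow> sc (sc i) \<noteq> i"
  using n4 by (auto simp: sc_cases split: if_splits)

definition pm :: "nat set \<Rightarrow> nat set" where "pm A = {i \<in> {..<n - 1}. sc i \<in> A}"

lemma pm_sub: "pm A \<subseteq> {..<n - 1}" by (auto simp: pm_def)
lemma pm_fin [simp]: "finite (pm A)" by (auto simp: pm_def)

lemma sc_image_pm: "A \<subseteq> {..<n - 1} \<Longrightarrow> sc ` pm A = A"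
  using sc_surj by (fastforce simp: pm_def)

lemma card_pm: "A \<subseteq> {..<n - 1} \<Longrightarrow> card (pm A) = card A"
proof -
  assume A: "A \<subseteq> {..<n - 1}"
  have "inj_on sc (pm A)" by (auto simp: pm_def inj_on_def sc_inj)
  then show ?thesis using sc_image_pm[OF A] by (metis card_image)
qed

text \<open>Predecessors of any element lead down to 0, wrap around to n - 2 and from there reach
  every position.\<close>

lemma pm_closed:
  assumes "A \<subseteq> {..<n - 1}" "pm A \<subseteq> A" "A \<noteq> {}"
  shows "A = {..<n - 1}"
proof -
  obtain a where a: "a \<in> A" using assms by blast
  then have aL: "a < n - 1" using assms by auto
  have step: "Suc i \<in> A \<Longrightarrow> i \<in> A" if "Suc i < n - 1" for i
    using assms(2) that by (auto simp: pm_def sc_simps)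
  have down: "j - k \<in> A" if "j \<in> A" "j < n - 1" for j k
  proof (induction k)
    case (Suc k)
    show ?case
    proof (cases "j - k")
      case (Suc m)
      then have "m \<in> A" using step[of m] Suc.IH that by auto
      moreover have "j - Suc k = m" using Suc by simp
      ultimately show ?thesis by simp
    qed (use Suc.IH in simp)
  qed (use that in simp)
  have "0 \<in> A" using down[OF a aL, of a] by simp
  moreover have "sc (n - 2) = 0" using n4 by (auto simp: sc_cases)
  ultimately have "n - 2 \<in> A" using assms(2) n4 by (auto simp: pm_def)
  have "i \<in> A" if "i < n - 1" for i
  proof -
    have "n - 2 - (n - 2 - i) = i" using that by simp
    then show ?thesis using down[OF \<open>n - 2 \<in> A\<close>, of "n - 2 - i"] n4 by simp
  qed
  then show ?thesis using assms(1) by auto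
qed

lemma card_pm_gt:
  assumes "A \<subseteq> {..<n - 1}" "A \<noteq> {}" "A \<noteq> {..<n - 1}"
  shows "card A < card (A \<union> pm A)"
proof (rule psubset_card_mono)
  show "finite (A \<union> pm A)" using assms by (simp add: finite_subset)
  show "A \<subset> A \<union> pm A" using pm_closed[OF assms(1)] assms by blast
qed

definition sh :: "nat \<Rightarrow> nat \<Rightarrow> nat" where "sh a i = (i + a) mod (n - 1)"
definition mi :: "nat \<Rightarrow> nat" where "mi i = n - 2 - i"
text \<open>Edges need their own reflection because c_i sits between u_i and u_(i+1): the new edge i
  is the old edge n - 3 - i, and the wrap-around edge c_(n-2) stays in place.\<close>

definition mi' :: "nat \<Rightarrow> nat" where "mi' i = (if i = n - 2 then n - 2 else n - 3 - i)"

lemma sh_lt [simp]: "sh a i < n - 1" using n4 by (simp add: sh_def)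

lemma sh_inj: "i < n - 1 \<Longrightarrow> j < n - 1 \<Longrightarrow> sh a i = sh a j \<Longrightarrow> i = j"
proof -
  have *: "i = j" if "i \<le> j" "j < n - 1" "sh a i = sh a j" for i j
  proof -
    have "n - 1 dvd (j + a) - (i + a)"
      using that unfolding sh_def by (metis mod_eq_dvd_iff_nat add_le_mono1)
    then have "n - 1 dvd j - i" by simp
    moreover have "j - i < n - 1" using that by simp
    ultimately have "j - i = 0" by (meson dvd_imp_le not_less neq0_conv)
    then show ?thesis using that by simp
  qed
  assume "i < n - 1" "j < n - 1" "sh a i = sh a j"
  then show "i = j" using *[of i j] *[of j i] by (cases "i \<le> j") auto
qed

lemma cyc_shift:
  fixes a defines "s \<equiv> sh a"
  assumes h: "near_cycle w u c"
  shows "near_cycle w (u \<circ> s) (c \<circ> s)" "off_cycle (c \<circ> s) = off_cycle c" "\<And>i. s (sc i) = sc (s i)"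
    "bij_betw s {..<n - 1} {..<n - 1}"
proof -
  note H = cycD[OF h]
  have L: "0 < n - 1" using n4 by simp
  show ss: "\<And>i. s (sc i) = sc (s i)"
    unfolding s_def sh_def sc_def by (simp add: mod_simps)
  have inj: "inj_on s {..<n - 1}"
    using sh_inj unfolding s_def by (auto simp: inj_on_def)
  have sub: "s ` {..<n - 1} \<subseteq> {..<n - 1}" unfolding s_def by auto
  show bs: "bij_betw s {..<n - 1} {..<n - 1}"
    unfolding bij_betw_def using inj sub by (metis endo_inj_surj finite_lessThan)
  have im: "s ` {..<n - 1} = {..<n - 1}" using bs by (simp add: bij_betw_def)
  have slt: "s i < n - 1" for i unfolding s_def by simp
  have im2: "(c \<circ> s) ` {..<n - 1} = c ` {..<n - 1}" using im unfolding image_comp[symmetric] by simp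
  then show "off_cycle (c \<circ> s) = off_cycle c" unfolding off_cycle_def by simp
  have "inj_on (c \<circ> s) {..<n - 1}" using inj H(3) im by (simp add: comp_inj_on)
  moreover have "bij_betw (u \<circ> s) {..<n - 1} (V - {w})" using bs H(2) by (rule bij_betw_trans)
  ultimately show "near_cycle w (u \<circ> s) (c \<circ> s)"
    unfolding near_cycle_def using H(1,4,5,6) im2 slt ss by auto
qed

lemma cyc_mirror:
  defines "s \<equiv> mi" and "s' \<equiv> mi'"
  assumes h: "near_cycle w u c"
  shows "near_cycle w (u \<circ> s) (c \<circ> s')" "off_cycle (c \<circ> s') = off_cycle c"
    "\<And>i. i < n - 1 \<Longrightarrow> sc (s' i) = s i" "\<And>i. i < n - 1 \<Longrightarrow> s (sc i) = s' i"
    "\<And>i. i < n - 1 \<Longrightarrow> s i < n - 1" "\<And>i. i < n - 1 \<Longrightarrow> s' i < n - 1"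
    "\<And>i. i < n - 1 \<Longrightarrow> s (s i) = i" "\<And>i. i < n - 1 \<Longrightarrow> s' (s' i) = i"
proof -
  note H = cycD[OF h]
  show 1: "\<And>i. i < n - 1 \<Longrightarrow> s i < n - 1" "\<And>i. i < n - 1 \<Longrightarrow> s' i < n - 1"
    "\<And>i. i < n - 1 \<Longrightarrow> s (s i) = i" "\<And>i. i < n - 1 \<Longrightarrow> s' (s' i) = i"
    unfolding s_def s'_def mi_def mi'_def using n4 by auto
  show 2: "\<And>i. i < n - 1 \<Longrightarrow> sc (s' i) = s i" "\<And>i. i < n - 1 \<Longrightarrow> s (sc i) = s' i"
    unfolding s_def s'_def mi_def mi'_def using n4 by (auto simp: sc_cases)
  have bs: "bij_betw s {..<n - 1} {..<n - 1}" "bij_betw s' {..<n - 1} {..<n - 1}"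
    by (rule bij_betw_byWitness[where f' = s]; simp add: 1 image_subset_iff)
       (rule bij_betw_byWitness[where f' = s']; simp add: 1 image_subset_iff)
  have im2: "(c \<circ> s') ` {..<n - 1} = c ` {..<n - 1}" using bs(2) unfolding image_comp[symmetric] by (simp add: bij_betw_def)
  then show "off_cycle (c \<circ> s') = off_cycle c" unfolding off_cycle_def by simp
  have "inj_on (c \<circ> s') {..<n - 1}" using bs(2) H(3) by (simp add: comp_inj_on bij_betw_def)
  moreover have "bij_betw (u \<circ> s) {..<n - 1} (V - {w})" using bs(1) H(2) by (rule bij_betw_trans)
  moreover have "u (s i) \<in> c (s' i) \<and> u (s (sc i)) \<in> c (s' i)" if "i < n - 1" for i
    using H(5)[of "s' i"] H(6)[of "s' i"] 1(2)[OF that] 2[OF that] by simp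
  ultimately show "near_cycle w (u \<circ> s) (c \<circ> s')"
    unfolding near_cycle_def using H(1,4) im2 by auto
qed

text \<open>The cycle is opened at c_(n-2) and w is put in front of u_0. The opened edge may itself
  be used as \<open>l\<close>, and then no edge is released.\<close>

lemma cyc_path:
  assumes h: "near_cycle w u c" and l: "l \<in> insert (c (n - 2)) (off_cycle c)" "w \<in> l" "u 0 \<in> l"
  defines "v \<equiv> \<lambda>j. if j = 1 then w else u (j - 2)" and "e \<equiv> \<lambda>j. if j = 1 then l else c (j - 2)"
  shows "ham_path v e" "free_edges e = insert (c (n - 2)) (off_cycle c) - {l}"
proof -
  note H = cycD[OF h]
  have n2: "n - 2 < n - 1" using n4 by simp
  have lE: "l \<in> E" using l H(7)[OF n2] by (auto simp: off_cycle_def)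
  have lc: "l \<noteq> c j" if "j < n - 2" for j
  proof -
    have "j < n - 1" "j \<noteq> n - 2" using that by auto
    then show ?thesis using l H(11)[OF n2, of j] by (auto simp: off_cycle_def)
  qed
  have im: "e ` {1..<n} = insert l (c ` {..<n - 2})"
  proof
    show "e ` {1..<n} \<subseteq> insert l (c ` {..<n - 2})" unfolding e_def by force
    show "insert l (c ` {..<n - 2}) \<subseteq> e ` {1..<n}"
    proof
      fix x assume "x \<in> insert l (c ` {..<n - 2})"
      then show "x \<in> e ` {1..<n}"
      proof
        assume "x = l"
        then have "x = e 1" unfolding e_def by simp
        then show ?thesis using n4 by auto
      next
        assume "x \<in> c ` {..<n - 2}"
        then obtain k where k: "k < n - 2" "x = c k" by auto
        then have "x = e (k + 2)" "k + 2 \<in> {1..<n}" unfolding e_def using n4 by auto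
        then show ?thesis by blast
      qed
    qed
  qed
  have inj: "inj_on e {1..<n}"
  proof (rule inj_onI)
    fix x y assume xy: "x \<in> {1..<n}" "y \<in> {1..<n}" "e x = e y"
    have a: "x \<noteq> 1 \<Longrightarrow> x - 2 < n - 2" "y \<noteq> 1 \<Longrightarrow> y - 2 < n - 2" using xy by auto
    show "x = y"
    proof (cases "x = 1 \<or> y = 1")
      case True
      then show ?thesis using xy a lc[of "x - 2"] lc[of "y - 2"] by (auto simp: e_def split: if_splits)
    next
      case False
      then have "c (x - 2) = c (y - 2)" using xy by (simp add: e_def)
      then have "x - 2 = y - 2" using H(11)[of "x - 2" "y - 2"] a False by auto
      then show ?thesis using False xy by auto
    qed
  qed
  have bij: "bij_betw v {1..n} V"
    unfolding bij_betw_def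
  proof
    show "inj_on v {1..n}"
    proof (rule inj_onI)
      fix x y assume xy: "x \<in> {1..n}" "y \<in> {1..n}" "v x = v y"
      have a: "x \<noteq> 1 \<Longrightarrow> x - 2 < n - 1" "y \<noteq> 1 \<Longrightarrow> y - 2 < n - 1" using xy n4 by auto
      show "x = y"
      proof (cases "x = 1 \<or> y = 1")
        case True
        then show ?thesis using xy a H(9)[of "x - 2"] H(9)[of "y - 2"] by (auto simp: v_def split: if_splits)
      next
        case False
        then have "u (x - 2) = u (y - 2)" using xy by (simp add: v_def)
        then have "x - 2 = y - 2" using H(10)[of "x - 2" "y - 2"] a False by auto
        then show ?thesis using False xy by auto
      qed
    qed
    show "v ` {1..n} = V"
    proof
      show "v ` {1..n} \<subseteq> V"
      proof
        fix x assume "x \<in> v ` {1..n}"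
        then obtain j where "j \<in> {1..n}" "x = v j" by blast
        then show "x \<in> V" using H(1) H(8)[of "j - 2"] n4 by (auto simp: v_def)
      qed
      show "V \<subseteq> v ` {1..n}"
      proof
        fix x assume x: "x \<in> V"
        show "x \<in> v ` {1..n}"
        proof (cases "x = w")
          case True
          then have "x = v 1" by (simp add: v_def)
          then show ?thesis using n4 by auto
        next
          case False
          then have "x \<in> u ` {..<n - 1}" using H(2) x by (simp add: bij_betw_def)
          then obtain k where "k < n - 1" "x = u k" by auto
          then have "x = v (k + 2)" "k + 2 \<in> {1..n}" by (auto simp: v_def)
          then show ?thesis by blast
        qed
      qed
    qed
  qed
  have inc: "\<forall>i\<in>{1..<n}. v i \<in> e i \<and> v (Suc i) \<in> e i"
  proof
    fix i assume i: "i \<in> {1..<n}"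
    show "v i \<in> e i \<and> v (Suc i) \<in> e i"
    proof (cases "i = 1")
      case True then show ?thesis using l by (simp add: v_def e_def)
    next
      case False
      then have "i - 2 < n - 1" "sc (i - 2) = Suc i - 2" using i by (auto simp: sc_cases)
      then show ?thesis using H(5)[of "i - 2"] H(6)[of "i - 2"] False i by (auto simp: v_def e_def)
    qed
  qed
  show "ham_path v e" unfolding ham_path_def using bij inj inc im lE H(4) by auto
  have eq: "{..<n - 1} = insert (n - 2) {..<n - 2}" using n4 by auto
  have "c (n - 2) \<notin> c ` {..<n - 2}"
  proof
    assume "c (n - 2) \<in> c ` {..<n - 2}"
    then obtain k where "k < n - 2" "c (n - 2) = c k" by auto
    then show False using H(11)[OF n2, of k] by auto
  qed
  then show "free_edges e = insert (c (n - 2)) (off_cycle c) - {l}"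
    unfolding free_edges_def off_cycle_def im eq using H(7)[OF n2] by auto
qed

definition NC :: "'a \<Rightarrow> (nat \<Rightarrow> 'a) \<Rightarrow> (nat \<Rightarrow> 'a set) \<Rightarrow> nat set" where
  "NC w u c = {i \<in> {..<n - 1}. \<exists>f\<in>off_cycle c. w \<in> f \<and> u i \<in> f}"
definition BC :: "'a \<Rightarrow> (nat \<Rightarrow> 'a set) \<Rightarrow> nat set" where
  "BC w c = {i \<in> {..<n - 1}. w \<in> c i}"

lemma hdegree_cyc:
  assumes "near_cycle w u c"
  shows "hdegree E x = card {f \<in> off_cycle c. x \<in> f} + card (BC x c)"
proof -
  note H = cycD[OF assms]
  have "{f \<in> E. x \<in> f} = {f \<in> off_cycle c. x \<in> f} \<union> c ` BC x c"
    using H(4) unfolding off_cycle_def BC_def by auto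
  moreover have "{f \<in> off_cycle c. x \<in> f} \<inter> c ` BC x c = {}" unfolding off_cycle_def BC_def by auto
  moreover have "card (c ` BC x c) = card (BC x c)"
    by (rule card_image) (rule inj_on_subset[OF H(3)], auto simp: BC_def)
  moreover have "finite {f \<in> off_cycle c. x \<in> f}" "finite (c ` BC x c)"
    using finE by (auto simp: off_cycle_def BC_def)
  ultimately show ?thesis unfolding hdegree_def by (simp add: card_Un_disjoint)
qed

lemma card_CF:
  assumes "near_cycle w u c" shows "card (off_cycle c) + (n - 1) = card E"
proof -
  note H = cycD[OF assms]
  have "card (c ` {..<n - 1}) = n - 1" using H(3) by (simp add: card_image)
  then show ?thesis using H(4) finE unfolding off_cycle_def
    by (metis card_Diff_subset card_mono finite_imageI finite_lessThan le_add_diff_inverse2)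
qed

lemma cyc_idx:
  assumes "near_cycle w u c" "x \<in> V" "x \<noteq> w"
  obtains i where "i < n - 1" "x = u i"
  using cycD(2)[OF assms(1)] assms(2,3) unfolding bij_betw_def by blast

lemma card_u_image: "near_cycle w u c \<Longrightarrow> A \<subseteq> {..<n - 1} \<Longrightarrow> card (u ` A) = card A"
  using cycD(2) by (metis bij_betw_def card_image inj_on_subset)

definition J :: "(nat \<Rightarrow> 'a) \<Rightarrow> 'a set \<Rightarrow> nat set" where
  "J u f = {i \<in> {..<n - 1}. u i \<in> f}"

lemma J_sub: "J u f \<subseteq> {..<n - 1}" by (auto simp: J_def)
lemma J_fin [simp]: "finite (J u f)" by (auto simp: J_def)

lemma J_edge:
  assumes h: "near_cycle w u c" and f: "f \<in> E"
  shows "u ` J u f = f - {w}" "card (J u f) = (if w \<in> f then r - 1 else r)"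
proof -
  show e: "u ` J u f = f - {w}"
  proof
    show "u ` J u f \<subseteq> f - {w}" using cycD(9)[OF h] by (auto simp: J_def)
    show "f - {w} \<subseteq> u ` J u f"
    proof
      fix x assume x: "x \<in> f - {w}"
      then obtain i where "i < n - 1" "x = u i" using cyc_idx[OF h] EV f by blast
      then show "x \<in> u ` J u f" using x by (auto simp: J_def)
    qed
  qed
  have "card (J u f) = card (f - {w})" using card_u_image[OF h J_sub, of u f] e by simp
  then show "card (J u f) = (if w \<in> f then r - 1 else r)"
    using Er[OF f] by (simp add: card_Diff_singleton)
qed

end

section \<open>What non-hamiltonicity forbids around a near-cycle\<close>

context nonham
begin

text \<open>The two edges would insert w between u_i and its successor in place of c_i. One of them
  may be c_i.\<close>

lemma cyc_link:
  assumes h: "near_cycle w u c" and i: "i < n - 1"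
    and l: "l \<in> insert (c i) (off_cycle c)" "w \<in> l" "u (sc i) \<in> l"
    and k: "k \<in> insert (c i) (off_cycle c)" "k \<noteq> l" "w \<in> k" "u i \<in> k"
  shows False
proof -
  define s where "s = sh (sc i)"
  note S = cyc_shift[OF h, of "sc i", folded s_def]
  have s0: "s 0 = sc i" using sc_lt[of i] by (simp add: s_def sh_def)
  have sl: "s (n - 2) = i"
  proof -
    have "sc (n - 2) = 0" using n4 by (auto simp: sc_cases)
    then have "sc (s (n - 2)) = sc i" using S(3)[of "n - 2"] s0 by metis
    moreover have "s (n - 2) < n - 1" unfolding s_def by simp
    ultimately show ?thesis using sc_inj i by simp
  qed
  have l': "l \<in> insert ((c \<circ> s) (n - 2)) (off_cycle (c \<circ> s))" "(u \<circ> s) 0 \<in> l"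
    using l S(2) sl s0 by auto
  note P = cyc_path[OF S(1) l'(1) l(2) l'(2)]
  from no_closing_edge[OF P(1), of k] show False
    unfolding P(2) using k S(2) sl n4 by auto
qed

text \<open>Dirac's picture: cut the cycle at c_i and c_j, join w by \<open>l\<close> and
  \<open>m\<close> to the two successors, and let \<open>k\<close> join u_i and u_j. The cut edges
  may be reused as links or as \<open>k\<close>.\<close>

lemma cyc_indep:
  assumes h: "near_cycle w u c" and i: "i < n - 1" and j: "j < n - 1" "j \<noteq> i"
    and l: "l \<in> insert (c i) (off_cycle c)" "w \<in> l" "u (sc i) \<in> l"
    and m: "m \<in> insert (c j) (off_cycle c)" "w \<in> m" "u (sc j) \<in> m" "m \<noteq> l"
    and k: "k \<in> insert (c i) (insert (c j) (off_cycle c))" "k \<noteq> l" "k \<noteq> m" "u i \<in> k" "u j \<in> k"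
  shows False
proof -
  define s where "s = sh (sc i)"
  note S = cyc_shift[OF h, of "sc i", folded s_def]
  have s0: "s 0 = sc i" using sc_lt[of i] by (simp add: s_def sh_def)
  have sl: "s (n - 2) = i"
  proof -
    have "sc (n - 2) = 0" using n4 by (auto simp: sc_cases)
    then have "sc (s (n - 2)) = sc i" using S(3)[of "n - 2"] s0 by metis
    moreover have "s (n - 2) < n - 1" unfolding s_def by simp
    ultimately show ?thesis using sc_inj i by simp
  qed
  have "j \<in> s ` {..<n - 1}" using S(4) j by (simp add: bij_betw_def)
  then obtain p where p: "p < n - 1" "s p = j" by auto
  have pn: "p \<noteq> n - 2" using p sl j by auto
  then have "Suc p < n - 1" using p by linarith
  then have sp: "s (Suc p) = sc j" using S(3)[of p] p sc_simps(1)[of p] by simp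
  have l': "l \<in> insert ((c \<circ> s) (n - 2)) (off_cycle (c \<circ> s))" "(u \<circ> s) 0 \<in> l"
    using l S(2) sl s0 by auto
  define v where "v = (\<lambda>j. if j = 1 then w else (u \<circ> s) (j - 2))"
  define e where "e = (\<lambda>j. if j = 1 then l else (c \<circ> s) (j - 2))"
  note P0 = cyc_path[OF S(1) l'(1) l(2) l'(2), folded v_def e_def]
  have P: "ham_path v e" "free_edges e = insert (c i) (off_cycle c) - {l}"
    by (fact P0(1)) (use P0(2) S(2) sl in \<open>simp add: comp_def\<close>)
  \<comment> \<open>u_j has position p on the shifted cycle. The path has w in front and counts from
    1, hence p + 2.\<close>
  have q: "1 \<le> p + 2" "p + 2 < n" using p pn by auto
  have ep: "e (p + 2) = c j" using p by (simp add: e_def)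
  have mm: "m \<in> insert (e (p + 2)) (free_edges e)" using m P(2) ep by auto
  have "m \<in> E" using m cycD(7)[OF h] j by (auto simp: off_cycle_def)
  moreover have "m \<notin> e ` ({1..<n} - {p + 2})"
  proof
    assume "m \<in> e ` ({1..<n} - {p + 2})"
    then obtain x where x: "x \<in> {1..<n}" "x \<noteq> p + 2" "m = e x" by blast
    show False
    proof (cases "m = e (p + 2)")
      case True then show False using hpD(9)[OF P(1), of x "p + 2"] x q by auto
    next
      case False then show False using mm x path_edge_not_free[of x e] by auto
    qed
  qed
  moreover have "v 1 \<in> m" "v (Suc (p + 2)) \<in> m" using m sp by (auto simp: v_def)
  ultimately have R: "ham_path (rotv (p + 2) v) (rote (p + 2) m e)"
    "free_edges (rote (p + 2) m e) = insert (e (p + 2)) (free_edges e) - {m}"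
    using hp_rot[OF P(1) q] by auto
  have "k \<in> free_edges (rote (p + 2) m e)" unfolding R(2) ep P(2) using k by auto
  moreover have "rotv (p + 2) v 1 = u j" "rotv (p + 2) v n = u i"
    using q p sl n4 by (auto simp: rotv_def v_def)
  ultimately show False using no_closing_edge[OF R(1)] k by auto
qed

text \<open>The mirror image: w is linked to u_i and u_j, and their successors cannot be
  joined.\<close>

lemma cyc_indep':
  assumes h: "near_cycle w u c" and i: "i < n - 1" and j: "j < n - 1" "j \<noteq> i"
    and l: "l \<in> insert (c i) (off_cycle c)" "w \<in> l" "u i \<in> l"
    and m: "m \<in> insert (c j) (off_cycle c)" "w \<in> m" "u j \<in> m" "m \<noteq> l"
    and k: "k \<in> insert (c i) (insert (c j) (off_cycle c))" "k \<noteq> l" "k \<noteq> m" "u (sc i) \<in> k" "u (sc j) \<in> k"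
  shows False
proof -
  define s where "s = mi"
  define s' where "s' = mi'"
  note S = cyc_mirror[OF h, folded s_def s'_def]
  let ?i = "s' i" and ?j = "s' j"
  have ss: "s (sc (s' i)) = i" "s (sc (s' j)) = j" "s (s' i) = sc i" "s (s' j) = sc j"
  proof -
    show "s (sc (s' i)) = i" "s (sc (s' j)) = j" using S(3,7) i j by auto
    show "s (s' i) = sc i" using S(4)[OF i] S(7)[OF sc_lt[of i]] by simp
    show "s (s' j) = sc j" using S(4)[OF j(1)] S(7)[OF sc_lt[of j]] by simp
  qed
  have "?j \<noteq> ?i" using S(8)[OF i] S(8)[OF j(1)] j(2) by metis
  then show False
    using cyc_indep[OF S(1) S(6)[OF i] S(6)[OF j(1)], of l m k] l m k
    unfolding S(2) comp_apply ss S(8)[OF i] S(8)[OF j(1)] by blast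
qed

end

section \<open>Binomial estimates\<close>

lemma choose_ge: "1 \<le> k \<Longrightarrow> k < m \<Longrightarrow> m \<le> m choose k"
proof (induction m arbitrary: k)
  case (Suc m)
  obtain k' where k: "k = Suc k'" using Suc.prems by (cases k) auto
  show ?case
  proof (cases "k = m")
    case True then show ?thesis by (simp add: k)
  next
    case False
    then have "m \<le> m choose k" using Suc by simp
    moreover have "1 \<le> m choose k'" using Suc.prems k by (simp add: Suc_le_eq One_nat_def)
    ultimately show ?thesis by (simp add: k)
  qed
qed simp

text \<open>A comparison with C(m,2), doubled to avoid division. In the base case m = k + 2 the two
  sides agree by symmetry.\<close>

lemma choose_ge_two: "2 \<le> k \<Longrightarrow> k + 2 \<le> m \<Longrightarrow> m * (m - 1) \<le> 2 * (m choose k)"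
proof (induction m)
  case (Suc m)
  obtain k' where k: "k = Suc k'" using Suc.prems by (cases k) auto
  show ?case
  proof (cases "k + 2 \<le> m")
    case True
    then have "m * (m - 1) \<le> 2 * (m choose k)" using Suc by simp
    moreover have "m \<le> m choose k'" using Suc.prems k by (intro choose_ge) auto
    ultimately have "m * (m - 1) + 2 * m \<le> 2 * (Suc m choose k)" by (simp add: k)
    moreover have "Suc m * (Suc m - 1) \<le> m * (m - 1) + 2 * m" by (cases m) auto
    ultimately show ?thesis by linarith
  next
    case False
    then have "Suc m = k + 2" using Suc.prems by simp
    then have "Suc m choose k = (Suc m choose 2)" using binomial_symmetric[of 2 "Suc m"] by simp
    then show ?thesis by (simp add: choose_two)
  qed
qed simp

text \<open>By Pascal each step from m to t adds j choose (r - 2) >= j, hence at least 2, and at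
  least 3 once m >= r (next lemma). The factor is measured against a count in which each free
  neighbour of w blocks two cycle indices.\<close>

lemma choose_step:
  assumes "3 \<le> r" "r - 1 \<le> m" "m \<le> t"
  shows "(m choose (r - 1)) + 2 * (t - m) \<le> t choose (r - 1)"
  using assms(3,2)
proof (induction t rule: dec_induct)
  case (step j)
  have s: "r - 1 = Suc (r - 2)" using assms by simp
  have "j \<le> j choose (r - 2)" using assms step by (intro choose_ge) auto
  then have "2 \<le> j choose (r - 2)" using step assms by linarith
  then have "(j choose (r - 1)) + 2 \<le> Suc j choose (r - 1)" unfolding s by simp
  then show ?case using step by (simp add: Suc_diff_le)
qed simp

lemma choose_step3:
  assumes "3 \<le> r" "r \<le> m" "m \<le> t"
  shows "(m choose (r - 1)) + 3 * (t - m) \<le> t choose (r - 1)"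
  using assms(3,2)
proof (induction t rule: dec_induct)
  case (step j)
  have s: "r - 1 = Suc (r - 2)" using assms by simp
  have "j \<le> j choose (r - 2)" using assms step by (intro choose_ge) auto
  then have "3 \<le> j choose (r - 2)" using step assms by linarith
  then have "(j choose (r - 1)) + 3 \<le> Suc j choose (r - 1)" unfolding s by simp
  then show ?case using step by (simp add: Suc_diff_le)
qed simp

lemma choose_lower:
  assumes "3 \<le> r" "r < (t::nat)"
  shows "t * (t - 1) \<le> 2 * (t choose (r - 1))"
  using assms by (intro choose_ge_two) auto

lemma choose_top: "3 \<le> (t::nat) \<Longrightarrow> t choose (t - 1) = t"
  using binomial_symmetric[of 1 t] by (simp add: One_nat_def)

lemma choose_lin:
  assumes "3 \<le> r" "r \<le> (t::nat)"
  shows "2 * t - r \<le> t choose (r - 1)"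
proof (cases "r = t")
  case True then show ?thesis using choose_top[of t] assms by simp
next
  case False
  then have r: "r < t" using assms by simp
  obtain k where k: "t = k + 4" using r assms by (intro that[of "t - 4"]) simp
  have "t * (t - 1) \<le> 2 * (t choose (r - 1))" using choose_lower[OF assms(1) r] .
  moreover have "2 * (2 * t - 3) \<le> t * (t - 1)" unfolding k by (simp add: algebra_simps)
  ultimately show ?thesis using assms by linarith
qed

section \<open>Excluding cycles of length $n - 1$\<close>

locale dirac = nonham +
  fixes t :: nat
  assumes rt: "r \<le> t" and nt: "n = 2 * t + 1 \<or> n = 2 * t + 2"
    and deg: "\<And>x. x \<in> V \<Longrightarrow> (t choose (r - 1)) + 1 \<le> hdegree E x"

context unif
begin

text \<open>Index i stands for the cycle edge between u_i and its successor, so \<open>tc A\<close>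
  consists of the cycle edges at the positions in \<open>A\<close>. For free neighbours of w these
  are the edges that cannot contain w.\<close>

definition tc :: "nat set \<Rightarrow> nat set" where "tc A = A \<union> pm A"

lemma tc_disj:
  assumes "A \<subseteq> {..<n - 1}" "A' \<subseteq> {..<n - 1}" "A \<inter> A' = {}"
    "\<And>a. a \<in> A \<Longrightarrow> sc a \<notin> A'" "\<And>a. a \<in> A' \<Longrightarrow> sc a \<notin> A"
  shows "tc A \<inter> tc A' = {}"
  using assms by (auto simp: tc_def pm_def)

lemma tc_sub: "A \<subseteq> {..<n - 1} \<Longrightarrow> tc A \<subseteq> {..<n - 1}"
  by (auto simp: tc_def pm_def)

lemma tc_pair:
  assumes i: "i < n - 1" shows "card (tc {i, sc i}) = 3"
proof -
  obtain p where p: "p < n - 1" "sc p = i" using sc_surj[OF i] by blast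
  have "pm {i, sc i} = {p, i}" using p i sc_inj by (auto simp: pm_def)
  then have "tc {i, sc i} = {p, i, sc i}" by (auto simp: tc_def)
  moreover have "p \<noteq> i" "p \<noteq> sc i" "i \<noteq> sc i" using p i sc_neq by metis+
  ultimately show ?thesis by simp
qed

lemma tc_indep:
  assumes "A \<subseteq> {..<n - 1}" "\<And>a. a \<in> A \<Longrightarrow> sc a \<notin> A"
  shows "card (tc A) = 2 * card A"
proof -
  have "A \<inter> pm A = {}" using assms by (auto simp: pm_def)
  then show ?thesis using assms card_pm[of A] finite_subset[OF assms(1)]
    by (simp add: tc_def card_Un_disjoint)
qed

end

context nonham
begin

text \<open>Otherwise c_i and a free edge at one of its two cycle vertices would insert w at
  i.\<close>

lemma BC_NC:
  assumes h: "near_cycle w u c" and i: "i \<in> BC w c"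
  shows "i \<notin> NC w u c" "sc i \<notin> NC w u c"
proof -
  have i': "i < n - 1" "w \<in> c i" using i by (auto simp: BC_def)
  have nf: "c i \<notin> off_cycle c" using i' by (auto simp: off_cycle_def)
  show "i \<notin> NC w u c"
  proof
    assume "i \<in> NC w u c"
    then obtain f where f: "f \<in> off_cycle c" "w \<in> f" "u i \<in> f" by (auto simp: NC_def)
    show False using cyc_link[OF h i'(1), of "c i" f] i' f nf cycD(6)[OF h i'(1)] by blast
  qed
  show "sc i \<notin> NC w u c"
  proof
    assume "sc i \<in> NC w u c"
    then obtain f where f: "f \<in> off_cycle c" "w \<in> f" "u (sc i) \<in> f" by (auto simp: NC_def)
    show False using cyc_link[OF h i'(1), of f "c i"] i' f nf cycD(5)[OF h i'(1)] by blast
  qed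
qed

lemma BC_tc:
  assumes h: "near_cycle w u c" and A: "A \<subseteq> NC w u c"
  shows "BC w c \<inter> tc A = {}"
  using BC_NC[OF h] A by (auto simp: tc_def pm_def)

lemma free_consec:
  assumes h: "near_cycle w u c" and f: "f \<in> off_cycle c" "w \<in> f" "f' \<in> off_cycle c" "w \<in> f'" "f \<noteq> f'"
    and a: "a \<in> J u f"
  shows "sc a \<notin> J u f'"
proof
  assume "sc a \<in> J u f'"
  then show False using cyc_link[OF h, of a f' f] f a by (auto simp: J_def)
qed

end

context dirac
begin

lemma t3: "3 \<le> t" using r3 rt by simp

lemma nt': "n - 1 \<le> 2 * t + 1" "2 * t \<le> n - 1" using nt by auto

text \<open>A free neighbour of w denies w the two cycle edges next to it. A free edge with two
  consecutive vertices (\<open>G1\<close>) needs only three indices for that pair, but by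
  \<open>free_consec\<close> the three are blocked by no other free edge. So the cost is 2 for each
  neighbour through \<open>G0\<close> and 3 for each edge in \<open>G1\<close>, and the degree of w
  can only just be paid for.\<close>

lemma cyc_two_free:
  assumes h: "near_cycle w u c" and d: "2 \<le> card {f \<in> off_cycle c. w \<in> f}"
  shows "n = 2 * t + 2 \<and> card (NC w u c) = t \<and> (\<forall>i\<in>NC w u c. sc i \<notin> NC w u c) \<and>
    card (BC w c) = 1 \<and> card {f \<in> off_cycle c. w \<in> f} = t choose (r - 1)"
proof -
  define G where "G = {f \<in> off_cycle c. w \<in> f}"
  define G1 where "G1 = {f \<in> G. \<exists>i\<in>J u f. sc i \<in> J u f}"
  define G0 where "G0 = G - G1"
  have finG: "finite G" using finE by (auto simp: G_def off_cycle_def)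
  have G: "f \<in> off_cycle c \<and> w \<in> f \<and> f \<in> E" if "f \<in> G" for f using that by (auto simp: G_def off_cycle_def)
  have fin: "finite G1" "finite G0" using finG by (auto simp: G1_def G0_def)
  have JN: "J u f \<subseteq> NC w u c" if "f \<in> G" for f using G[OF that] by (auto simp: J_def NC_def)
  have Jc: "card (J u f) = r - 1" if "f \<in> G" for f using J_edge(2)[OF h] G[OF that] by simp
  have F2: "sc a \<notin> J u f'" if "f \<in> G" "f' \<in> G" "f \<noteq> f'" "a \<in> J u f" for f f' a
    using free_consec[OF h, of f f' a] G[OF that(1)] G[OF that(2)] that(3,4) by simp
  define p where "p = (\<lambda>f. SOME i. i \<in> J u f \<and> sc i \<in> J u f)"
  have p: "p f \<in> J u f \<and> sc (p f) \<in> J u f" if "f \<in> G1" for f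
  proof -
    have "\<exists>i. i \<in> J u f \<and> sc i \<in> J u f" using that unfolding G1_def by blast
    then show ?thesis unfolding p_def by (rule someI_ex)
  qed
  define P where "P = (\<lambda>f. {p f, sc (p f)})"
  have Psub: "P f \<subseteq> J u f" if "f \<in> G1" for f using p[OF that] by (auto simp: P_def)
  have priv: "P f \<inter> J u f' = {}" if "f \<in> G1" "f' \<in> G" "f' \<noteq> f" for f f'
    using p[OF that(1)] F2[of f' f "p f"] F2[of f f' "p f"] that by (auto simp: P_def G1_def)
  have tcP: "tc (P f) \<inter> tc (J u f') = {}" if "f \<in> G1" "f' \<in> G" "f' \<noteq> f" for f f'
  proof (rule tc_disj)
    show "P f \<subseteq> {..<n - 1}" "J u f' \<subseteq> {..<n - 1}" using Psub[OF that(1)] J_sub by blast+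
    show "P f \<inter> J u f' = {}" by (rule priv[OF that])
    show "sc a \<notin> J u f'" if "a \<in> P f" for a
      using that F2[of f f' a] Psub \<open>f \<in> G1\<close> \<open>f' \<in> G\<close> \<open>f' \<noteq> f\<close> by (auto simp: G1_def)
    show "sc a \<notin> P f" if "a \<in> J u f'" for a
      using that F2[of f' f a] Psub \<open>f \<in> G1\<close> \<open>f' \<in> G\<close> \<open>f' \<noteq> f\<close> by (auto simp: G1_def)
  qed
  have tcPP: "tc (P f) \<inter> tc (P f') = {}" if "f \<in> G1" "f' \<in> G1" "f' \<noteq> f" for f f'
    using tcP[OF that(1), of f'] Psub[OF that(2)] that by (auto simp: tc_def pm_def G1_def)
  have cardU: "card (\<Union>f\<in>H. tc (P f)) = 3 * card H" if "H \<subseteq> G1" for H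
  proof -
    have "card (\<Union>f\<in>H. tc (P f)) = (\<Sum>f\<in>H. card (tc (P f)))"
      using that tcPP fin(1) by (intro card_UN_disjoint) (auto simp: tc_def P_def finite_subset)
    also have "\<dots> = (\<Sum>f\<in>H. 3)"
    proof (rule sum.cong[OF refl])
      fix f assume "f \<in> H"
      then have "p f < n - 1" using p[of f] that by (auto simp: J_def)
      then show "card (tc (P f)) = 3" unfolding P_def by (rule tc_pair)
    qed
    finally show ?thesis by simp
  qed
  define b where "b = card (BC w c)"
  have BCs: "BC w c \<subseteq> {..<n - 1}" by (auto simp: BC_def)
  have count: "b + (card (tc A) + 3 * card H) \<le> n - 1"
    if A: "A \<subseteq> NC w u c" and H: "H \<subseteq> G1" and AH: "\<And>f. f \<in> H \<Longrightarrow> tc A \<inter> tc (P f) = {}" for A H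
  proof -
    have NZ: "NC w u c \<subseteq> {..<n - 1}" by (auto simp: NC_def)
    have "P f \<subseteq> NC w u c" if "f \<in> H" for f using Psub[of f] JN[of f] H that by (auto simp: G1_def)
    then have 1: "BC w c \<inter> (tc A \<union> (\<Union>f\<in>H. tc (P f))) = {}"
      using BC_tc[OF h] A by blast
    have sub: "tc A \<subseteq> {..<n - 1}" "(\<Union>f\<in>H. tc (P f)) \<subseteq> {..<n - 1}"
      using tc_sub A NZ \<open>\<And>f. f \<in> H \<Longrightarrow> P f \<subseteq> NC w u c\<close> by (blast, meson UN_least subset_trans)
    have 2: "card (tc A \<union> (\<Union>f\<in>H. tc (P f))) = card (tc A) + 3 * card H"
      unfolding cardU[OF H, symmetric]
      using AH sub by (intro card_Un_disjoint) (auto intro: finite_subset)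
    have "card (BC w c \<union> (tc A \<union> (\<Union>f\<in>H. tc (P f)))) = b + (card (tc A) + 3 * card H)"
      unfolding 2[symmetric] b_def using 1 sub BCs
      by (intro card_Un_disjoint) (auto intro: finite_subset)
    moreover have "card (BC w c \<union> (tc A \<union> (\<Union>f\<in>H. tc (P f)))) \<le> card {..<n - 1}"
      using sub BCs by (intro card_mono) auto
    ultimately show ?thesis by simp
  qed
  have cG: "card G = card G0 + card G1"
  proof -
    have "G = G0 \<union> G1" "G0 \<inter> G1 = {}" by (auto simp: G0_def G1_def)
    then show ?thesis using fin card_Un_disjoint[of G0 G1] by simp
  qed
  have degw: "(t choose (r - 1)) + 1 \<le> card G0 + card G1 + b"
  proof -
    show ?thesis using deg[of w] hdegree_cyc[OF h, of w] cycD(1)[OF h] cG unfolding G_def b_def by simp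
  qed
  have dd: "2 \<le> card G0 + card G1"
    using d cG unfolding G_def by simp
  define N0 where "N0 = (\<Union>f\<in>G0. J u f)"
  have G0G: "f \<in> G" if "f \<in> G0" for f using that by (simp add: G0_def)
  have N0N: "N0 \<subseteq> NC w u c" using JN G0G by (auto simp: N0_def)
  have N0Z: "N0 \<subseteq> {..<n - 1}" using J_sub by (auto simp: N0_def)
  have N0c: "sc a \<notin> N0" if a: "a \<in> N0" for a
  proof
    assume "sc a \<in> N0"
    then obtain f f' where f: "f \<in> G0" "f' \<in> G0" "a \<in> J u f" "sc a \<in> J u f'" using a by (auto simp: N0_def)
    then show False using F2[of f f' a] by (cases "f = f'") (auto simp: G0_def G1_def)
  qed
  have tN0: "card (tc N0) = 2 * card N0" by (rule tc_indep[OF N0Z N0c])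
  have cG0: "card G0 \<le> card N0 choose (r - 1)"
  proof -
    have "card G0 \<le> card (u ` N0) choose (r - 1)"
    proof (rule card_star_le[where x = w])
      show "finite (u ` N0)" using N0Z finite_subset by blast
      fix f assume f: "f \<in> G0"
      then have "f - {w} = u ` J u f" using J_edge(1)[OF h, of f] G G0G by simp
      then show "f \<in> E \<and> w \<in> f \<and> f - {w} \<subseteq> u ` N0" using f G G0G by (auto simp: N0_def)
    qed
    then show ?thesis using card_u_image[OF h N0Z] by simp
  qed
  show ?thesis
  proof (cases "G0 = {}")
    case True
    then have "2 \<le> card G1" using dd by simp
    then obtain f0 where f0: "f0 \<in> G1" by fastforce
    then have f0G: "f0 \<in> G" by (simp add: G1_def)
    \<comment> \<open>Pairs alone are too cheap here, so one edge \<open>f0\<close> is counted with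
      all of its r - 1 positions; they block at least r indices.\<close>
    have "b + (card (tc (J u f0)) + 3 * card (G1 - {f0})) \<le> n - 1"
    proof (rule count)
      show "J u f0 \<subseteq> NC w u c" by (rule JN[OF f0G])
      show "tc (J u f0) \<inter> tc (P f) = {}" if "f \<in> G1 - {f0}" for f using tcP[of f f0] that f0G by auto
    qed auto
    moreover have "r \<le> card (tc (J u f0))"
    proof -
      have c: "card (J u f0) = r - 1" by (rule Jc[OF f0G])
      have "J u f0 \<noteq> {}" by (rule notI) (use c r3 in simp)
      moreover have "J u f0 \<noteq> {..<n - 1}" by (rule notI) (use c r3 rn in simp)
      ultimately have "card (J u f0) < card (tc (J u f0))" unfolding tc_def by (intro card_pm_gt J_sub)
      then show ?thesis using c by simp
    qed
    moreover have "card (G1 - {f0}) = card G1 - 1" using f0 fin by simp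
    ultimately have "card G1 + b + (r + 2 * card G1) \<le> n + 2" using \<open>2 \<le> card G1\<close> by linarith
    then have "(t choose (r - 1)) + 1 \<le> 2 * t - r"
      using degw True \<open>2 \<le> card G1\<close> nt' rt by simp
    then show ?thesis using choose_lin[OF r3 rt] by simp
  next
    case False
    then obtain f where f: "f \<in> G0" by blast
    have fN0: "finite N0" using N0Z finite_subset by blast
    have m0: "r - 1 \<le> card N0"
      using Jc[OF G0G[OF f]] card_mono[OF fN0, of "J u f"] f by (auto simp: N0_def)
    have cnt: "b + (2 * card N0 + 3 * card G1) \<le> n - 1"
      unfolding tN0[symmetric]
    proof (rule count[OF N0N order_refl])
      show "tc N0 \<inter> tc (P g) = {}" if "g \<in> G1" for g
      proof -
        have "tc (P g) \<inter> tc (J u f') = {}" if "f' \<in> G0" for f'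
          using tcP[OF \<open>g \<in> G1\<close> G0G[OF that]] that \<open>g \<in> G1\<close> by (auto simp: G0_def)
        then show ?thesis by (auto simp: tc_def pm_def N0_def)
      qed
    qed
    then have m0t: "card N0 \<le> t" using nt' by linarith
    \<comment> \<open>Each neighbour missing from t lowers the binomial by at least 2 and frees two
      indices. This balances exactly, so an edge of \<open>G1\<close>, which adds 1 to the degree at
      the price of 3, does not fit.\<close>
    have k0: "card G1 = 0"
    proof (rule ccontr)
      assume "card G1 \<noteq> 0"
      then show False using choose_step[OF r3 m0 m0t] cG0 degw cnt nt' m0t by linarith
    qed
    then have "card N0 \<noteq> r - 1" using dd cG0 by auto
    then have m0r: "r \<le> card N0" using m0 by simp
    \<comment> \<open>With at least two edges in \<open>G0\<close>, \<open>N0\<close> has at least r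
      elements. The binomial then drops by 3 for each missing neighbour, which two freed indices no
      longer make up for.\<close>
    have mt: "card N0 = t"
    proof (rule ccontr)
      assume "card N0 \<noteq> t"
      then show False using choose_step3[OF r3 m0r m0t] cG0 degw cnt nt' m0t k0 by linarith
    qed
    have "G1 = {}" using k0 fin by simp
    then have GG: "G0 = G" by (simp add: G0_def)
    have "NC w u c = N0"
      using N0N GG by (auto simp: N0_def G_def NC_def J_def)
    moreover have "b = 1" "card G0 = t choose (r - 1)" "n = 2 * t + 2"
      using degw cG0 cnt k0 mt nt by auto
    ultimately show ?thesis using mt N0c GG unfolding b_def G_def by auto
  qed
qed

text \<open>Equality means that the free edges at w are w together with all (r-1)-subsets of the t
  free neighbours, and that positions inside and outside \<open>NC\<close> alternate except at the
  single index \<beta>. Then no edge other than c_\<beta> contains two of the t + 2 vertices outside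
  the neighbourhood (w included). One of these vertices misses c_\<beta>, so all its edges live on
  the t neighbours.\<close>

lemma cyc_tight_false:
  assumes h: "near_cycle w u c" and n: "n = 2 * t + 2" and N: "card (NC w u c) = t"
    and nc: "\<And>i. i \<in> NC w u c \<Longrightarrow> sc i \<notin> NC w u c"
    and B: "card (BC w c) = 1" and G: "card {f \<in> off_cycle c. w \<in> f} = t choose (r - 1)"
  shows False
proof -
  let ?N = "NC w u c"
  note H = cycD[OF h]
  have NZ: "?N \<subseteq> {..<n - 1}" by (auto simp: NC_def)
  have fN: "finite ?N" using NZ finite_subset by blast
  obtain \<beta> where \<beta>: "BC w c = {\<beta>}" using B by (meson card_1_singletonE)
  then have \<beta>L: "\<beta> < n - 1" "w \<in> c \<beta>" by (auto simp: BC_def)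
  have wB: "w \<notin> c i" if "i < n - 1" "i \<noteq> \<beta>" for i using \<beta> that by (auto simp: BC_def)
  have dis: "\<beta> \<notin> tc ?N" using BC_tc[OF h order_refl] \<beta> by auto
  have "card (insert \<beta> (tc ?N)) = 2 * t + 1"
    using tc_indep[OF NZ nc] dis N fN by (simp add: tc_def)
  then have cover: "insert \<beta> (tc ?N) = {..<n - 1}"
    using n tc_sub[OF NZ] \<beta>L by (intro card_subset_eq) auto
  have pre: "sc i \<in> ?N" if "i < n - 1" "i \<notin> ?N" "i \<noteq> \<beta>" for i
    using cover that by (auto simp: tc_def pm_def)
  have post: "\<exists>j<n - 1. sc j = i \<and> (j \<in> ?N \<or> j = \<beta>)" if "i < n - 1" "i \<notin> ?N" for i
    using sc_surj[OF that(1)] pre that(2) by metis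
  define S where "S = (\<lambda>f. f - {w}) ` {f \<in> off_cycle c. w \<in> f}"
  have S: "S = {A. A \<subseteq> u ` ?N \<and> card A = r - 1}"
  proof (rule card_subset_eq)
    show "finite {A. A \<subseteq> u ` ?N \<and> card A = r - 1}" using fN by simp
    show "S \<subseteq> {A. A \<subseteq> u ` ?N \<and> card A = r - 1}"
    proof
      fix A assume "A \<in> S"
      then obtain f where f: "f \<in> off_cycle c" "w \<in> f" "A = f - {w}" by (auto simp: S_def)
      then have fE: "f \<in> E" by (simp add: off_cycle_def)
      have "J u f \<subseteq> ?N" using f by (auto simp: J_def NC_def)
      then have "A \<subseteq> u ` ?N" using J_edge(1)[OF h fE] f by auto
      then show "A \<in> {A. A \<subseteq> u ` ?N \<and> card A = r - 1}" using f Er[OF fE] by (simp add: card_Diff_singleton)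
    qed
    have "inj_on (\<lambda>f. f - {w}) {f \<in> off_cycle c. w \<in> f}" by (intro inj_onI) (metis (mono_tags, lifting) insert_Diff mem_Collect_eq)
    then have "card S = t choose (r - 1)" using G by (simp add: S_def card_image)
    also have "\<dots> = card {A. A \<subseteq> u ` ?N \<and> card A = r - 1}"
      using n_subsets[of "u ` ?N" "r - 1"] fN card_u_image[OF h NZ] N by simp
    finally show "card S = card {A. A \<subseteq> u ` ?N \<and> card A = r - 1}" .
  qed
  \<comment> \<open>Since r - 1 < t, a free edge can contain one neighbour and miss another; this is
    what makes two links at w distinct.\<close>
  have avoid: "\<exists>f. f \<in> off_cycle c \<and> w \<in> f \<and> u p \<in> f \<and> u q \<notin> f" if pq: "p \<in> ?N" "q \<in> ?N" "p \<noteq> q" for p q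
  proof -
    have "card (?N - {p, q}) = t - 2" using pq N fN by (simp add: card_Diff_subset)
    then have "r - 2 \<le> card (?N - {p, q})" using rt by simp
    then obtain A where A: "A \<subseteq> ?N - {p, q}" "card A = r - 2" "finite A" by (rule obtain_subset_with_card_n)
    have "u ` insert p A \<subseteq> u ` ?N" using A pq by auto
    moreover have "card (u ` insert p A) = r - 1"
    proof -
      have "insert p A \<subseteq> {..<n - 1}" "p \<notin> A" using A pq NZ by auto
      then show ?thesis using card_u_image[OF h, of "insert p A"] A r3 by simp
    qed
    ultimately have "u ` insert p A \<in> S" unfolding S by simp
    then obtain f where f: "f \<in> off_cycle c" "w \<in> f" "f - {w} = u ` insert p A" by (auto simp: S_def)
    have "u p \<in> f" using f by blast
    moreover have "u q \<notin> u ` insert p A"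
    proof
      assume "u q \<in> u ` insert p A"
      then obtain x where "x \<in> insert p A" "u q = u x" by blast
      moreover from this have "x < n - 1" "q < n - 1" "x \<noteq> q" using A pq NZ by auto
      ultimately show False using H(10)[of q x] by auto
    qed
    then have "u q \<notin> f" using f H(9)[of q] pq NZ by blast
    ultimately show ?thesis using f by blast
  qed
  have t2: "2 \<le> card ?N" using N t3 by simp
  have hasf: "\<exists>f. f \<in> off_cycle c \<and> w \<in> f \<and> u p \<in> f" if "p \<in> ?N" for p using that by (auto simp: NC_def)
  have nf: "c i \<notin> off_cycle c" if "i < n - 1" for i using that by (auto simp: off_cycle_def)
  \<comment> \<open>At \<beta> the cycle edge c_\<beta> is the link, elsewhere a free edge
    is.\<close>
  have links: "\<exists>l m. l \<in> insert (c i) (off_cycle c) \<and> w \<in> l \<and> u i' \<in> l \<and> (i \<noteq> \<beta> \<longrightarrow> l \<in> off_cycle c) \<and>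
      m \<in> insert (c j) (off_cycle c) \<and> w \<in> m \<and> u j' \<in> m \<and> (j \<noteq> \<beta> \<longrightarrow> m \<in> off_cycle c) \<and> m \<noteq> l"
    if ij: "i < n - 1" "j < n - 1" "i \<noteq> j" "i' \<noteq> j'" "i \<noteq> \<beta> \<Longrightarrow> i' \<in> ?N" "j \<noteq> \<beta> \<Longrightarrow> j' \<in> ?N"
      "i = \<beta> \<Longrightarrow> u i' \<in> c \<beta>" "j = \<beta> \<Longrightarrow> u j' \<in> c \<beta>" for i j i' j'
  proof -
    consider "i = \<beta>" | "j = \<beta>" | "i \<noteq> \<beta>" "j \<noteq> \<beta>" by blast
    then show ?thesis
    proof cases
      case 1
      then obtain m where "m \<in> off_cycle c" "w \<in> m" "u j' \<in> m" using hasf[of j'] ij by blast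
      moreover from this have "m \<noteq> c \<beta>" using nf[OF \<beta>L(1)] by auto
      ultimately show ?thesis using 1 \<beta>L ij by (intro exI[of _ "c \<beta>"] exI[of _ m]) auto
    next
      case 2
      then obtain m where "m \<in> off_cycle c" "w \<in> m" "u i' \<in> m" using hasf[of i'] ij by blast
      moreover from this have "m \<noteq> c \<beta>" using nf[OF \<beta>L(1)] by auto
      ultimately show ?thesis using 2 \<beta>L ij by (intro exI[of _ m] exI[of _ "c \<beta>"]) auto
    next
      case 3
      then obtain l m where "l \<in> off_cycle c" "w \<in> l" "u i' \<in> l" "u j' \<notin> l" "m \<in> off_cycle c" "w \<in> m" "u j' \<in> m"
        using avoid[of i' j'] hasf[of j'] ij by metis
      then show ?thesis by (intro exI[of _ l] exI[of _ m]) auto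
    qed
  qed
  have indep: False if ij: "i < n - 1" "j < n - 1" "i \<noteq> j" "i \<notin> ?N" "j \<notin> ?N" and k: "k \<in> E" "k \<noteq> c \<beta>"
    "u i \<in> k" "u j \<in> k" for i j k
  proof -
    have gen: False if ij: "i < n - 1" "j < n - 1" "i \<noteq> j" "i \<notin> ?N" "j \<notin> ?N"
      and k: "k \<in> insert (c i) (insert (c j) (off_cycle c))" "w \<notin> k" "u i \<in> k" "u j \<in> k" for i j k
    proof -
      have "sc i \<noteq> sc j" using ij sc_inj by simp
      then obtain l m where "l \<in> insert (c i) (off_cycle c)" "w \<in> l" "u (sc i) \<in> l"
        "m \<in> insert (c j) (off_cycle c)" "w \<in> m" "u (sc j) \<in> m" "m \<noteq> l"
        using links[OF ij(1-3), of "sc i" "sc j"] pre ij H(6)[OF \<beta>L(1)] by metis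
      then show False using cyc_indep[OF h ij(1,2), of l m k] ij k by blast
    qed
    consider "k \<in> off_cycle c" | a where "a < n - 1" "k = c a" using k by (auto simp: off_cycle_def)
    then show False
    proof cases
      case 1
      have "w \<notin> k"
      proof
        assume "w \<in> k"
        then have "i \<in> ?N" using 1 k ij by (auto simp: NC_def)
        then show False using ij by simp
      qed
      then show False using gen[OF ij, of k] 1 k by blast
    next
      case 2
      then have a\<beta>: "a \<noteq> \<beta>" using k by auto
      then have wa: "w \<notin> k" using wB 2 by auto
      show False
      proof (cases "a \<in> ?N")
        case False
        \<comment> \<open>u_a is itself one of the outside vertices, so k = c_a counts as a cut edge
          in \<open>gen\<close>.\<close>
        have ua: "u a \<in> k" using H(5) 2 by simp
        obtain x where x: "x < n - 1" "x \<notin> ?N" "x \<noteq> a" "u x \<in> k" using ij k by metis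
        show False using gen[of a x k] x 2 False wa ua by blast
      next
        case True
        \<comment> \<open>Now the successor of a is the outside vertex on k, so the mirrored
          exclusion applies, with j the predecessor of the other outside vertex.\<close>
        then have sa: "sc a \<notin> ?N" "u (sc a) \<in> k" using nc H(6) 2 by auto
        obtain x where x: "x < n - 1" "x \<notin> ?N" "x \<noteq> sc a" "u x \<in> k" using ij k by metis
        obtain j where j: "j < n - 1" "sc j = x" "j \<in> ?N \<or> j = \<beta>" using post[OF x(1,2)] by blast
        then have ja: "a \<noteq> j" using x by auto
        obtain l m where lm: "l \<in> insert (c a) (off_cycle c)" "w \<in> l" "u a \<in> l"
          "m \<in> insert (c j) (off_cycle c)" "w \<in> m" "u j \<in> m" "m \<noteq> l"
          using links[OF 2(1) j(1) ja ja] True j a\<beta> H(5)[OF \<beta>L(1)] by metis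
        show False
          using cyc_indep'[OF h 2(1) j(1) ja[symmetric] lm(1-3) lm(4-7), of k] sa x j 2 lm wa by blast
      qed
    qed
  qed
  define R where "R = insert w (u ` ({..<n - 1} - ?N))"
  have "card (u ` ({..<n - 1} - ?N)) = t + 1"
    using card_u_image[OF h Diff_subset, of ?N] NZ fN N n by (simp add: card_Diff_subset)
  moreover have "w \<notin> u ` ({..<n - 1} - ?N)" using H(9) by auto
  ultimately have cR: "card R = t + 2" by (simp add: R_def)
  have "card (c \<beta>) = r" using Er H(7) \<beta>L by simp
  then have "\<not> R \<subseteq> c \<beta>" using card_mono[of "c \<beta>" R] cR rt finite_edge[OF H(7)[OF \<beta>L(1)]] by auto
  then obtain x where x: "x \<in> R" "x \<notin> c \<beta>" by blast
  then have xw: "x \<noteq> w" using \<beta>L by auto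
  then obtain i where i: "i < n - 1" "i \<notin> ?N" "x = u i" using x by (auto simp: R_def)
  have "hdegree E x \<le> card (u ` ?N) choose (r - 1)"
    unfolding hdegree_def
  proof (rule card_star_le[where x = x])
    show "finite (u ` ?N)" using fN by simp
    fix k assume k: "k \<in> {e \<in> E. x \<in> e}"
    have "k - {x} \<subseteq> u ` ?N"
    proof
      fix y assume y: "y \<in> k - {x}"
      have "w \<notin> k"
      proof
        assume wk: "w \<in> k"
        show False
        proof (cases "k \<in> off_cycle c")
          case True
          then have "i \<in> ?N" using wk k i by (auto simp: NC_def)
          then show False using i by simp
        next
          case False
          then obtain a where a: "a < n - 1" "k = c a" using k by (auto simp: off_cycle_def)
          then have "a = \<beta>" using wB wk by blast
          then show False using x k a by simp
        qed
      qed
      then have "y \<in> V" "y \<noteq> w" using y EV k by auto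
      then obtain j where j: "j < n - 1" "y = u j" using cyc_idx[OF h] by blast
      have "k \<noteq> c \<beta>" using x k by auto
      then have "j \<in> ?N" using indep[of i j k] i j y k by auto
      then show "y \<in> u ` ?N" using j by blast
    qed
    then show "k \<in> E \<and> x \<in> k \<and> k - {x} \<subseteq> u ` ?N" using k by simp
  qed
  then show False using deg[of x] H(8)[OF i(1)] i card_u_image[OF h NZ] N by simp
qed

lemma cyc_free_le_1: "near_cycle w u c \<Longrightarrow> card {f \<in> off_cycle c. w \<in> f} \<le> 1"
  using cyc_two_free[of w u c] cyc_tight_false[of w u c] by (cases "2 \<le> card {f \<in> off_cycle c. w \<in> f}") auto

end

text \<open>The tight case $n = 8$, $r = 3$: positions on the cycle are below 7, \<open>A\<close> is the set of positions of a free
edge avoiding \<open>w\<close>, \<open>B\<close> the set of indices of the cycle edges through \<open>w\<close>, and \<open>s\<close> the cyclic successor.\<close>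

lemma seven_card:
  assumes "A \<subseteq> {..<7::nat}"
  shows "card A = of_bool (0 \<in> A) + of_bool (1 \<in> A) + of_bool (2 \<in> A) + of_bool (3 \<in> A) +
    of_bool (4 \<in> A) + of_bool (5 \<in> A) + of_bool (6 \<in> A)"
proof -
  have "card A = (\<Sum>i<7. of_bool (i \<in> A))"
    using assms by (simp add: of_bool_def sum.If_cases Int_absorb1 Int_def[symmetric] inf.absorb2)
  also have "{..<7::nat} = {0, 1, 2, 3, 4, 5, 6}" by auto
  finally show ?thesis by simp
qed

lemma seven_eq:
  assumes "A \<subseteq> {..<7::nat}" "B \<subseteq> {..<7}"
    "0 \<in> A \<longleftrightarrow> 0 \<in> B" "1 \<in> A \<longleftrightarrow> 1 \<in> B" "2 \<in> A \<longleftrightarrow> 2 \<in> B" "3 \<in> A \<longleftrightarrow> 3 \<in> B"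
    "4 \<in> A \<longleftrightarrow> 4 \<in> B" "5 \<in> A \<longleftrightarrow> 5 \<in> B" "6 \<in> A \<longleftrightarrow> 6 \<in> B"
  shows "A = B"
proof -
  have e: "{..<7::nat} = {0, 1, 2, 3, 4, 5, 6}" by auto
  show ?thesis using assms unfolding e by blast
qed

text \<open>The digits in these names list \<open>B\<close>, and a_i stands for membership of i in
  \<open>A\<close>. Conditions: no two elements of \<open>B\<close> and no two of their successors
  lie in \<open>A\<close>; an element of \<open>B\<close> in \<open>A\<close> excludes 6 and 0, a
  successor in \<open>A\<close> excludes 1 and 2. The latter come from a free edge at w in positions
  0 and 1.\<close>

lemma seven_bool_345:
  assumes "of_bool a0 + of_bool a1 + of_bool a2 + of_bool a3 + of_bool a4 + of_bool a5 + of_bool a6 = (3::nat)"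
    "\<not> (a3 \<and> a4)" "\<not> (a3 \<and> a5)" "\<not> (a4 \<and> a5)" "\<not> (a4 \<and> a6)" "\<not> (a5 \<and> a6)"
    "a3 \<or> a4 \<or> a5 \<longrightarrow> \<not> a6 \<and> \<not> a0" "a4 \<or> a5 \<or> a6 \<longrightarrow> \<not> a1 \<and> \<not> a2"
  shows "(\<not> a0 \<and> a1 \<and> a2 \<and> a3 \<and> \<not> a4 \<and> \<not> a5 \<and> \<not> a6) \<or> (a0 \<and> a1 \<and> a2 \<and> \<not> a3 \<and> \<not> a4 \<and> \<not> a5 \<and> \<not> a6)"
  using assms by (cases a3; cases a4; cases a5; cases a6; cases a0; cases a1; cases a2) simp_all

lemma seven_345:
  assumes "A \<subseteq> {..<7::nat}" "card A = 3"
    "\<not> (3 \<in> A \<and> 4 \<in> A)" "\<not> (3 \<in> A \<and> 5 \<in> A)" "\<not> (4 \<in> A \<and> 5 \<in> A)" "\<not> (4 \<in> A \<and> 6 \<in> A)" "\<not> (5 \<in> A \<and> 6 \<in> A)"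
    "3 \<in> A \<or> 4 \<in> A \<or> 5 \<in> A \<longrightarrow> 6 \<notin> A \<and> 0 \<notin> A" "4 \<in> A \<or> 5 \<in> A \<or> 6 \<in> A \<longrightarrow> 1 \<notin> A \<and> 2 \<notin> A"
  shows "A = {1, 2, 3} \<or> A = {0, 1, 2}"
  using seven_bool_345[OF seven_card[OF assms(1), unfolded assms(2), symmetric] assms(3-)]
    seven_eq[OF assms(1), of "{1, 2, 3}"] seven_eq[OF assms(1), of "{0, 1, 2}"] by auto

lemma seven_bool_234:
  assumes "of_bool a0 + of_bool a1 + of_bool a2 + of_bool a3 + of_bool a4 + of_bool a5 + of_bool a6 = (3::nat)"
    "\<not> (a2 \<and> a3)" "\<not> (a2 \<and> a4)" "\<not> (a3 \<and> a4)" "\<not> (a3 \<and> a5)" "\<not> (a4 \<and> a5)"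
    "a2 \<or> a3 \<or> a4 \<longrightarrow> \<not> a6 \<and> \<not> a0" "a3 \<or> a4 \<or> a5 \<longrightarrow> \<not> a1 \<and> \<not> a2"
  shows "(a0 \<and> \<not> a1 \<and> \<not> a2 \<and> \<not> a3 \<and> \<not> a4 \<and> a5 \<and> a6) \<or> (a0 \<and> a1 \<and> \<not> a2 \<and> \<not> a3 \<and> \<not> a4 \<and> \<not> a5 \<and> a6)"
  using assms by (cases a3; cases a4; cases a5; cases a6; cases a0; cases a1; cases a2) simp_all

lemma seven_234:
  assumes "A \<subseteq> {..<7::nat}" "card A = 3"
    "\<not> (2 \<in> A \<and> 3 \<in> A)" "\<not> (2 \<in> A \<and> 4 \<in> A)" "\<not> (3 \<in> A \<and> 4 \<in> A)" "\<not> (3 \<in> A \<and> 5 \<in> A)" "\<not> (4 \<in> A \<and> 5 \<in> A)"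
    "2 \<in> A \<or> 3 \<in> A \<or> 4 \<in> A \<longrightarrow> 6 \<notin> A \<and> 0 \<notin> A" "3 \<in> A \<or> 4 \<in> A \<or> 5 \<in> A \<longrightarrow> 1 \<notin> A \<and> 2 \<notin> A"
  shows "A = {0, 5, 6} \<or> A = {0, 1, 6}"
  using seven_bool_234[OF seven_card[OF assms(1), unfolded assms(2), symmetric] assms(3-)]
    seven_eq[OF assms(1), of "{0, 5, 6}"] seven_eq[OF assms(1), of "{0, 1, 6}"] by auto

lemma seven_bool_245:
  assumes "of_bool a0 + of_bool a1 + of_bool a2 + of_bool a3 + of_bool a4 + of_bool a5 + of_bool a6 = (3::nat)"
    "\<not> (a2 \<and> a4)" "\<not> (a2 \<and> a5)" "\<not> (a4 \<and> a5)" "\<not> (a3 \<and> a5)" "\<not> (a3 \<and> a6)" "\<not> (a5 \<and> a6)"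
    "a2 \<or> a4 \<or> a5 \<longrightarrow> \<not> a6 \<and> \<not> a0" "a3 \<or> a5 \<or> a6 \<longrightarrow> \<not> a1 \<and> \<not> a2"
  shows "False"
  using assms by (cases a3; cases a4; cases a5; cases a6; cases a0; cases a1; cases a2) simp_all

lemma seven_245:
  assumes "A \<subseteq> {..<7::nat}" "card A = 3"
    "\<not> (2 \<in> A \<and> 4 \<in> A)" "\<not> (2 \<in> A \<and> 5 \<in> A)" "\<not> (4 \<in> A \<and> 5 \<in> A)" "\<not> (3 \<in> A \<and> 5 \<in> A)" "\<not> (3 \<in> A \<and> 6 \<in> A)" "\<not> (5 \<in> A \<and> 6 \<in> A)"
    "2 \<in> A \<or> 4 \<in> A \<or> 5 \<in> A \<longrightarrow> 6 \<notin> A \<and> 0 \<notin> A" "3 \<in> A \<or> 5 \<in> A \<or> 6 \<in> A \<longrightarrow> 1 \<notin> A \<and> 2 \<notin> A"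
  shows "False"
  by (rule seven_bool_245[OF seven_card[OF assms(1), unfolded assms(2), symmetric] assms(3-)])

lemma seven_bool_235:
  assumes "of_bool a0 + of_bool a1 + of_bool a2 + of_bool a3 + of_bool a4 + of_bool a5 + of_bool a6 = (3::nat)"
    "\<not> (a2 \<and> a3)" "\<not> (a2 \<and> a5)" "\<not> (a3 \<and> a5)" "\<not> (a3 \<and> a4)" "\<not> (a3 \<and> a6)" "\<not> (a4 \<and> a6)"
    "a2 \<or> a3 \<or> a5 \<longrightarrow> \<not> a6 \<and> \<not> a0" "a3 \<or> a4 \<or> a6 \<longrightarrow> \<not> a1 \<and> \<not> a2"
  shows "False"
  using assms by (cases a3; cases a4; cases a5; cases a6; cases a0; cases a1; cases a2) simp_all

lemma seven_235:
  assumes "A \<subseteq> {..<7::nat}" "card A = 3"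
    "\<not> (2 \<in> A \<and> 3 \<in> A)" "\<not> (2 \<in> A \<and> 5 \<in> A)" "\<not> (3 \<in> A \<and> 5 \<in> A)" "\<not> (3 \<in> A \<and> 4 \<in> A)" "\<not> (3 \<in> A \<and> 6 \<in> A)" "\<not> (4 \<in> A \<and> 6 \<in> A)"
    "2 \<in> A \<or> 3 \<in> A \<or> 5 \<in> A \<longrightarrow> 6 \<notin> A \<and> 0 \<notin> A" "3 \<in> A \<or> 4 \<in> A \<or> 6 \<in> A \<longrightarrow> 1 \<notin> A \<and> 2 \<notin> A"
  shows "False"
  by (rule seven_bool_235[OF seven_card[OF assms(1), unfolded assms(2), symmetric] assms(3-)])

lemma seven_345_idx:
  assumes A: "A \<subseteq> {..<7::nat}" "card A = 3" and B: "B = {3, 4, 5}"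
    and p: "\<And>i j. i \<in> B \<Longrightarrow> j \<in> B \<Longrightarrow> i \<noteq> j \<Longrightarrow> \<not> (i \<in> A \<and> j \<in> A)"
    and q: "\<And>i j. i \<in> B \<Longrightarrow> j \<in> B \<Longrightarrow> i \<noteq> j \<Longrightarrow> \<not> (s i \<in> A \<and> s j \<in> A)"
    and x: "\<And>i. i \<in> B \<Longrightarrow> i \<in> A \<Longrightarrow> 6 \<notin> A \<and> 0 \<notin> A"
    and y: "\<And>i. i \<in> B \<Longrightarrow> s i \<in> A \<Longrightarrow> 1 \<notin> A \<and> 2 \<notin> A"
    and s: "s 2 = 3" "s 3 = 4" "s 4 = 5" "s 5 = 6"
  shows "A = {1, 2, 3} \<or> A = {0, 1, 2}"
proof -
  have m: "3 \<in> B" "4 \<in> B" "5 \<in> B" using B by auto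
  show ?thesis
  proof (rule seven_345[OF A])
    show "\<not> (3 \<in> A \<and> 4 \<in> A)" using p[OF m(1) m(2)] s by simp
    show "\<not> (3 \<in> A \<and> 5 \<in> A)" using p[OF m(1) m(3)] s by simp
    show "\<not> (4 \<in> A \<and> 5 \<in> A)" using p[OF m(2) m(3)] s by simp
    show "\<not> (4 \<in> A \<and> 6 \<in> A)" using q[OF m(1) m(3)] s by simp
    show "\<not> (5 \<in> A \<and> 6 \<in> A)" using q[OF m(2) m(3)] s by simp
    show "3 \<in> A \<or> 4 \<in> A \<or> 5 \<in> A \<longrightarrow> 6 \<notin> A \<and> 0 \<notin> A" using x[OF m(1)] x[OF m(2)] x[OF m(3)] by blast
    show "4 \<in> A \<or> 5 \<in> A \<or> 6 \<in> A \<longrightarrow> 1 \<notin> A \<and> 2 \<notin> A" using y[OF m(1)] y[OF m(2)] y[OF m(3)] unfolding s by blast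
  qed
qed

lemma seven_245_idx:
  assumes A: "A \<subseteq> {..<7::nat}" "card A = 3" and B: "B = {2, 4, 5}"
    and p: "\<And>i j. i \<in> B \<Longrightarrow> j \<in> B \<Longrightarrow> i \<noteq> j \<Longrightarrow> \<not> (i \<in> A \<and> j \<in> A)"
    and q: "\<And>i j. i \<in> B \<Longrightarrow> j \<in> B \<Longrightarrow> i \<noteq> j \<Longrightarrow> \<not> (s i \<in> A \<and> s j \<in> A)"
    and x: "\<And>i. i \<in> B \<Longrightarrow> i \<in> A \<Longrightarrow> 6 \<notin> A \<and> 0 \<notin> A"
    and y: "\<And>i. i \<in> B \<Longrightarrow> s i \<in> A \<Longrightarrow> 1 \<notin> A \<and> 2 \<notin> A"
    and s: "s 2 = 3" "s 3 = 4" "s 4 = 5" "s 5 = 6"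
  shows "False"
proof -
  have m: "2 \<in> B" "4 \<in> B" "5 \<in> B" using B by auto
  show ?thesis
  proof (rule seven_245[OF A])
    show "\<not> (2 \<in> A \<and> 4 \<in> A)" using p[OF m(1) m(2)] s by simp
    show "\<not> (2 \<in> A \<and> 5 \<in> A)" using p[OF m(1) m(3)] s by simp
    show "\<not> (4 \<in> A \<and> 5 \<in> A)" using p[OF m(2) m(3)] s by simp
    show "\<not> (3 \<in> A \<and> 5 \<in> A)" using q[OF m(1) m(2)] s by simp
    show "\<not> (3 \<in> A \<and> 6 \<in> A)" using q[OF m(1) m(3)] s by simp
    show "\<not> (5 \<in> A \<and> 6 \<in> A)" using q[OF m(2) m(3)] s by simp
    show "2 \<in> A \<or> 4 \<in> A \<or> 5 \<in> A \<longrightarrow> 6 \<notin> A \<and> 0 \<notin> A" using x[OF m(1)] x[OF m(2)] x[OF m(3)] by blast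
    show "3 \<in> A \<or> 5 \<in> A \<or> 6 \<in> A \<longrightarrow> 1 \<notin> A \<and> 2 \<notin> A" using y[OF m(1)] y[OF m(2)] y[OF m(3)] unfolding s by blast
  qed
qed

lemma seven_235_idx:
  assumes A: "A \<subseteq> {..<7::nat}" "card A = 3" and B: "B = {2, 3, 5}"
    and p: "\<And>i j. i \<in> B \<Longrightarrow> j \<in> B \<Longrightarrow> i \<noteq> j \<Longrightarrow> \<not> (i \<in> A \<and> j \<in> A)"
    and q: "\<And>i j. i \<in> B \<Longrightarrow> j \<in> B \<Longrightarrow> i \<noteq> j \<Longrightarrow> \<not> (s i \<in> A \<and> s j \<in> A)"
    and x: "\<And>i. i \<in> B \<Longrightarrow> i \<in> A \<Longrightarrow> 6 \<notin> A \<and> 0 \<notin> A"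
    and y: "\<And>i. i \<in> B \<Longrightarrow> s i \<in> A \<Longrightarrow> 1 \<notin> A \<and> 2 \<notin> A"
    and s: "s 2 = 3" "s 3 = 4" "s 4 = 5" "s 5 = 6"
  shows "False"
proof -
  have m: "2 \<in> B" "3 \<in> B" "5 \<in> B" using B by auto
  show ?thesis
  proof (rule seven_235[OF A])
    show "\<not> (2 \<in> A \<and> 3 \<in> A)" using p[OF m(1) m(2)] s by simp
    show "\<not> (2 \<in> A \<and> 5 \<in> A)" using p[OF m(1) m(3)] s by simp
    show "\<not> (3 \<in> A \<and> 5 \<in> A)" using p[OF m(2) m(3)] s by simp
    show "\<not> (3 \<in> A \<and> 4 \<in> A)" using q[OF m(1) m(2)] s by simp
    show "\<not> (3 \<in> A \<and> 6 \<in> A)" using q[OF m(1) m(3)] s by simp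
    show "\<not> (4 \<in> A \<and> 6 \<in> A)" using q[OF m(2) m(3)] s by simp
    show "2 \<in> A \<or> 3 \<in> A \<or> 5 \<in> A \<longrightarrow> 6 \<notin> A \<and> 0 \<notin> A" using x[OF m(1)] x[OF m(2)] x[OF m(3)] by blast
    show "3 \<in> A \<or> 4 \<in> A \<or> 6 \<in> A \<longrightarrow> 1 \<notin> A \<and> 2 \<notin> A" using y[OF m(1)] y[OF m(2)] y[OF m(3)] unfolding s by blast
  qed
qed

lemma seven_234_idx:
  assumes A: "A \<subseteq> {..<7::nat}" "card A = 3" and B: "B = {2, 3, 4}"
    and p: "\<And>i j. i \<in> B \<Longrightarrow> j \<in> B \<Longrightarrow> i \<noteq> j \<Longrightarrow> \<not> (i \<in> A \<and> j \<in> A)"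
    and q: "\<And>i j. i \<in> B \<Longrightarrow> j \<in> B \<Longrightarrow> i \<noteq> j \<Longrightarrow> \<not> (s i \<in> A \<and> s j \<in> A)"
    and x: "\<And>i. i \<in> B \<Longrightarrow> i \<in> A \<Longrightarrow> 6 \<notin> A \<and> 0 \<notin> A"
    and y: "\<And>i. i \<in> B \<Longrightarrow> s i \<in> A \<Longrightarrow> 1 \<notin> A \<and> 2 \<notin> A"
    and s: "s 2 = 3" "s 3 = 4" "s 4 = 5" "s 5 = 6"
  shows "A = {0, 5, 6} \<or> A = {0, 1, 6}"
proof -
  have m: "2 \<in> B" "3 \<in> B" "4 \<in> B" using B by auto
  show ?thesis
  proof (rule seven_234[OF A])
    show "\<not> (2 \<in> A \<and> 3 \<in> A)" using p[OF m(1) m(2)] s by simp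
    show "\<not> (2 \<in> A \<and> 4 \<in> A)" using p[OF m(1) m(3)] s by simp
    show "\<not> (3 \<in> A \<and> 4 \<in> A)" using p[OF m(2) m(3)] s by simp
    show "\<not> (3 \<in> A \<and> 5 \<in> A)" using q[OF m(1) m(3)] s by simp
    show "\<not> (4 \<in> A \<and> 5 \<in> A)" using q[OF m(2) m(3)] s by simp
    show "2 \<in> A \<or> 3 \<in> A \<or> 4 \<in> A \<longrightarrow> 6 \<notin> A \<and> 0 \<notin> A" using x[OF m(1)] x[OF m(2)] x[OF m(3)] by blast
    show "3 \<in> A \<or> 4 \<in> A \<or> 5 \<in> A \<longrightarrow> 1 \<notin> A \<and> 2 \<notin> A" using y[OF m(1)] y[OF m(2)] y[OF m(3)] unfolding s by blast
  qed
qed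

section \<open>Exchanging the missing vertex with a vertex of the cycle\<close>

context unif
begin

lemma sc_image_sub: "sc ` A \<subseteq> {..<n - 1}" by auto

lemma card_sc: "A \<subseteq> {..<n - 1} \<Longrightarrow> card (sc ` A) = card A"
  by (rule card_image) (auto simp: inj_on_def sc_inj subset_iff)

lemma sc_image_closed:
  assumes "A \<subseteq> {..<n - 1}" "sc ` A = A" "A \<noteq> {}"
  shows "A = {..<n - 1}"
proof (rule pm_closed[OF assms(1) _ assms(3)])
  show "pm A \<subseteq> A"
  proof
    fix i assume i: "i \<in> pm A"
    then have "sc i \<in> sc ` A" using assms(2) by (simp add: pm_def)
    then obtain j where "j \<in> A" "sc i = sc j" by blast
    then show "i \<in> A" using sc_inj[of i j] assms(1) i by (auto simp: pm_def)
  qed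
qed

text \<open>Bounding the possible position sets therefore bounds the number of free edges avoiding
  w.\<close>

lemma J_inj:
  assumes h: "near_cycle w u c" and "f \<in> E" "f' \<in> E" "w \<notin> f" "w \<notin> f'" "J u f = J u f'"
  shows "f = f'"
proof -
  have "f - {w} = u ` J u f" using J_edge(1)[OF h assms(2)] by simp
  also have "\<dots> = f' - {w}" unfolding assms(6) by (rule J_edge(1)[OF h assms(3)])
  finally show ?thesis using assms(4,5) by simp
qed

text \<open>When both cycle edges at u_j contain w, the two vertices trade places with no edge
  changed; in particular the off-cycle edges stay the same.\<close>

lemma cyc_swap:
  assumes h: "near_cycle w u c" and j: "j < n - 1" "p < n - 1" "sc p = j" "w \<in> c p" "w \<in> c j"
  shows "near_cycle (u j) (u(j := w)) c"
proof -
  note H = cycD[OF h]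
  have b: "bij_betw (u(j := w)) {..<n - 1} (V - {u j})"
  proof -
    have e: "{..<n - 1} = insert j ({..<n - 1} - {j})" using j by auto
    have im: "u ` ({..<n - 1} - {j}) = V - {w} - {u j}"
    proof -
      have "u ` ({..<n - 1} - {j}) = u ` {..<n - 1} - u ` {j}"
        using H(2) j by (intro inj_on_image_set_diff[of u "{..<n - 1}"]) (auto simp: bij_betw_def)
      then show ?thesis using H(2) by (simp add: bij_betw_def)
    qed
    have "(u(j := w)) ` {..<n - 1} = insert w (u ` ({..<n - 1} - {j}))" by (subst e) auto
    also have "\<dots> = V - {u j}" unfolding im using H(1) H(9)[OF j(1)] by auto
    finally have 1: "(u(j := w)) ` {..<n - 1} = V - {u j}" .
    moreover have "card (V - {u j}) = n - 1" using H(8)[OF j(1)] cardV finV by simp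
    ultimately have "inj_on (u(j := w)) {..<n - 1}" by (intro eq_card_imp_inj_on) auto
    then show ?thesis using 1 by (simp add: bij_betw_def)
  qed
  have "(u(j := w)) i \<in> c i \<and> (u(j := w)) (sc i) \<in> c i" if i: "i < n - 1" for i
  proof -
    have "sc i = j \<Longrightarrow> i = p" using sc_inj[OF i j(2)] j by simp
    then show ?thesis using H(5)[OF i] H(6)[OF i] j by auto
  qed
  then show ?thesis unfolding near_cycle_def using b H(3,4) H(8)[OF j(1)] by auto
qed

end

context nonham
begin

text \<open>A cycle edge through w links w to both of its cycle vertices, so two such edges provide
  the links for \<open>cyc_indep\<close> and for its mirror image.\<close>

lemma free_BC:
  assumes h: "near_cycle w u c" and k: "k \<in> off_cycle c" "w \<notin> k" and i: "i \<in> BC w c" "j \<in> BC w c" "i \<noteq> j"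
  shows "\<not> (i \<in> J u k \<and> j \<in> J u k)" "\<not> (sc i \<in> J u k \<and> sc j \<in> J u k)"
proof -
  note H = cycD[OF h]
  have i': "i < n - 1" "w \<in> c i" "j < n - 1" "w \<in> c j" using i by (auto simp: BC_def)
  have ne: "c j \<noteq> c i" using H(11) i' i by metis
  show "\<not> (i \<in> J u k \<and> j \<in> J u k)"
  proof
    assume "i \<in> J u k \<and> j \<in> J u k"
    then show False
      using cyc_indep[OF h i'(1,3), of "c i" "c j" k] i' i k ne H(6) by (auto simp: J_def)
  qed
  show "\<not> (sc i \<in> J u k \<and> sc j \<in> J u k)"
  proof
    assume "sc i \<in> J u k \<and> sc j \<in> J u k"
    then show False
      using cyc_indep'[OF h i'(1,3), of "c i" "c j" k] i' i k ne H(5) by (auto simp: J_def)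
  qed
qed

lemma free_BC_card:
  assumes h: "near_cycle w u c" and k: "k \<in> off_cycle c" "w \<notin> k"
  shows "card (J u k \<inter> BC w c) \<le> 1" "card (J u k \<inter> sc ` BC w c) \<le> 1"
proof -
  have *: "card A \<le> 1" if "finite A" "\<And>x y. x \<in> A \<Longrightarrow> y \<in> A \<Longrightarrow> x = y" for A :: "nat set"
  proof (cases "A = {}")
    case False
    then obtain a where "a \<in> A" by blast
    then have "A \<subseteq> {a}" using that(2) by blast
    then show ?thesis using card_mono[of "{a}" A] by simp
  qed simp
  show "card (J u k \<inter> BC w c) \<le> 1" using free_BC(1)[OF h k] by (intro *) auto
  show "card (J u k \<inter> sc ` BC w c) \<le> 1" using free_BC(2)[OF h k] by (intro *) auto
qed

text \<open>As before, but the second link is the free edge \<open>f\<close>.\<close>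

lemma free_BC_NC:
  assumes h: "near_cycle w u c" and f: "f \<in> off_cycle c" "w \<in> f" and k: "k \<in> off_cycle c" "w \<notin> k" and i: "i \<in> BC w c"
  shows "i \<in> J u k \<Longrightarrow> j \<in> pm (J u f) \<Longrightarrow> j \<notin> J u k"
    "sc i \<in> J u k \<Longrightarrow> j \<in> J u f \<Longrightarrow> sc j \<notin> J u k"
proof -
  note H = cycD[OF h]
  have i': "i < n - 1" "w \<in> c i" using i by (auto simp: BC_def)
  have ne: "f \<noteq> c i" using f i' by (auto simp: off_cycle_def)
  have JN: "J u f \<subseteq> NC w u c" using f by (auto simp: J_def NC_def)
  show "j \<notin> J u k" if "i \<in> J u k" "j \<in> pm (J u f)"
  proof
    assume "j \<in> J u k"
    moreover have "j \<noteq> i" using that JN BC_NC(2)[OF h i] by (auto simp: pm_def)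
    ultimately show False
      using cyc_indep[OF h i'(1), of j "c i" f k] that i' f k ne H(6) by (auto simp: J_def pm_def)
  qed
  show "sc j \<notin> J u k" if "sc i \<in> J u k" "j \<in> J u f"
  proof
    assume "sc j \<in> J u k"
    moreover have "j \<noteq> i" using that JN BC_NC(1)[OF h i] by auto
    ultimately show False
      using cyc_indep'[OF h i'(1), of j "c i" f k] that i' f k ne H(5) by (auto simp: J_def)
  qed
qed

end

section \<open>Near-cycles whose missing vertex has at most one free edge\<close>

context dirac
begin

text \<open>Double counting gives n(t + 1) <= r |E|. For r = t, n > 2t makes the left side exceed
  t(n + 2).\<close>

lemma card_E_gt: "n < card E" "r = t \<Longrightarrow> n + 3 \<le> card E"
proof -
  have "n * ((t choose (r - 1)) + 1) \<le> (\<Sum>x\<in>V. hdegree E x)"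
    using sum_bounded_below[of V "(t choose (r - 1)) + 1" "hdegree E"] deg cardV by simp
  then have s: "n * ((t choose (r - 1)) + 1) \<le> r * card E" using sum_hdegree by simp
  have "t \<le> t choose (r - 1)" using r3 rt by (intro choose_ge) auto
  then have "n * (t + 1) \<le> n * ((t choose (r - 1)) + 1)" by simp
  then have s2: "n * (t + 1) \<le> r * card E" using s by linarith
  then have s3: "n * (t + 1) \<le> t * card E" using rt by (meson le_trans mult_le_mono1)
  have "t * n < n * (t + 1)" using n4 by (simp add: algebra_simps)
  then have "t * n < t * card E" using s3 by linarith
  then show "n < card E" by simp
  assume "r = t"
  have "t * (n + 2) < n * (t + 1)" using nt by (auto simp: algebra_simps)
  then have "t * (n + 2) < t * card E" using s3 by linarith
  then have "n + 2 < card E" by (rule mult_left_less_imp_less) simp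
  then show "n + 3 \<le> card E" by simp
qed

lemma CF_ge: "near_cycle w u c \<Longrightarrow> 2 \<le> card (off_cycle c)" "near_cycle w u c \<Longrightarrow> r = t \<Longrightarrow> 4 \<le> card (off_cycle c)"
  using card_CF[of w u c] card_E_gt n4 by linarith+

lemma finCF: "finite (off_cycle c)" using finE by (simp add: off_cycle_def)

lemma quadratic_gt_linear: "4 \<le> t \<Longrightarrow> 2 * C \<ge> t * (t - 1) \<Longrightarrow> C + 3 > 2 * (t::nat)"
proof -
  assume t: "4 \<le> t" and C: "2 * C \<ge> t * (t - 1)"
  obtain k where k: "t = k + 4" using t by (intro that[of "t - 4"]) simp
  have "2 * (2 * t - 2) \<le> t * (t - 1)" unfolding k by (simp add: algebra_simps)
  then show ?thesis using C t by linarith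
qed

text \<open>The whole degree of w sits in \<open>BC\<close>. A free edge has at most one position in
  \<open>BC\<close> and at most one in its shift, so both complements have at least r - 1 elements.
  For r < t the quadratic bound on the binomial is already too large for this.\<close>

lemma cyc_no_free:
  assumes h: "near_cycle w u c" and d: "card {f \<in> off_cycle c. w \<in> f} = 0"
  shows "r = t \<and> n = 2 * t + 2 \<and> card (BC w c) = t + 1"
proof -
  let ?B = "BC w c" and ?Z = "{..<n - 1}"
  have BZ: "?B \<subseteq> ?Z" by (auto simp: BC_def)
  have fB: "finite ?B" using BZ finite_subset by blast
  have b: "(t choose (r - 1)) + 1 \<le> card ?B"
    using deg[of w] hdegree_cyc[OF h, of w] cycD(1)[OF h] d by simp
  have nw: "w \<notin> k" if "k \<in> off_cycle c" for k using d finCF that by auto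
  have kE: "k \<in> E" if "k \<in> off_cycle c" for k using that by (simp add: off_cycle_def)
  have cJ: "card (J u k) = r" if "k \<in> off_cycle c" for k using J_edge(2)[OF h kE[OF that]] nw[OF that] by simp
  obtain k where k: "k \<in> off_cycle c" using CF_ge(1)[OF h] by fastforce
  have cZ: "card (?Z - ?B) = n - 1 - card ?B" using BZ fB by (simp add: card_Diff_subset)
  have sZ: "card (?Z - sc ` ?B) = n - 1 - card ?B"
    using card_sc[OF BZ] fB sc_image_sub by (simp add: card_Diff_subset)
  have diff: "r - 1 \<le> card (J u k - ?B)" "r - 1 \<le> card (J u k - sc ` ?B)" if "k \<in> off_cycle c" for k
    using free_BC_card[OF h that nw[OF that]] cJ[OF that]
    by (auto simp: card_Diff_subset_Int)
  have sub: "J u k - ?B \<subseteq> ?Z - ?B" "J u k - sc ` ?B \<subseteq> ?Z - sc ` ?B" for k using J_sub by auto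
  have le: "r - 1 \<le> n - 1 - card ?B"
    using diff(1)[OF k] card_mono[OF _ sub(1), of k] cZ by simp
  \<comment> \<open>In the extreme case every free edge contains both complements, which are
    distinct. Their union then has r elements and is the position set of every free edge, so there
    is only one free edge.\<close>
  have ne: "n - 1 - card ?B \<noteq> r - 1"
  proof
    assume eq: "n - 1 - card ?B = r - 1"
    have B0: "?B \<noteq> {}" using b by auto
    have BnZ: "?B \<noteq> ?Z"
    proof
      assume "?B = ?Z" then show False using eq r3 by simp
    qed
    have neq: "sc ` ?B \<noteq> ?B" using sc_image_closed[OF BZ _ B0] BnZ by blast
    have Jk: "J u k = (?Z - ?B) \<union> (?Z - sc ` ?B)" if kk: "k \<in> off_cycle c" for k
    proof -
      have 1: "J u k - ?B = ?Z - ?B" "J u k - sc ` ?B = ?Z - sc ` ?B"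
        by (rule card_seteq[OF _ sub(1)], simp, use diff[OF kk] cZ eq in simp)
           (rule card_seteq[OF _ sub(2)], simp, use diff[OF kk] sZ eq in simp)
      then have s: "(?Z - ?B) \<union> (?Z - sc ` ?B) \<subseteq> J u k" by blast
      have "(?Z - ?B) \<noteq> (?Z - sc ` ?B)" using neq BZ sc_image_sub[of ?B] by blast
      then have "?Z - ?B \<subset> (?Z - ?B) \<union> (?Z - sc ` ?B)"
        using card_subset_eq[of "?Z - ?B" "?Z - sc ` ?B"] cZ sZ by auto
      then have "card (?Z - ?B) < card ((?Z - ?B) \<union> (?Z - sc ` ?B))"
        by (intro psubset_card_mono) auto
      then have "card (J u k) \<le> card ((?Z - ?B) \<union> (?Z - sc ` ?B))" using cZ eq cJ[OF kk] by simp
      then show ?thesis using card_seteq[OF J_fin s] by simp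
    qed
    then have "x = y" if "x \<in> off_cycle c" "y \<in> off_cycle c" for x y using J_inj[OF h kE[OF that(1)] kE[OF that(2)]] nw that by simp
    then have "off_cycle c \<subseteq> {k}" using k by blast
    then have "card (off_cycle c) \<le> 1" using card_mono[of "{k}" "off_cycle c"] by simp
    then show False using CF_ge(1)[OF h] by simp
  qed
  have le2: "card ?B + r \<le> n - 1" using le ne r3 card_mono[OF _ BZ] by simp
  have rt': "r = t"
  proof (rule ccontr)
    assume "r \<noteq> t"
    then have r: "r < t" using rt by simp
    have "2 * (t choose (r - 1)) \<ge> t * (t - 1)" using choose_lower[OF r3 r] .
    then show False using quadratic_gt_linear[of "t choose (r - 1)"] r r3 b le2 nt' by linarith
  qed
  then have "t + 1 \<le> card ?B" using b choose_top[OF t3] by simp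
  then show ?thesis using rt' le2 nt by auto
qed

text \<open>Outside the exceptional case |BC| + 2r <= n + 1 is impossible (\<open>arith\<close>). A
  second free edge meeting \<open>BC\<close> or its shift would give this inequality. One that
  avoids both must be their whole complement with r = t, which leaves two free edges in all instead
  of four.\<close>

lemma cyc_one_free:
  assumes h: "near_cycle w u c" and f: "f \<in> off_cycle c" "w \<in> f"
  shows "r = 3 \<and> t = 3 \<and> n = 8 \<and> card (BC w c) = 3"
proof (rule ccontr)
  assume no: "\<not> ?thesis"
  let ?B = "BC w c" and ?Z = "{..<n - 1}"
  note H = cycD[OF h]
  have BZ: "?B \<subseteq> ?Z" by (auto simp: BC_def)
  have fB: "finite ?B" using BZ finite_subset by blast
  have fE: "f \<in> E" using f by (simp add: off_cycle_def)
  have "card {f \<in> off_cycle c. w \<in> f} \<le> 1" by (rule cyc_free_le_1[OF h])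
  then have single: "k = f" if "k \<in> off_cycle c" "w \<in> k" for k
    using f that finCF by (auto simp: card_le_Suc0_iff_eq One_nat_def)
  have b: "t choose (r - 1) \<le> card ?B"
    using deg[of w] hdegree_cyc[OF h, of w] H(1) cyc_free_le_1[OF h] by simp
  have nw: "w \<notin> k" if "k \<in> off_cycle c" "k \<noteq> f" for k using single that by blast
  have kE: "k \<in> E" if "k \<in> off_cycle c" for k using that by (simp add: off_cycle_def)
  have cJ: "card (J u k) = r" if "k \<in> off_cycle c" "k \<noteq> f" for k
    using J_edge(2)[OF h kE[OF that(1)]] nw[OF that] by simp
  have cf: "card (J u f) = r - 1" using J_edge(2)[OF h fE] f by simp
  have JN: "J u f \<subseteq> NC w u c" using f by (auto simp: J_def NC_def)
  have B0: "?B \<noteq> {}" using b choose_ge[of "r - 1" t] r3 rt t3 by auto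
  have big: "r < t \<Longrightarrow> 2 * t < (t choose (r - 1)) + 3"
    using quadratic_gt_linear[OF _ choose_lower[OF r3]] r3 by simp
  have arith: False if "card ?B + 2 * r \<le> n + 1"
  proof (cases "r = t")
    case True
    then have c: "t choose (r - 1) = t" using choose_top[OF t3] by simp
    then have "t = 3" "n = 8" "card ?B = 3" using that b nt t3 True by auto
    then show False using no True by simp
  next
    case False
    then show False using big that b nt' rt r3 by linarith
  qed
  have typeA: "i \<notin> J u k" if k: "k \<in> off_cycle c" "k \<noteq> f" and i: "i \<in> ?B" for k i
  proof
    assume iJ: "i \<in> J u k"
    have "J u k \<inter> (?B \<union> pm (J u f)) \<subseteq> {i}"
      using free_BC(1)[OF h k(1) nw[OF k] _ i] free_BC_NC(1)[OF h f k(1) nw[OF k] i iJ] iJ by blast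
    then have "J u k \<subseteq> insert i (?Z - (?B \<union> pm (J u f)))" using J_sub by blast
    then have "card (J u k) \<le> card (insert i (?Z - (?B \<union> pm (J u f))))" by (intro card_mono) auto
    also have "\<dots> \<le> 1 + card (?Z - (?B \<union> pm (J u f)))" by (simp add: card_insert_if)
    also have "card (?Z - (?B \<union> pm (J u f))) = n - 1 - card (?B \<union> pm (J u f))"
      using BZ pm_sub fB by (simp add: card_Diff_subset)
    also have "?B \<inter> pm (J u f) = {}" using BC_NC(2)[OF h] JN by (auto simp: pm_def)
    then have "card (?B \<union> pm (J u f)) = card ?B + (r - 1)"
      using fB card_pm[OF J_sub] cf by (simp add: card_Un_disjoint)
    finally have "r \<le> 1 + (n - 1 - (card ?B + (r - 1)))" using cJ[OF k] by simp
    then show False using arith r3 by linarith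
  qed
  have typeA': "sc i \<notin> J u k" if k: "k \<in> off_cycle c" "k \<noteq> f" and i: "i \<in> ?B" for k i
  proof
    assume iJ: "sc i \<in> J u k"
    have "J u k \<inter> (sc ` ?B \<union> sc ` J u f) \<subseteq> {sc i}"
      using free_BC(2)[OF h k(1) nw[OF k] _ i] free_BC_NC(2)[OF h f k(1) nw[OF k] i iJ] iJ by blast
    then have "J u k \<subseteq> insert (sc i) (?Z - (sc ` ?B \<union> sc ` J u f))" using J_sub by blast
    then have "card (J u k) \<le> card (insert (sc i) (?Z - (sc ` ?B \<union> sc ` J u f)))" by (intro card_mono) auto
    also have "\<dots> \<le> 1 + card (?Z - (sc ` ?B \<union> sc ` J u f))" by (simp add: card_insert_if)
    also have "card (?Z - (sc ` ?B \<union> sc ` J u f)) = n - 1 - card (sc ` ?B \<union> sc ` J u f)"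
      using fB by (subst card_Diff_subset) auto
    also have "?B \<inter> J u f = {}" using BC_NC(1)[OF h] JN by auto
    then have "card (sc ` (?B \<union> J u f)) = card ?B + (r - 1)"
      using card_sc[of "?B \<union> J u f"] BZ J_sub fB cf by (simp add: card_Un_disjoint)
    then have "card (sc ` ?B \<union> sc ` J u f) = card ?B + (r - 1)" by (simp add: image_Un)
    finally have "r \<le> 1 + (n - 1 - (card ?B + (r - 1)))" using cJ[OF k] by simp
    then show False using arith r3 by linarith
  qed
  have MZ: "?B \<union> sc ` ?B \<subseteq> ?Z" using BZ sc_image_sub by blast
  have sub: "J u k \<subseteq> ?Z - (?B \<union> sc ` ?B)" if "k \<in> off_cycle c" "k \<noteq> f" for k
    using typeA[OF that] typeA'[OF that] J_sub by blast
  have "J u f \<noteq> {}" by (rule notI) (use cf r3 in simp)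
  then have "?B \<noteq> ?Z" using BC_NC(1)[OF h] JN J_sub[of u f] by blast
  then have "sc ` ?B \<noteq> ?B" using sc_image_closed[OF BZ _ B0] by blast
  then have "?B \<subset> ?B \<union> sc ` ?B"
    using card_subset_eq[OF fB, of "sc ` ?B"] card_sc[OF BZ] by blast
  then have cM: "card ?B < card (?B \<union> sc ` ?B)" using fB by (intro psubset_card_mono) auto
  have cD: "card (?Z - (?B \<union> sc ` ?B)) = n - 1 - card (?B \<union> sc ` ?B)"
    using MZ fB by (subst card_Diff_subset) auto
  obtain k where k: "k \<in> off_cycle c" "k \<noteq> f"
  proof -
    have "\<not> off_cycle c \<subseteq> {f}" using CF_ge(1)[OF h] card_mono[of "{f}" "off_cycle c"] by auto
    then show thesis using that by blast
  qed
  have "r \<le> n - 1 - card (?B \<union> sc ` ?B)"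
    using card_mono[OF _ sub[OF k]] cJ[OF k] cD by simp
  then have le: "card ?B + 1 + r \<le> n - 1" using cM r3 by linarith
  have "r = t"
  proof (rule ccontr)
    assume "r \<noteq> t"
    then show False using big le b nt' rt r3 by linarith
  qed
  have c: "t choose (r - 1) = t" using choose_top[OF t3] \<open>r = t\<close> by simp
  \<comment> \<open>For r = t, \<open>BC\<close> has at least t elements and gains at least one by
    adding its shift, so of at most 2t + 1 positions no more than t = r are left.\<close>
  have "card (?Z - (?B \<union> sc ` ?B)) \<le> r" using cD cM b c le \<open>r = t\<close> nt by auto
  then have eq: "J u k = ?Z - (?B \<union> sc ` ?B)" if "k \<in> off_cycle c" "k \<noteq> f" for k
    using sub[OF that] cJ[OF that] by (intro card_seteq) auto
  have "off_cycle c \<subseteq> {f, k}"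
  proof
    fix x assume x: "x \<in> off_cycle c"
    show "x \<in> {f, k}"
    proof (cases "x = f")
      case False
      then have "x = k" using J_inj[OF h kE[OF x] kE[OF k(1)]] eq[OF x] eq[OF k] nw[OF x] nw[OF k] by simp
      then show ?thesis by simp
    qed simp
  qed
  then have "card (off_cycle c) \<le> card {f, k}" by (intro card_mono) auto
  also have "\<dots> \<le> 2" by (simp add: card_insert_if)
  finally show False using CF_ge(2)[OF h \<open>r = t\<close>] by simp
qed

text \<open>A shift puts \<open>f\<close> at positions 0 and 1, which block the indices 6, 0, 1, so
  \<open>BC\<close> is a 3-subset of {2,3,4,5}. Each of the four choices leaves at most two position
  sets for a free edge avoiding w, hence at most three free edges instead of four.\<close>

lemma cyc_consecutive_false:
  assumes h: "near_cycle w u c" and f: "f \<in> off_cycle c" "w \<in> f" and a: "a \<in> J u f" "sc a \<in> J u f"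
  shows False
proof -
  have S: "r = 3" "t = 3" "n = 8" "card (BC w c) = 3" using cyc_one_free[OF h f] by auto
  have n7: "n - 1 = 7" using S by simp
  have aL: "a < n - 1" using a by (simp add: J_def)
  define s where "s = sh a"
  note T = cyc_shift[OF h, of a, folded s_def]
  define u' c' where "u' = u \<circ> s" and "c' = c \<circ> s"
  have h': "near_cycle w u' c'" and CF': "off_cycle c' = off_cycle c" using T(1,2) by (auto simp: u'_def c'_def)
  have s0: "s 0 = a" "s 1 = sc a" using aL by (auto simp: s_def sh_def sc_def One_nat_def)
  have f': "f \<in> off_cycle c'" "w \<in> f" using f CF' by auto
  have fE: "f \<in> E" using f by (simp add: off_cycle_def)
  have sc7: "sc i = (if i = 6 then 0 else Suc i)" if "i < 7" for i
    using sc_cases[of i] that unfolding n7 by auto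
  have "u' 0 \<in> f" "u' 1 \<in> f" using a s0 by (auto simp: J_def u'_def)
  then have "{0, 1} \<subseteq> J u' f" by (auto simp: J_def n7)
  moreover have "card (J u' f) = 2" using J_edge(2)[OF h' fE] f S(1) by simp
  ultimately have Jf: "J u' f = {0, 1}"
    using card_subset_eq[OF J_fin, of "{0, 1}" u' f] by simp
  let ?B = "BC w c'"
  have cB: "card ?B = 3" using cyc_one_free[OF h' f'] by blast
  have BZ: "?B \<subseteq> {..<7}" by (auto simp: BC_def n7)
  have "J u' f \<subseteq> NC w u' c'" using f' by (auto simp: J_def NC_def)
  then have "?B \<inter> tc (J u' f) = {}" by (rule BC_tc[OF h'])
  moreover have "tc {0, 1} \<supseteq> {6, 0, 1}" using sc7[of 6] by (auto simp: tc_def pm_def n7)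
  ultimately have "?B \<subseteq> {..<7} - {6, 0, 1}" using BZ Jf by auto
  then have B4: "?B \<subseteq> {2, 3, 4, 5}" by (auto simp: lessThan_nat_numeral lessThan_Suc)
  have single: "k = f" if "k \<in> off_cycle c'" "w \<in> k" for k
    using cyc_free_le_1[OF h'] f' that finCF[of c'] by (auto simp: card_le_Suc0_iff_eq One_nat_def)
  have kk: "card (J u' k) = 3 \<and> J u' k \<subseteq> {..<7} \<and>
     (\<forall>i\<in>?B. \<forall>j\<in>?B. i \<noteq> j \<longrightarrow> \<not> (i \<in> J u' k \<and> j \<in> J u' k) \<and> \<not> (sc i \<in> J u' k \<and> sc j \<in> J u' k)) \<and>
     (\<forall>i\<in>?B. (i \<in> J u' k \<longrightarrow> 6 \<notin> J u' k \<and> 0 \<notin> J u' k) \<and> (sc i \<in> J u' k \<longrightarrow> 1 \<notin> J u' k \<and> 2 \<notin> J u' k))"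
    if k: "k \<in> off_cycle c'" "k \<noteq> f" for k
  proof -
    have wk: "w \<notin> k" using single k by blast
    have kE: "k \<in> E" using k by (simp add: off_cycle_def)
    have sv: "sc 6 = 0" "sc 0 = 1" "sc 1 = 2" using sc7[of 6] sc7[of 0] sc7[of 1] by simp_all
    have "6 \<in> pm (J u' f)" "0 \<in> pm (J u' f)" unfolding pm_def Jf n7 using sv by simp_all
    then have 1: "i \<in> J u' k \<Longrightarrow> 6 \<notin> J u' k \<and> 0 \<notin> J u' k" if "i \<in> ?B" for i
      using free_BC_NC(1)[OF h' f' k(1) wk that] by blast
    have 2: "sc i \<in> J u' k \<Longrightarrow> 1 \<notin> J u' k \<and> 2 \<notin> J u' k" if "i \<in> ?B" for i
      using free_BC_NC(2)[OF h' f' k(1) wk that, of 0] free_BC_NC(2)[OF h' f' k(1) wk that, of 1]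
      unfolding Jf sv by blast
    show ?thesis
      using J_edge(2)[OF h' kE] wk S(1) J_sub[of u' k, unfolded n7] free_BC[OF h' k(1) wk] 1 2 by simp
  qed
  have sv: "sc 2 = 3" "sc 3 = 4" "sc 4 = 5" "sc 5 = 6" using sc7[of 2] sc7[of 3] sc7[of 4] sc7[of 5] by simp_all
  have opt: "\<exists>A1 A2. \<forall>k. k \<in> off_cycle c' \<longrightarrow> k \<noteq> f \<longrightarrow> J u' k = A1 \<or> J u' k = A2"
  proof -
    have "card ({2, 3, 4, 5} - ?B) = 1" using B4 cB by (subst card_Diff_subset) (auto simp: finite_subset)
    then obtain x where x: "{2, 3, 4, 5} - ?B = {x}" by (meson card_1_singletonE)
    then have e: "?B = {2, 3, 4, 5} - {x}" and "x = 2 \<or> x = 3 \<or> x = 4 \<or> x = 5" using B4 by blast+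
    moreover have "{2, 3, 4, 5} - {2::nat} = {3, 4, 5}" "{2, 3, 4, 5} - {3::nat} = {2, 4, 5}"
      "{2, 3, 4, 5} - {4::nat} = {2, 3, 5}" "{2, 3, 4, 5} - {5::nat} = {2, 3, 4}" by auto
    ultimately consider "?B = {3, 4, 5}" | "?B = {2, 4, 5}" | "?B = {2, 3, 5}" | "?B = {2, 3, 4}" by metis
    then show ?thesis
    proof cases
      case 1
      have "J u' k = {1, 2, 3} \<or> J u' k = {0, 1, 2}" if "k \<in> off_cycle c'" "k \<noteq> f" for k
      proof -
        from kk[OF that] have K: "card (J u' k) = 3" "J u' k \<subseteq> {..<7}"
          "\<And>i j. i \<in> ?B \<Longrightarrow> j \<in> ?B \<Longrightarrow> i \<noteq> j \<Longrightarrow> \<not> (i \<in> J u' k \<and> j \<in> J u' k)"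
          "\<And>i j. i \<in> ?B \<Longrightarrow> j \<in> ?B \<Longrightarrow> i \<noteq> j \<Longrightarrow> \<not> (sc i \<in> J u' k \<and> sc j \<in> J u' k)"
          "\<And>i. i \<in> ?B \<Longrightarrow> i \<in> J u' k \<Longrightarrow> 6 \<notin> J u' k \<and> 0 \<notin> J u' k"
          "\<And>i. i \<in> ?B \<Longrightarrow> sc i \<in> J u' k \<Longrightarrow> 1 \<notin> J u' k \<and> 2 \<notin> J u' k" by blast+
        show ?thesis
          by (rule seven_345_idx[OF K(2,1) 1 K(3-6) sv])
      qed
      then show ?thesis by blast
    next
      case 2
      have False if "k \<in> off_cycle c'" "k \<noteq> f" for k
      proof -
        from kk[OF that] have K: "card (J u' k) = 3" "J u' k \<subseteq> {..<7}"
          "\<And>i j. i \<in> ?B \<Longrightarrow> j \<in> ?B \<Longrightarrow> i \<noteq> j \<Longrightarrow> \<not> (i \<in> J u' k \<and> j \<in> J u' k)"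
          "\<And>i j. i \<in> ?B \<Longrightarrow> j \<in> ?B \<Longrightarrow> i \<noteq> j \<Longrightarrow> \<not> (sc i \<in> J u' k \<and> sc j \<in> J u' k)"
          "\<And>i. i \<in> ?B \<Longrightarrow> i \<in> J u' k \<Longrightarrow> 6 \<notin> J u' k \<and> 0 \<notin> J u' k"
          "\<And>i. i \<in> ?B \<Longrightarrow> sc i \<in> J u' k \<Longrightarrow> 1 \<notin> J u' k \<and> 2 \<notin> J u' k" by blast+
        show ?thesis
          by (rule seven_245_idx[OF K(2,1) 2 K(3-6) sv])
      qed
      then show ?thesis by blast
    next
      case 3
      have False if "k \<in> off_cycle c'" "k \<noteq> f" for k
      proof -
        from kk[OF that] have K: "card (J u' k) = 3" "J u' k \<subseteq> {..<7}"
          "\<And>i j. i \<in> ?B \<Longrightarrow> j \<in> ?B \<Longrightarrow> i \<noteq> j \<Longrightarrow> \<not> (i \<in> J u' k \<and> j \<in> J u' k)"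
          "\<And>i j. i \<in> ?B \<Longrightarrow> j \<in> ?B \<Longrightarrow> i \<noteq> j \<Longrightarrow> \<not> (sc i \<in> J u' k \<and> sc j \<in> J u' k)"
          "\<And>i. i \<in> ?B \<Longrightarrow> i \<in> J u' k \<Longrightarrow> 6 \<notin> J u' k \<and> 0 \<notin> J u' k"
          "\<And>i. i \<in> ?B \<Longrightarrow> sc i \<in> J u' k \<Longrightarrow> 1 \<notin> J u' k \<and> 2 \<notin> J u' k" by blast+
        show ?thesis
          by (rule seven_235_idx[OF K(2,1) 3 K(3-6) sv])
      qed
      then show ?thesis by blast
    next
      case 4
      have "J u' k = {0, 5, 6} \<or> J u' k = {0, 1, 6}" if "k \<in> off_cycle c'" "k \<noteq> f" for k
      proof -
        from kk[OF that] have K: "card (J u' k) = 3" "J u' k \<subseteq> {..<7}"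
          "\<And>i j. i \<in> ?B \<Longrightarrow> j \<in> ?B \<Longrightarrow> i \<noteq> j \<Longrightarrow> \<not> (i \<in> J u' k \<and> j \<in> J u' k)"
          "\<And>i j. i \<in> ?B \<Longrightarrow> j \<in> ?B \<Longrightarrow> i \<noteq> j \<Longrightarrow> \<not> (sc i \<in> J u' k \<and> sc j \<in> J u' k)"
          "\<And>i. i \<in> ?B \<Longrightarrow> i \<in> J u' k \<Longrightarrow> 6 \<notin> J u' k \<and> 0 \<notin> J u' k"
          "\<And>i. i \<in> ?B \<Longrightarrow> sc i \<in> J u' k \<Longrightarrow> 1 \<notin> J u' k \<and> 2 \<notin> J u' k" by blast+
        show ?thesis
          by (rule seven_234_idx[OF K(2,1) 4 K(3-6) sv])
      qed
      then show ?thesis by blast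
    qed
  qed
  then obtain A1 A2 where A: "\<And>k. k \<in> off_cycle c' \<Longrightarrow> k \<noteq> f \<Longrightarrow> J u' k = A1 \<or> J u' k = A2" by blast
  have inj: "inj_on (J u') (off_cycle c' - {f})"
  proof (rule inj_onI)
    fix x y assume "x \<in> off_cycle c' - {f}" "y \<in> off_cycle c' - {f}" "J u' x = J u' y"
    then show "x = y" using J_inj[OF h', of x y] single by (auto simp: off_cycle_def)
  qed
  have "card (off_cycle c' - {f}) = card (J u' ` (off_cycle c' - {f}))" using inj by (simp add: card_image)
  also have "\<dots> \<le> card {A1, A2}" using A by (intro card_mono) auto
  also have "\<dots> \<le> 2" by (simp add: card_insert_if)
  finally have "card (off_cycle c') \<le> 3" using f' finCF[of c'] by (simp add: card_Diff_singleton)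
  then show False using CF_ge(2)[OF h'] S by simp
qed

text \<open>\<open>int\<close> consists of the positions where w can be exchanged, \<open>St\<close>
  of the first positions of the runs of \<open>BC\<close>, \<open>En\<close> of the positions just
  after the runs; \<iota> counts the runs. The aim is that every exchangeable vertex lies in the
  same cycle edges as w, which overfills one edge.\<close>

lemma cyc_no_free_false:
  assumes h: "near_cycle w u c" and d: "card {f \<in> off_cycle c. w \<in> f} = 0"
  shows False
proof -
  let ?B = "BC w c" and ?Z = "{..<n - 1}"
  note H = cycD[OF h]
  have S: "r = t" "n - 1 = 2 * t + 1" "card ?B = t + 1" using cyc_no_free[OF h d] by auto
  have BZ: "?B \<subseteq> ?Z" by (auto simp: BC_def)
  have fB: "finite ?B" using BZ finite_subset by blast
  have nw: "w \<notin> k" if "k \<in> off_cycle c" for k using d finCF that by auto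
  have kE: "k \<in> E" if "k \<in> off_cycle c" for k using that by (simp add: off_cycle_def)
  have cJ: "card (J u k) = r" if "k \<in> off_cycle c" for k using J_edge(2)[OF h kE[OF that]] nw[OF that] by simp
  have J1: "card (J u k \<inter> ?B) \<le> 1" "card (J u k \<inter> sc ` ?B) \<le> 1" if "k \<in> off_cycle c" for k
    using free_BC_card[OF h that nw[OF that]] .
  define int where "int = ?B \<inter> sc ` ?B"
  define St where "St = ?B - sc ` ?B"
  define En where "En = sc ` ?B - ?B"
  define Ou where "Ou = ?Z - (?B \<union> sc ` ?B)"
  define \<iota> where "\<iota> = card St"
  have fin: "finite int" "finite St" "finite En" "finite Ou" using fB by (auto simp: int_def St_def En_def Ou_def)
  have csB: "card (sc ` ?B) = t + 1" using card_sc[OF BZ] S by simp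
  have cint: "card int + \<iota> = t + 1"
  proof -
    have "?B = int \<union> St" "int \<inter> St = {}" by (auto simp: int_def St_def)
    then show ?thesis using card_Un_disjoint[OF fin(1,2)] S by (simp add: \<iota>_def)
  qed
  have cEn: "card En = \<iota>"
  proof -
    have "sc ` ?B = int \<union> En" "int \<inter> En = {}" by (auto simp: int_def En_def)
    then have "card (sc ` ?B) = card int + card En" using card_Un_disjoint[OF fin(1,3)] by simp
    then show ?thesis using csB cint by simp
  qed
  have cO: "card Ou + (t + 1 + \<iota>) = n - 1"
  proof -
    have "?B \<union> sc ` ?B = ?B \<union> En" "?B \<inter> En = {}" by (auto simp: En_def)
    then have c: "card (?B \<union> sc ` ?B) = t + 1 + \<iota>" using card_Un_disjoint[OF fB fin(3)] S cEn by simp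
    have sub: "?B \<union> sc ` ?B \<subseteq> ?Z" using BZ sc_image_sub by blast
    then have "card Ou = n - 1 - (t + 1 + \<iota>)" unfolding Ou_def using c fB by (subst card_Diff_subset) auto
    moreover have "t + 1 + \<iota> \<le> n - 1" using card_mono[OF _ sub] c by simp
    ultimately show ?thesis by simp
  qed
  have B0: "?B \<noteq> {}" "?B \<noteq> ?Z"
    by (rule notI, use S(3) in simp) (rule notI, use S(2,3) t3 in simp)
  have io1: "1 \<le> \<iota>"
  proof (rule ccontr)
    assume "\<not> 1 \<le> \<iota>"
    then have "card St = 0" unfolding \<iota>_def by linarith
    then have "St = {}" using fin by simp
    then have "?B \<subseteq> sc ` ?B" by (auto simp: St_def)
    then have "?B = sc ` ?B" using csB S fB by (intro card_subset_eq) auto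
    then show False using sc_image_closed[OF BZ _ B0(1)] B0(2) by simp
  qed
  have part: "x \<in> int \<or> x \<in> St \<or> x \<in> En \<or> x \<in> Ou" if "x < n - 1" for x
    using that by (auto simp: int_def St_def En_def Ou_def)
  have swap: "near_cycle (u j) (u(j := w)) c" if j: "j \<in> int" for j
  proof -
    obtain p where "p \<in> ?B" "sc p = j" using j by (auto simp: int_def)
    then show ?thesis using j cyc_swap[OF h, of j p] by (auto simp: int_def BC_def)
  qed
  \<comment> \<open>Otherwise, after the exchange, the missing vertex has a free edge, so r = t = 3
    and n = 8. Then k fills \<open>Ou\<close> apart from j, there is only one run, and so
    \<open>Ou\<close> has two consecutive positions, which \<open>cyc_consecutive_false\<close>
    excludes.\<close>
  have avoid: "k \<inter> u ` int = {}" if k: "k \<in> off_cycle c" for k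
  proof (rule ccontr)
    assume "k \<inter> u ` int \<noteq> {}"
    then obtain j where j: "j \<in> int" "u j \<in> k" by blast
    then have jL: "j < n - 1" and jB: "j \<in> ?B" "j \<in> sc ` ?B" using BZ by (auto simp: int_def)
    note h' = swap[OF j(1)]
    have S': "r = 3" "t = 3" "n - 1 = 7" using cyc_one_free[OF h' k j(2)] by auto
    have jJ: "j \<in> J u k" using j jL by (simp add: J_def)
    have one: "A = {j}" if "j \<in> A" "finite A" "card A \<le> 1" for A
      using card_seteq[of A "{j}"] that by simp
    have 1: "J u k \<inter> ?B = {j}" "J u k \<inter> sc ` ?B = {j}"
      by (rule one, use jJ jB(1) J1(1)[OF k] in blast, simp, rule J1(1)[OF k])
         (rule one, use jJ jB(2) in blast, simp, rule J1(2)[OF k])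
    have sub: "J u k - {j} \<subseteq> Ou" using 1 J_sub[of u k] by (auto simp: Ou_def)
    have "card (J u k - {j}) = 2" using cJ[OF k] jJ S' by simp
    moreover have "card Ou \<le> 2" using cO io1 S' by simp
    ultimately have O2: "J u k - {j} = Ou" "card Ou = 2" using card_seteq[OF fin(4) sub] sub fin by auto
    then have "\<iota> = 1" using cO S' by simp
    then obtain y where y: "En = {y}" using cEn by (metis card_1_singletonE)
    obtain p q where pq: "Ou = {p, q}" "p \<noteq> q" using O2(2) by (meson card_2_iff)
    have scO: "sc x \<in> Ou \<union> St" if "x \<in> Ou" for x
    proof -
      have "sc x \<notin> sc ` ?B"
      proof
        assume "sc x \<in> sc ` ?B"
        then obtain z where "z \<in> ?B" "sc x = sc z" by blast
        then have "x = z" using sc_inj[of x z] that BZ by (auto simp: Ou_def)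
        then show False using that \<open>z \<in> ?B\<close> by (simp add: Ou_def)
      qed
      then show ?thesis by (auto simp: Ou_def St_def)
    qed
    obtain z where z: "St = {z}" using \<open>\<iota> = 1\<close> unfolding \<iota>_def by (metis card_1_singletonE)
    have pqL: "p < n - 1" "q < n - 1" using pq by (auto simp: Ou_def)
    have "sc p \<in> {p, q, z}" "sc q \<in> {p, q, z}" using scO[of p] scO[of q] pq z by auto
    then have "sc p = q \<or> sc q = p" using sc_neq(1)[OF pqL(1)] sc_neq(1)[OF pqL(2)] sc_inj[OF pqL] pq by auto
    then obtain a where a: "a \<in> Ou" "sc a \<in> Ou" using pq by auto
    have "x \<in> J (u(j := w)) k" if "x \<in> Ou" for x using that O2(1) by (auto simp: J_def)
    then show False using cyc_consecutive_false[OF h' k j(2), of a] a by blast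
  qed
  have JW: "J u k \<subseteq> St \<union> En \<union> Ou" if kC: "k \<in> off_cycle c" for k
  proof
    fix x assume x: "x \<in> J u k"
    then have x1: "x < n - 1" "u x \<in> k" by (auto simp: J_def)
    have "x \<notin> int" using avoid[OF kC] x1(2) by blast
    then show "x \<in> St \<union> En \<union> Ou" using part[OF x1(1)] by blast
  qed
  have JS: "card (J u k \<inter> St) \<le> 1" "card (J u k \<inter> En) \<le> 1" if "k \<in> off_cycle c" for k
  proof -
    have "card (J u k \<inter> St) \<le> card (J u k \<inter> ?B)" by (rule card_mono) (auto simp: St_def)
    then show "card (J u k \<inter> St) \<le> 1" using J1(1)[OF that] by simp
    have "card (J u k \<inter> En) \<le> card (J u k \<inter> sc ` ?B)" by (rule card_mono) (auto simp: En_def)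
    then show "card (J u k \<inter> En) \<le> 1" using J1(2)[OF that] by simp
  qed
  have cW: "card (J u k) = card (J u k \<inter> St) + card (J u k \<inter> En) + card (J u k \<inter> Ou)" if "k \<in> off_cycle c" for k
  proof -
    have "J u k = (J u k \<inter> St) \<union> (J u k \<inter> En) \<union> (J u k \<inter> Ou)" using JW[OF that] by blast
    also have "card \<dots> = card ((J u k \<inter> St) \<union> (J u k \<inter> En)) + card (J u k \<inter> Ou)"
      by (rule card_Un_disjoint) (auto simp: St_def En_def Ou_def)
    also have "card ((J u k \<inter> St) \<union> (J u k \<inter> En)) = card (J u k \<inter> St) + card (J u k \<inter> En)"
      by (rule card_Un_disjoint) (auto simp: St_def En_def)
    finally show ?thesis .
  qed
  obtain k0 where k0: "k0 \<in> off_cycle c" using CF_ge(1)[OF h] by fastforce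
  have "card (J u k0 \<inter> Ou) \<le> card Ou" by (rule card_mono[OF fin(4)]) auto
  \<comment> \<open>A free edge has t positions: at most one in \<open>St\<close>, one in
    \<open>En\<close> and t - \<iota> in \<open>Ou\<close>.\<close>
  then have io2: "\<iota> \<le> 2" using cW[OF k0] JS[OF k0] cJ[OF k0] cO S by simp
  have inj: "inj_on (J u) (off_cycle c)" by (rule inj_onI) (use J_inj[OF h] kE nw in blast)
  \<comment> \<open>\<open>BC (u j) c\<close> and its shift both have t + 1 elements and meet every
    free edge in at most one position. There are enough free edges for this to determine
    \<open>BC (u j) c\<close>.\<close>
  have B': "BC (u j) c = ?B" if j: "j \<in> int" for j
  proof -
    let ?B' = "BC (u j) c"
    note h' = swap[OF j]
    have jL: "j < n - 1" using j BZ by (auto simp: int_def)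
    have nj: "u j \<notin> k" if "k \<in> off_cycle c" for k using avoid[OF that] j by blast
    then have e: "{f \<in> off_cycle c. u j \<in> f} = {}" by blast
    then have "card {f \<in> off_cycle c. u j \<in> f} = 0" by (metis card.empty)
    then have cB': "card ?B' = t + 1" using cyc_no_free[OF h'] by blast
    have BZ': "?B' \<subseteq> ?Z" by (auto simp: BC_def)
    have fB': "finite ?B'" using BZ' finite_subset by blast
    have JJ: "J (u(j := w)) k = J u k" if "k \<in> off_cycle c" for k using nw[OF that] nj[OF that] by (auto simp: J_def)
    have P: "card (J u k \<inter> ?B') \<le> 1" "card (J u k \<inter> sc ` ?B') \<le> 1" if "k \<in> off_cycle c" for k
      using free_BC_card[OF h' that nj[OF that]] JJ[OF that] by auto
    have csB': "card (sc ` ?B') = t + 1" using card_sc[OF BZ'] cB' by simp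
    show ?thesis
    proof (cases "\<iota> = 1")
      case True
      let ?W = "St \<union> En \<union> Ou"
      have cWW: "card ?W = t + 1"
      proof -
        have "card ?W = card (St \<union> En) + card Ou"
          by (rule card_Un_disjoint) (use fin in \<open>auto simp: St_def En_def Ou_def\<close>)
        also have "card (St \<union> En) = card St + card En"
          by (rule card_Un_disjoint) (use fin in \<open>auto simp: St_def En_def\<close>)
        finally have "card ?W = card St + card En + card Ou" .
        then show ?thesis using True cEn cO S by (simp add: \<iota>_def)
      qed
      \<comment> \<open>A free edge omits exactly one of the t + 1 positions in \<open>?W\<close>.
        If none contained both x and y, each would omit x or y, leaving at most two free
        edges.\<close>
      have common: "\<exists>k\<in>off_cycle c. x \<in> J u k \<and> y \<in> J u k" if xy: "x \<in> ?W" "y \<in> ?W" for x y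
      proof (rule ccontr)
        assume no: "\<not> ?thesis"
        have "J u k = ?W - {x} \<or> J u k = ?W - {y}" if k: "k \<in> off_cycle c" for k
        proof -
          have *: "J u k = ?W - {z}" if "z \<in> ?W" "z \<notin> J u k" for z
          proof (rule card_seteq)
            show "finite (?W - {z})" using fin by simp
            show "J u k \<subseteq> ?W - {z}" using JW[OF k] that by blast
            show "card (?W - {z}) \<le> card (J u k)" using cWW that cJ[OF k] S fin by simp
          qed
          show ?thesis using no k *[of x] *[of y] xy by blast
        qed
        then have "J u ` off_cycle c \<subseteq> {?W - {x}, ?W - {y}}" by blast
        then have "card (J u ` off_cycle c) \<le> card {?W - {x}, ?W - {y}}" by (rule card_mono[rotated]) simp
        also have "\<dots> \<le> 2" by (simp add: card_insert_if)
        finally have "card (off_cycle c) \<le> 2" using card_image[OF inj] by simp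
        then show False using CF_ge(2)[OF h S(1)] by simp
      qed
      have sup: "int \<subseteq> A \<and> card (A - int) = 1" if A: "A \<subseteq> ?Z" "card A = t + 1" "\<And>k. k \<in> off_cycle c \<Longrightarrow> card (J u k \<inter> A) \<le> 1" for A
      proof -
        have fA: "finite A" using A finite_subset by blast
        have "x = y" if "x \<in> A - int" "y \<in> A - int" for x y
        proof -
          have "x \<in> ?W" "y \<in> ?W" using that part A(1) by auto
          then obtain k where k: "k \<in> off_cycle c" "x \<in> J u k" "y \<in> J u k" using common by blast
          then have "{x, y} \<subseteq> J u k \<inter> A" using that by auto
          then have "card {x, y} \<le> 1" using A(3)[OF k(1)] card_mono[of "J u k \<inter> A" "{x, y}"] by auto
          then show ?thesis by (cases "x = y") auto
        qed
        then have 1: "card (A - int) \<le> 1" using fA by (auto simp: card_le_Suc0_iff_eq One_nat_def)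
        have "card A = card (A \<inter> int) + card (A - int)" using fA by (metis card_Int_Diff)
        moreover have "card (A \<inter> int) \<le> card int" using fin by (intro card_mono) auto
        ultimately have "card (A \<inter> int) = card int" "card (A - int) = 1" using 1 A(2) cint True by auto
        then show ?thesis using card_subset_eq[OF fin(1), of "A \<inter> int"] by auto
      qed
      have s1: "int \<subseteq> ?B'" "card (?B' - int) = 1" using sup[OF BZ' cB' P(1)] by auto
      have s2: "int \<subseteq> sc ` ?B'" using sup[OF sc_image_sub csB' P(2)] by auto
      obtain s where s: "St = {s}" using True unfolding \<iota>_def by (metis card_1_singletonE)
      have sL: "s \<in> ?B" "s < n - 1" "s \<notin> int" using s BZ by (auto simp: St_def int_def)
      have "sc s \<in> int"
      proof (rule ccontr)
        assume ns: "sc s \<notin> int"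
        have "pm int \<subseteq> int"
        proof
          fix i assume i: "i \<in> pm int"
          then have "sc i \<in> sc ` ?B" "i < n - 1" "sc i \<in> int" by (auto simp: pm_def int_def)
          then obtain j where j: "j \<in> ?B" "sc i = sc j" by blast
          then have "i = j" using sc_inj[of i j] BZ \<open>i < n - 1\<close> by auto
          then have "i \<in> ?B" "i \<noteq> s" using j ns \<open>sc i \<in> int\<close> by auto
          then show "i \<in> int" using s by (auto simp: St_def int_def)
        qed
        moreover have "int \<subseteq> ?Z" using BZ by (auto simp: int_def)
        ultimately have "int = ?Z" using pm_closed j by blast
        then show False using sL by auto
      qed
      then have "sc s \<in> sc ` ?B'" using s2 by blast
      then obtain z where "z \<in> ?B'" "sc s = sc z" by blast
      then have "s \<in> ?B'" using sc_inj[of s z] sL BZ' by auto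
      then have "?B \<subseteq> ?B'" using s1(1) s by (auto simp: St_def int_def)
      then show ?thesis using card_subset_eq[OF fB', of ?B] cB' S by simp
    next
      case False
      then have io: "\<iota> = 2" using io1 io2 by simp
      have cO2: "card Ou + 2 = t" using cO io S by simp
      have O0: "Ou \<noteq> {}"
      proof
        assume "Ou = {}" then show False using cO2 t3 by simp
      qed
      have full: "Ou \<subseteq> J u k \<and> card (J u k \<inter> St) = 1 \<and> card (J u k \<inter> En) = 1" if k: "k \<in> off_cycle c" for k
      proof -
        have "card (J u k \<inter> Ou) \<le> card Ou" by (rule card_mono[OF fin(4)]) auto
        then have "card (J u k \<inter> Ou) = card Ou" "card (J u k \<inter> St) = 1" "card (J u k \<inter> En) = 1"
          using cW[OF k] JS[OF k] cJ[OF k] cO2 S by auto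
        then show ?thesis using card_subset_eq[OF fin(4), of "J u k \<inter> Ou"] by auto
      qed
      \<comment> \<open>Each free edge contains \<open>Ou\<close>, one point of \<open>St\<close>
        and one of \<open>En\<close>, so one of four pairs determines it. As there are four free
        edges, every pair occurs.\<close>
      have pair: "\<exists>k\<in>off_cycle c. s \<in> J u k \<and> z \<in> J u k" if sz: "s \<in> St" "z \<in> En" for s z
      proof (rule ccontr)
        assume no: "\<not> ?thesis"
        define g where "g k = (J u k \<inter> St, J u k \<inter> En)" for k
        have g_inj: "inj_on g (off_cycle c)"
        proof (rule inj_onI)
          fix x y assume xy: "x \<in> off_cycle c" "y \<in> off_cycle c" "g x = g y"
          have "J u k = (J u k \<inter> St) \<union> (J u k \<inter> En) \<union> Ou" if "k \<in> off_cycle c" for k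
            using JW[OF that] full[OF that] by blast
          then have "J u x = J u y" using xy unfolding g_def by (metis prod.inject)
          then show "x = y" using inj xy by (auto dest: inj_onD)
        qed
        have im: "g ` off_cycle c \<subseteq> ((\<lambda>x. {x}) ` St) \<times> ((\<lambda>x. {x}) ` En) - {({s}, {z})}"
        proof
          fix q assume "q \<in> g ` off_cycle c"
          then obtain k where k: "k \<in> off_cycle c" "q = g k" by blast
          obtain x y where xy: "J u k \<inter> St = {x}" "J u k \<inter> En = {y}" using full[OF k(1)] by (meson card_1_singletonE)
          then have "x \<in> St" "y \<in> En" "x \<in> J u k" "y \<in> J u k" by auto
          moreover have "\<not> (x = s \<and> y = z)" using no k calculation by blast
          ultimately show "q \<in> ((\<lambda>x. {x}) ` St) \<times> ((\<lambda>x. {x}) ` En) - {({s}, {z})}"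
            unfolding k(2) g_def xy by auto
        qed
        have "card (((\<lambda>x. {x}) ` St) \<times> ((\<lambda>x. {x}) ` En) - {({s}, {z})}) = 3"
          using sz cEn io fin by (simp add: card_cartesian_product card_image \<iota>_def)
        then have "card (g ` off_cycle c) \<le> 3" using card_mono[OF _ im] fin by simp
        then show False using card_image[OF g_inj] CF_ge(2)[OF h S(1)] by simp
      qed
      have En2: "En \<noteq> {}" "St \<noteq> {}" using cEn io by (auto simp: \<iota>_def)
      have two: "A = ?B \<or> A = sc ` ?B" if A: "A \<subseteq> ?Z" "card A = t + 1" "\<And>k. k \<in> off_cycle c \<Longrightarrow> card (J u k \<inter> A) \<le> 1" for A
      proof -
        have fA: "finite A" using A finite_subset by blast
        have excl: "\<not> (x \<in> J u k \<and> y \<in> J u k)" if "x \<in> A" "y \<in> A" "x \<noteq> y" "k \<in> off_cycle c" for x y k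
        proof
          assume "x \<in> J u k \<and> y \<in> J u k"
          then have "{x, y} \<subseteq> J u k \<inter> A" using that by auto
          then have "card {x, y} \<le> 1" using A(3)[OF that(4)] card_mono[of "J u k \<inter> A" "{x, y}"] by auto
          then show False using that by simp
        qed
        have "card A = card (A \<inter> int) + card (A - int)" using fA by (metis card_Int_Diff)
        moreover have "card (A \<inter> int) \<le> card int" using fin by (intro card_mono) auto
        ultimately have 2: "2 \<le> card (A - int)" using A(2) cint io by simp
        have noO: "A \<inter> Ou = {}"
        proof (rule ccontr)
          assume "A \<inter> Ou \<noteq> {}"
          then obtain o' where o': "o' \<in> A" "o' \<in> Ou" by blast
          have "\<not> A - int \<subseteq> {o'}" using 2 card_mono[of "{o'}" "A - int"] by auto
          then obtain x where x: "x \<in> A" "x \<notin> int" "x \<noteq> o'" by blast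
          have "\<exists>k\<in>off_cycle c. x \<in> J u k"
            using part[of x] x A(1) full[OF k0] k0 pair En2 by blast
          then show False using excl[OF x(1) o'(1) x(3)] full o' by blast
        qed
        have sub: "A - int \<subseteq> St \<or> A - int \<subseteq> En"
        proof (rule ccontr)
          assume "\<not> ?thesis"
          then obtain x y where xy: "x \<in> A" "x \<in> En" "y \<in> A" "y \<in> St"
            using part A(1) noO by blast
          then have "x \<noteq> y" by (auto simp: En_def St_def)
          then show False using pair[OF xy(4,2)] excl[OF xy(1,3)] by blast
        qed
        have *: "A = X" if "A - int \<subseteq> X - int" "int \<subseteq> X" "card X = t + 1" "finite X" for X
        proof -
          have "A \<subseteq> X" using that by blast
          then show ?thesis using card_subset_eq[OF that(4)] that(3) A(2) by simp
        qed
        show ?thesis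
        proof (cases "A - int \<subseteq> St")
          case True
          then have "A = ?B" using S fB by (intro *) (auto simp: St_def int_def)
          then show ?thesis ..
        next
          case False
          then have "A - int \<subseteq> En" using sub by blast
          then have "A = sc ` ?B" using csB fB by (intro *) (auto simp: En_def int_def)
          then show ?thesis ..
        qed
      qed
      have t1: "?B' = ?B \<or> ?B' = sc ` ?B" by (rule two[OF BZ' cB' P(1)])
      have t2: "sc ` ?B' = ?B \<or> sc ` ?B' = sc ` ?B" by (rule two[OF sc_image_sub csB' P(2)])
      show ?thesis
      proof (rule ccontr)
        assume ne: "?B' \<noteq> ?B"
        then have e1: "?B' = sc ` ?B" using t1 by blast
        have "sc ` ?B' \<noteq> sc ` ?B"
        proof
          assume "sc ` ?B' = sc ` ?B"
          moreover have "inj_on sc ?Z" by (auto simp: inj_on_def sc_inj)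
          ultimately show False using ne BZ BZ' by (simp add: inj_on_image_eq_iff)
        qed
        \<comment> \<open>Shifting twice would fix \<open>BC w c\<close>. Then \<open>Ou\<close> is
          invariant under the shift and would be the whole circle.\<close>
        then have e2: "sc ` sc ` ?B = ?B" using t2 e1 by simp
        have injZ: "inj_on sc ?Z" by (auto simp: inj_on_def sc_inj)
        have scZ: "sc ` ?Z = ?Z" using sc_surj by (auto simp: image_iff)
        have "sc ` Ou = sc ` ?Z - sc ` (?B \<union> sc ` ?B)"
          unfolding Ou_def using injZ BZ sc_image_sub by (intro inj_on_image_set_diff[of sc ?Z]) auto
        also have "\<dots> = Ou" unfolding scZ image_Un e2 Ou_def by blast
        finally have "Ou = ?Z" using sc_image_closed[of Ou] O0 by (auto simp: Ou_def)
        then show False using B0(1) BZ by (auto simp: Ou_def)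
      qed
    qed
  qed
  obtain s where s: "s \<in> St" using io1 unfolding \<iota>_def by (metis all_not_in_conv card.empty not_one_le_zero)
  then have sB: "s \<in> ?B" "s \<notin> int" "s < n - 1" using BZ by (auto simp: St_def int_def)
  \<comment> \<open>The cycle edge at the start of a run contains w, its own vertex and all
    exchangeable vertices, t + 3 - \<iota> > r in number.\<close>
  have "insert w (u ` insert s int) \<subseteq> c s"
  proof -
    have "u j \<in> c s" if "j \<in> int" for j using B'[OF that] sB by (auto simp: BC_def)
    then show ?thesis using sB H(5) by (auto simp: BC_def)
  qed
  moreover have "card (insert w (u ` insert s int)) = card int + 2"
  proof -
    have sub: "insert s int \<subseteq> ?Z" using sB BZ by (auto simp: int_def)
    then have "w \<notin> u ` insert s int" using H(9) by auto
    then show ?thesis using card_u_image[OF h sub] sB fin by simp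
  qed
  moreover have "card (c s) = r" "finite (c s)" using Er H(7) sB finite_edge by auto
  ultimately have "card int + 2 \<le> r" by (metis card_mono)
  then show False using cint io2 S by simp
qed

text \<open>What remains is r = t = 3, n = 8 with one free edge \<open>f\<close> at w on two
  non-consecutive positions. These block four of the seven indices, so \<open>BC\<close> is the
  complement; it has two consecutive indices and hence an exchangeable vertex u_j. The free edge of
  u_j has, after the exchange, the same positions as \<open>f\<close>, so u_j lies in the same cycle
  edges as w. The third of these edges then has four vertices.\<close>

lemma no_near_cycle:
  assumes h: "near_cycle w u c"
  shows False
proof (cases "card {f \<in> off_cycle c. w \<in> f} = 0")
  case True
  then show False using cyc_no_free_false[OF h] by simp
next
  case False
  then obtain f where f: "f \<in> off_cycle c" "w \<in> f" by (metis (no_types, lifting) card.empty empty_Collect_eq)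
  let ?B = "BC w c" and ?Z = "{..<n - 1}"
  note H = cycD[OF h]
  have S: "r = 3" "t = 3" "n - 1 = 7" "card ?B = 3" using cyc_one_free[OF h f] by auto
  have BZ: "?B \<subseteq> ?Z" by (auto simp: BC_def)
  have fB: "finite ?B" using BZ finite_subset by blast
  have fE: "f \<in> E" using f by (simp add: off_cycle_def)
  have cf: "card (J u f) = 2" using J_edge(2)[OF h fE] f S by simp
  have JN: "J u f \<subseteq> NC w u c" using f by (auto simp: J_def NC_def)
  have nc: "sc a \<notin> J u f" if "a \<in> J u f" for a using cyc_consecutive_false[OF h f that] by blast
  have ctc: "card (tc (J u f)) = 4" using tc_indep[OF J_sub nc] cf by simp
  have comp: "BC x c = ?Z - tc (J u f)" if "BC x c \<inter> tc (J u f) = {}" "card (BC x c) = 3" for x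
  proof (rule card_subset_eq)
    show "BC x c \<subseteq> ?Z - tc (J u f)" using that by (auto simp: BC_def)
    show "card (BC x c) = card (?Z - tc (J u f))"
      using that ctc tc_sub[OF J_sub, of u f] S by (subst card_Diff_subset) (auto simp: tc_def)
  qed simp
  have Beq: "?B = ?Z - tc (J u f)" using comp BC_tc[OF h JN] S by blast
  have "(?B \<union> sc ` ?B) \<inter> J u f = {}" using BC_NC[OF h] JN by blast
  then have "card (?B \<union> sc ` ?B) + card (J u f) = card (?B \<union> sc ` ?B \<union> J u f)"
    using card_Un_disjoint[of "?B \<union> sc ` ?B" "J u f"] fB by simp
  also have "\<dots> \<le> card ?Z" using BZ sc_image_sub[of ?B] J_sub[of u f] by (intro card_mono) auto
  finally have "card (?B \<union> sc ` ?B) + card (J u f) \<le> 7" using S by simp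
  then have "?B \<inter> sc ` ?B \<noteq> {}"
    using card_Un_disjoint[of ?B "sc ` ?B"] fB card_sc[OF BZ] S cf by auto
  then obtain j p where j: "j \<in> ?B" "p \<in> ?B" "sc p = j" by blast
  then have jL: "j < n - 1" "p < n - 1" "w \<in> c p" "w \<in> c j" by (auto simp: BC_def)
  note h' = cyc_swap[OF h jL(1,2) j(3) jL(3,4)]
  have "card {f \<in> off_cycle c. u j \<in> f} \<noteq> 0" using cyc_no_free_false[OF h'] by blast
  then obtain k where k: "k \<in> off_cycle c" "u j \<in> k" by (metis (no_types, lifting) card.empty empty_Collect_eq)
  have kE: "k \<in> E" using k by (simp add: off_cycle_def)
  have jN: "j \<notin> J u f" using BC_NC(1)[OF h j(1)] JN by blast
  then have kf: "k \<noteq> f" using k jL by (auto simp: J_def)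
  have wk: "w \<notin> k"
    using cyc_free_le_1[OF h] f k kf finCF[of c] by (auto simp: card_le_Suc0_iff_eq One_nat_def)
  have jJ: "j \<in> J u k" using k jL by (simp add: J_def)
  have "J u k \<inter> (?B \<union> pm (J u f)) \<subseteq> {j}"
    using free_BC(1)[OF h k(1) wk _ j(1)] free_BC_NC(1)[OF h f k(1) wk j(1) jJ] jJ by blast
  then have sub: "J u k - {j} \<subseteq> ?Z - (?B \<union> pm (J u f))" using J_sub[of u k] by blast
  also have "\<dots> = J u f" using Beq J_sub[of u f] nc pm_sub[of "J u f"] by (auto simp: tc_def pm_def)
  finally have "J u k - {j} = J u f"
    using J_edge(2)[OF h kE] wk jJ S cf by (intro card_subset_eq) auto
  then have Jk: "J (u(j := w)) k = J u f" using wk by (auto simp: J_def)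
  have "card (BC (u j) c) = 3" using cyc_one_free[OF h' k] by blast
  moreover have "BC (u j) c \<inter> tc (J u f) = {}"
    unfolding Jk[symmetric] using k by (intro BC_tc[OF h']) (auto simp: J_def NC_def)
  ultimately have Bj: "BC (u j) c = ?B" using comp[of "u j"] Beq by simp
  have "\<not> ?B \<subseteq> {j, p}"
  proof
    assume "?B \<subseteq> {j, p}"
    then have "card ?B \<le> card {j, p}" by (intro card_mono) auto
    also have "\<dots> \<le> 2" by (simp add: card_insert_if)
    finally show False using S by simp
  qed
  then obtain i where i: "i \<in> ?B" "i \<noteq> j" "i \<noteq> p" by blast
  then have iL: "i < n - 1" "w \<in> c i" by (auto simp: BC_def)
  have "sc i \<noteq> j" using sc_inj[OF iL(1) jL(2)] i j by auto
  moreover have "u j \<in> c i" using Bj i by (auto simp: BC_def)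
  ultimately have "{w, u j, u i, u (sc i)} \<subseteq> c i" "card {w, u j, u i, u (sc i)} = 4"
    using iL H(5)[OF iL(1)] H(6)[OF iL(1)] H(9)[OF jL(1)] H(9)[OF iL(1)] H(9)[OF sc_lt[of i]]
      H(10)[OF jL(1) iL(1)] H(10)[OF jL(1) sc_lt[of i]] H(10)[OF iL(1) sc_lt[of i]] sc_neq(1)[OF iL(1)] i
    by auto
  moreover have "card (c i) = 3" "finite (c i)" using Er H(7)[OF iL(1)] finite_edge S by auto
  ultimately have "(4::nat) \<le> 3" by (metis card_mono)
  then show False by simp
qed

end

section \<open>Rotations of both kinds and the full rotation sets of the two ends\<close>

context unif
begin

definition rotation :: "nat \<Rightarrow> 'a set \<Rightarrow> (nat \<Rightarrow> 'a) \<Rightarrow> (nat \<Rightarrow> 'a set) \<Rightarrow> bool" where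
  "rotation i f v e \<longleftrightarrow> 1 \<le> i \<and> i < n \<and> f \<in> insert (e i) (free_edges e) \<and> v 1 \<in> f \<and> v (Suc i) \<in> f"

text \<open>\<open>i\<close> in \<open>XI\<close> means that a rotation makes v_i the first vertex;
  \<open>i\<close> in \<open>YK\<close> means that one makes v_(i+1) the last.\<close>

definition XI :: "(nat \<Rightarrow> 'a) \<Rightarrow> (nat \<Rightarrow> 'a set) \<Rightarrow> nat set" where "XI v e = NI v e \<union> BI v e"
definition YK :: "(nat \<Rightarrow> 'a) \<Rightarrow> (nat \<Rightarrow> 'a set) \<Rightarrow> nat set" where "YK v e = NK v e \<union> BK v e"

lemma XY_sub: "XI v e \<subseteq> {1..<n}" "YK v e \<subseteq> {1..<n}" "finite (XI v e)" "finite (YK v e)"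
  using idx_sub[of v e] by (auto simp: XI_def YK_def)

lemma XY_rev:
  assumes "ham_path v e"
  shows "XI (revv v) (reve e) = (\<lambda>i. n - i) ` YK v e" "YK (revv v) (reve e) = (\<lambda>i. n - i) ` XI v e"
  using NI_rev[OF assms] by (auto simp: XI_def YK_def image_Un)

lemma rev_mem:
  assumes "ham_path v e" "1 \<le> i" "i < n"
  shows "n - i \<in> NI (revv v) (reve e) \<longleftrightarrow> i \<in> NK v e" "n - i \<in> NK (revv v) (reve e) \<longleftrightarrow> i \<in> NI v e"
    "n - i \<in> BI (revv v) (reve e) \<longleftrightarrow> i \<in> BK v e" "n - i \<in> BK (revv v) (reve e) \<longleftrightarrow> i \<in> BI v e"
    "n - i \<in> XI (revv v) (reve e) \<longleftrightarrow> i \<in> YK v e" "n - i \<in> YK (revv v) (reve e) \<longleftrightarrow> i \<in> XI v e"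
proof -
  have *: "n - i \<in> (\<lambda>i. n - i) ` A \<longleftrightarrow> i \<in> A" if "A \<subseteq> {1..<n}" for A
  proof
    assume "n - i \<in> (\<lambda>i. n - i) ` A"
    then obtain j where j: "j \<in> A" "n - i = n - j" by blast
    then have "j < n" using that by auto
    then have "i = j" using j assms by simp
    then show "i \<in> A" using j by simp
  qed blast
  show "n - i \<in> NI (revv v) (reve e) \<longleftrightarrow> i \<in> NK v e" "n - i \<in> NK (revv v) (reve e) \<longleftrightarrow> i \<in> NI v e"
    "n - i \<in> BI (revv v) (reve e) \<longleftrightarrow> i \<in> BK v e" "n - i \<in> BK (revv v) (reve e) \<longleftrightarrow> i \<in> BI v e"
    unfolding NI_rev[OF assms(1)] by (rule *, rule idx_sub)+
  show "n - i \<in> XI (revv v) (reve e) \<longleftrightarrow> i \<in> YK v e" "n - i \<in> YK (revv v) (reve e) \<longleftrightarrow> i \<in> XI v e"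
    unfolding XY_rev[OF assms(1)] by (rule *, rule XY_sub)+
qed

lemma XI_stp:
  assumes h: "ham_path v e"
  shows "i \<in> XI v e \<longleftrightarrow> (\<exists>f. rotation i f v e)"
  using hpD(5)[OF h, of i] by (auto simp: XI_def NI_def BI_def rotation_def)

lemma stp_NI: "i \<in> NI v e \<Longrightarrow> \<exists>f\<in>free_edges e. rotation i f v e" by (auto simp: NI_def rotation_def)

lemma stp_BI: "ham_path v e \<Longrightarrow> i \<in> BI v e \<Longrightarrow> rotation i (e i) v e"
  using hpD(5)[of v e i] by (auto simp: BI_def rotation_def)

lemma rotationD:
  assumes h: "ham_path v e" and s: "rotation i f v e"
  shows "ham_path (rotv i v) (rote i f e)" "free_edges (rote i f e) = insert (e i) (free_edges e) - {f}"
proof -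
  have i: "1 \<le> i" "i < n" and v: "v 1 \<in> f" "v (Suc i) \<in> f" and f: "f = e i \<or> f \<in> free_edges e"
    using s by (auto simp: rotation_def)
  have 1: "f \<in> E" using f Fr_sub hpD(6)[OF h i] by blast
  have 2: "f \<notin> e ` ({1..<n} - {i})" using f hpD(2)[OF h] i by (auto simp: free_edges_def inj_on_def)
  show "ham_path (rotv i v) (rote i f e)" "free_edges (rote i f e) = insert (e i) (free_edges e) - {f}"
    by (fact hp_rot[OF h i 1 2 v])+
qed

lemma rot_simps:
  "1 \<le> i \<Longrightarrow> rotv i v 1 = v i" "l > i \<Longrightarrow> rotv i v l = v l" "l \<le> i \<Longrightarrow> rotv i v l = v (i + 1 - l)"
  "l > i \<Longrightarrow> rote i f e l = e l" "rote i f e i = f" "l < i \<Longrightarrow> rote i f e l = e (i - l)"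
  by (auto simp: rotv_def rote_def)

end

context nonham
begin

text \<open>A rotation at the start runs along an edge at v_1, which is never a free edge at v_n.
  Hence the free neighbourhood of the end survives all such rotations.\<close>

lemma stp_keep:
  assumes h: "ham_path v e" and s: "rotation i f v e" and g: "g \<in> free_edges e" "v n \<in> g"
  shows "g \<in> free_edges (rote i f e)"
proof -
  have "g \<noteq> f"
  proof
    assume gf: "g = f"
    have "v 1 \<in> f" using s by (simp add: rotation_def)
    then show False using no_closing_edge[OF h g(1)] gf g(2) by simp
  qed
  then show ?thesis using rotationD(2)[OF h s] g(1) by simp
qed

lemma stp_end: "rotation i f v e \<Longrightarrow> rotv i v n = v n" by (simp add: rotation_def rotv_def)

lemma stp_NK_gt:
  assumes h: "ham_path v e" and s: "rotation i f v e" and l: "l \<in> NK v e" "i < l"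
  shows "l \<in> NK (rotv i v) (rote i f e)"
proof -
  obtain g where g: "g \<in> free_edges e" "v n \<in> g" "v l \<in> g" "1 \<le> l" "l < n" using l by (auto simp: NK_def)
  show ?thesis using stp_keep[OF h s g(1,2)] g stp_end[OF s] l(2) by (auto simp: NK_def rot_simps)
qed

lemma stp_NK_le:
  assumes h: "ham_path v e" and s: "rotation i f v e" and l: "l \<in> NK v e" "l \<le> i"
  shows "i + 1 - l \<in> NK (rotv i v) (rote i f e)"
proof -
  obtain g where g: "g \<in> free_edges e" "v n \<in> g" "v l \<in> g" "1 \<le> l" "l < n" using l by (auto simp: NK_def)
  have i: "i < n" using s by (simp add: rotation_def)
  have "i + 1 - l \<le> i" "i + 1 - (i + 1 - l) = l" using l g(4) by auto
  then have "rotv i v (i + 1 - l) = v l" by (simp add: rotv_def)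
  then show ?thesis using stp_keep[OF h s g(1,2)] g stp_end[OF s] l(2) i by (auto simp: NK_def)
qed

lemma stp_YK_gt:
  assumes h: "ham_path v e" and s: "rotation i f v e" and l: "l \<in> YK v e" "i < l"
  shows "l \<in> YK (rotv i v) (rote i f e)"
  using l(1) stp_NK_gt[OF h s _ l(2)] stp_end[OF s] l(2) by (auto simp: YK_def BK_def rot_simps)

lemma stp_card_NK:
  assumes h: "ham_path v e" and s: "rotation i f v e"
  shows "card (NK v e) \<le> card (NK (rotv i v) (rote i f e))"
proof -
  let ?p = "\<lambda>l. if l \<le> i then i + 1 - l else l"
  have "inj_on ?p {1..}" by (auto simp: inj_on_def)
  then have "inj_on ?p (NK v e)" by (rule inj_on_subset) (auto simp: NK_def)
  moreover have "?p ` NK v e \<subseteq> NK (rotv i v) (rote i f e)"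
    using stp_NK_gt[OF h s] stp_NK_le[OF h s] by auto
  ultimately show ?thesis by (meson card_inj_on_le idx_fin(3))
qed

end

section \<open>Consequences of the absence of near-cycles\<close>

context dirac
begin

text \<open>Such an edge closes v_2, ..., v_n to a cycle that misses v_1; \<open>e 1\<close> is
  available because v_1 is left out.\<close>

lemma no_second_closing_edge:
  assumes h: "ham_path v e" and f: "f \<in> insert (e 1) (free_edges e)" "v 2 \<in> f" "v n \<in> f"
  shows False
proof -
  note H = hpD[OF h]
  let ?u = "\<lambda>i. v (i + 2)" and ?c = "\<lambda>i. if i = n - 2 then f else e (i + 2)"
  have "near_cycle (v 1) ?u ?c" unfolding near_cycle_def
  proof (intro conjI)
    show "v 1 \<in> V" using H(7)[of 1] n4 by simp
    have "bij_betw (\<lambda>i. i + 2) {..<n - 1} {2..n}"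
      by (rule bij_betw_byWitness[where f' = "\<lambda>i. i - 2"]) auto
    moreover have "bij_betw v {2..n} (V - {v 1})"
    proof -
      have i: "inj_on v {1..n}" and im: "v ` {1..n} = V" using H(1) by (auto simp: bij_betw_def)
      have e: "{2..n} = {1..n} - {1}" by auto
      have "v ` {2..n} = V - {v 1}" unfolding e im[symmetric]
        using i n4 by (subst inj_on_image_set_diff[OF i]) auto
      moreover have "inj_on v {2..n}" by (rule inj_on_subset[OF i]) auto
      ultimately show ?thesis by (simp add: bij_betw_def)
    qed
    ultimately show "bij_betw ?u {..<n - 1} (V - {v 1})" using bij_betw_trans by (fastforce simp: comp_def)
    have fe: "f \<noteq> e j" if "2 \<le> j" "j < n" for j
      using f(1) path_edge_not_free[of j e] H(9)[of 1 j] that n4 by auto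
    show "inj_on ?c {..<n - 1}"
    proof (rule inj_onI)
      fix x y assume xy: "x \<in> {..<n - 1}" "y \<in> {..<n - 1}" "?c x = ?c y"
      consider "x = n - 2" "y = n - 2" | "x = n - 2" "y < n - 2" | "x < n - 2" "y = n - 2"
        | "x < n - 2" "y < n - 2" using xy by fastforce
      then show "x = y"
      proof cases
        case 2
        then have "y + 2 < n" "f = e (y + 2)" using xy by auto
        then show ?thesis using fe[of "y + 2"] by simp
      next
        case 3
        then have "x + 2 < n" "f = e (x + 2)" using xy by auto
        then show ?thesis using fe[of "x + 2"] by simp
      next
        case 4
        then have "x + 2 < n" "y + 2 < n" "e (x + 2) = e (y + 2)" using xy by auto
        then show ?thesis using H(9)[of "x + 2" "y + 2"] by simp
      qed simp
    qed
    have "f \<in> E" using f(1) Fr_sub H(6)[of 1] n4 by auto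
    then show "?c ` {..<n - 1} \<subseteq> E" using H(6) by auto
    show "\<forall>i<n - 1. ?u i \<in> ?c i \<and> ?u (sc i) \<in> ?c i"
    proof (intro allI impI)
      fix i assume i: "i < n - 1"
      show "?u i \<in> ?c i \<and> ?u (sc i) \<in> ?c i"
      proof (cases "i = n - 2")
        case True
        then have "sc i = 0" using sc_simps(2)[of i] n4 by auto
        moreover have "n - 2 + 2 = n" using n4 by simp
        ultimately show ?thesis using True f by (simp add: numeral_2_eq_2)
      next
        case False
        then have "sc i = Suc i" using sc_simps(1)[of i] i by auto
        then show ?thesis using H(4)[of "i + 2"] H(5)[of "i + 2"] i False by auto
      qed
    qed
  qed
  then show False using no_near_cycle by blast
qed

text \<open>Rotating at i puts v_(i-1) in second place with e_(i-1) as the first edge. An edge from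
  there to v_n would close a near-cycle.\<close>

lemma XI_shift_YK:
  assumes h: "ham_path v e" and i: "i \<in> XI v e" "2 \<le> i"
  shows "i - 1 \<notin> YK v e"
proof
  assume y: "i - 1 \<in> YK v e"
  obtain f where s: "rotation i f v e" using XI_stp[OF h] i by blast
  note R = rotationD[OF h s]
  have i': "i < n" using s by (simp add: rotation_def)
  have 2: "rotv i v 2 = v (i - 1)" "rote i f e 1 = e (i - 1)" using i by (auto simp: rotv_def rote_def intro!: arg_cong[of _ _ v])
  note E' = stp_end[OF s]
  from y show False unfolding YK_def
  proof
    assume "i - 1 \<in> NK v e"
    then obtain g where g: "g \<in> free_edges e" "v n \<in> g" "v (i - 1) \<in> g" by (auto simp: NK_def)
    show False using no_second_closing_edge[OF R(1), of g] stp_keep[OF h s g(1,2)] g 2 E' by simp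
  next
    assume "i - 1 \<in> BK v e"
    then have "v n \<in> e (i - 1)" by (simp add: BK_def)
    then show False using no_second_closing_edge[OF R(1), of "e (i - 1)"] 2 E' hpD(4)[OF h, of "i - 1"] i i' by simp
  qed
qed

lemma NI_YK: "ham_path v e \<Longrightarrow> i \<in> NI v e \<Longrightarrow> i \<notin> YK v e"
  using XK_disjoint NI_BK_disjoint by (auto simp: YK_def)
lemma XI_NK: "ham_path v e \<Longrightarrow> i \<in> XI v e \<Longrightarrow> i \<notin> NK v e"
  using XK_disjoint by (auto simp: XI_def)
lemma NI_XI: "NI v e \<subseteq> XI v e" "BI v e \<subseteq> XI v e" "NK v e \<subseteq> YK v e" "BK v e \<subseteq> YK v e"
  by (auto simp: XI_def YK_def)

text \<open>At most t - 1 free neighbours span at most C(t-1, r-1) free edges; by Pascal the rest of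
  the degree falls on path edges.\<close>

lemma few_free_BI:
  assumes h: "ham_path v e" and c: "card (NI v e) \<le> t - 1"
  shows "1 + (t - 1 choose (r - 2)) \<le> card (BI v e)"
proof -
  have "card {f \<in> free_edges e. v 1 \<in> f} \<le> card (NI v e) choose (r - 1)" by (rule card_free_start[OF h])
  also have "\<dots> \<le> t - 1 choose (r - 1)" by (rule binomial_right_mono[OF c])
  finally have 1: "card {f \<in> free_edges e. v 1 \<in> f} \<le> t - 1 choose (r - 1)" .
  have "t = Suc (t - 1)" "r - 1 = Suc (r - 2)" using t3 r3 by auto
  then have "t choose (r - 1) = (t - 1 choose (r - 2)) + (t - 1 choose (r - 1))"
    by (metis binomial_Suc_Suc)
  then show ?thesis using 1 hdegree_start_eq[OF h] deg[of "v 1"] hpD(7)[OF h, of 1] n4 by simp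
qed

lemma choose_pred_ge: "t - 1 \<le> t - 1 choose (r - 2)" "4 \<le> r \<Longrightarrow> r < t \<Longrightarrow> t + 1 \<le> t - 1 choose (r - 2)"
proof -
  show "t - 1 \<le> t - 1 choose (r - 2)" using r3 rt by (intro choose_ge) auto
  assume r: "4 \<le> r" "r < t"
  have "(t - 1) * (t - 1 - 1) \<le> 2 * (t - 1 choose (r - 2))" using r by (intro choose_ge_two) auto
  moreover have "2 * (t + 1) \<le> (t - 1) * (t - 1 - 1)"
  proof -
    obtain s where "t = s + 5" using r le_Suc_ex[of 5 t] by (auto simp: add.commute)
    then show ?thesis by (simp add: algebra_simps)
  qed
  ultimately have "2 * (t + 1) \<le> 2 * (t - 1 choose (r - 2))" by (rule order_trans[rotated])
  then show "t + 1 \<le> t - 1 choose (r - 2)" by simp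
qed

lemma few_free_BI_t: "ham_path v e \<Longrightarrow> card (NI v e) \<le> t - 1 \<Longrightarrow> t \<le> card (BI v e)"
  using few_free_BI[of v e] choose_pred_ge(1) t3 by linarith

lemma card_XI: "ham_path v e \<Longrightarrow> t \<le> card (XI v e)"
proof (cases "card (NI v e) \<le> t - 1")
  case True
  assume "ham_path v e"
  then show ?thesis using few_free_BI_t True card_mono[OF XY_sub(3) NI_XI(2)] le_trans by blast
next
  case False
  then show ?thesis using card_mono[OF XY_sub(3) NI_XI(1), of v e] by linarith
qed

lemma card_YK: "ham_path v e \<Longrightarrow> t \<le> card (YK v e)"
  using card_XI[OF hp_rev(1)] XY_rev(1) card_flip[OF XY_sub(2)] by metis

end

section \<open>Paths whose ends have many free neighbours\<close>

lemma down_closed_interval: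
  assumes "finite S" "\<And>i. i \<in> S \<Longrightarrow> (lo::nat) \<le> i" "\<And>i. i \<in> S \<Longrightarrow> lo < i \<Longrightarrow> i - 1 \<in> S"
  shows "S = {lo..<lo + card S}"
proof (cases "S = {}")
  case False
  define M where "M = Max S"
  have M: "M \<in> S" "\<And>i. i \<in> S \<Longrightarrow> i \<le> M" using False assms(1) by (auto simp: M_def)
  have "M - d \<in> S" if "d \<le> M - lo" for d using that
  proof (induction d)
    case (Suc d)
    then have "M - d - 1 \<in> S" using assms(3)[of "M - d"] by auto
    moreover have "M - d - 1 = M - Suc d" by arith
    ultimately show ?case by (simp only:)
  qed (use M in simp)
  then have "i \<in> S" if "lo \<le> i" "i \<le> M" for i using that by (metis diff_diff_cancel diff_le_mono2)
  then have "{lo..M} \<subseteq> S" by (simp add: subset_iff)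
  moreover have "S \<subseteq> {lo..M}" using M(2) assms(2) by (simp add: subset_iff)
  ultimately have e: "S = {lo..M}" by (rule subset_antisym[rotated])
  then have "card S = Suc M - lo" by simp
  moreover have "lo \<le> M" using M(1) assms(2) by blast
  ultimately have "lo + card S = Suc M" by simp
  then show ?thesis using e by (simp add: atLeastLessThanSuc_atLeastAtMost)
qed simp

text \<open>The indices form a word of length 2t + 1 with at least t letters A and t letters B, so
  at most one blank \<open>z\<close>. As no A directly follows a B, each stretch without a blank
  reads A...AB...B; \<open>k\<close> is the last A before the blank and \<open>s\<close> the first
  index after the A's that follow it.\<close>

lemma two_letter_word:
  fixes A B :: "nat set"
  assumes AB: "A \<subseteq> {1..<n}" "B \<subseteq> {1..<n}" "A \<inter> B = {}" "\<And>i. i \<in> A \<Longrightarrow> 2 \<le> i \<Longrightarrow> i - 1 \<notin> B"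
    and c: "n = 2 * t + 2" "t \<le> card A" "t \<le> card B"
  obtains (full) a where "a = t \<or> a = t + 1" "A = {1..<Suc a}" "B = {Suc a..<n}"
  | (gap) k z s where "k < z" "z < s" "s \<le> n" "A = {1..<Suc k} \<union> {Suc z..<s}" "B = {Suc k..<z} \<union> {s..<n}"
    "k + (s - Suc z) = t"
proof -
  have fin: "finite A" "finite B" using AB finite_subset by blast+
  have cU: "card (A \<union> B) = card A + card B" by (rule card_Un_disjoint[OF fin AB(3)])
  have le: "card (A \<union> B) \<le> 2 * t + 1" using card_mono[of "{1..<n}" "A \<union> B"] AB c by simp
  show thesis
  proof (cases "A \<union> B = {1..<n}")
    case True
    have "A = {1..<1 + card A}"
    proof (rule down_closed_interval[OF fin(1)])
      fix i assume i: "i \<in> A" "1 < i"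
      then have "i - 1 \<in> A \<union> B" unfolding True using AB(1) by auto
      then show "i - 1 \<in> A" using AB(4)[of i] i by auto
    qed (use AB in auto)
    then have A: "A = {1..<Suc (card A)}" unfolding Suc_eq_plus1_left .
    have B: "B = {Suc (card A)..<n}"
    proof -
      have "B = {1..<n} - A" using True AB(3) by blast
      also have "\<dots> = {Suc (card A)..<n}" by (subst A) auto
      finally show ?thesis .
    qed
    have "card A = t \<or> card A = t + 1" using le cU c by linarith
    then show thesis using full[OF _ A B] by blast
  next
    case False
    then obtain z where z: "z \<in> {1..<n}" "z \<notin> A" "z \<notin> B" using AB by blast
    have "A \<union> B \<subseteq> {1..<n} - {z}" using AB z by auto
    moreover have "card ({1..<n} - {z}) = 2 * t" using z c by simp
    ultimately have "card (A \<union> B) \<le> 2 * t" by (metis card_mono finite_Diff finite_atLeastLessThan)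
    then have cAB: "card A = t" "card B = t" using cU c by auto
    then have U: "A \<union> B = {1..<n} - {z}" using \<open>A \<union> B \<subseteq> _\<close> cU \<open>card ({1..<n} - {z}) = 2 * t\<close>
      by (intro card_subset_eq) auto
    define A1 A2 where "A1 = A \<inter> {1..<z}" and "A2 = A \<inter> {Suc z..<n}"
    have f12: "finite A1" "finite A2" using fin by (auto simp: A1_def A2_def)
    have A1: "A1 = {1..<1 + card A1}"
    proof (rule down_closed_interval[OF f12(1)])
      fix i assume i: "i \<in> A1" "1 < i"
      then have "i - 1 \<in> A \<union> B" unfolding U A1_def using AB(1) by auto
      then show "i - 1 \<in> A1" using AB(4)[of i] i by (auto simp: A1_def)
    qed (auto simp: A1_def)
    have A2: "A2 = {Suc z..<Suc z + card A2}"
    proof (rule down_closed_interval[OF f12(2)])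
      fix i assume i: "i \<in> A2" "Suc z < i"
      then have "i - 1 \<in> A \<union> B" unfolding U A2_def using AB(1) z by auto
      then show "i - 1 \<in> A2" using AB(4)[of i] i by (auto simp: A2_def)
    qed (auto simp: A2_def)
    have AA: "A = A1 \<union> A2"
    proof -
      have "i < z \<or> Suc z \<le> i" if "i \<in> A" for i using that z(2) by (cases "i = z") auto
      then show ?thesis using AB(1) unfolding A1_def A2_def by fastforce
    qed
    define k s where "k = card A1" and "s = Suc z + card A2"
    have A1': "A1 = {1..<Suc k}" using A1 unfolding k_def Suc_eq_plus1_left .
    have A2': "A2 = {Suc z..<s}" using A2 unfolding s_def .
    have kz: "k < z"
    proof -
      have "card A1 \<le> card {1..<z}" by (rule card_mono) (auto simp: A1_def)
      then show ?thesis using z by (auto simp: k_def)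
    qed
    have sn: "s \<le> n"
    proof -
      have "card A2 \<le> card {Suc z..<n}" by (rule card_mono) (auto simp: A2_def)
      then show ?thesis using z by (auto simp: s_def)
    qed
    have A: "A = {1..<Suc k} \<union> {Suc z..<s}" using AA A1' A2' by simp
    have B: "B = {Suc k..<z} \<union> {s..<n}"
    proof -
      have "B = ({1..<n} - {z}) - A" using U AB(3) by blast
      also have "\<dots> = {Suc k..<z} \<union> {s..<n}" unfolding A using kz z by (auto simp: s_def)
      finally show ?thesis .
    qed
    have "card A = k + card A2" unfolding AA k_def by (rule card_Un_disjoint[OF f12]) (auto simp: A1_def A2_def)
    then have "k + (s - Suc z) = t" using cAB by (simp add: s_def)
    then show thesis using gap[OF kz _ sn A B] by (simp add: s_def)
  qed
qed

context dirac
begin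

lemma choose_pascal: "t choose (r - 1) = (t - 1 choose (r - 2)) + (t - 1 choose (r - 1))"
proof -
  have "t = Suc (t - 1)" "r - 1 = Suc (r - 2)" using t3 r3 by auto
  then show ?thesis by (metis binomial_Suc_Suc)
qed

lemma rot_NI:
  assumes h: "ham_path v e" and s: "rotation i f v e" and k: "k \<in> insert (e i) (free_edges e)" "k \<noteq> f" "v i \<in> k"
    and l: "i < l" "l < n" "v (Suc l) \<in> k"
  shows "l \<in> NI (rotv i v) (rote i f e)"
proof -
  have "k \<in> free_edges (rote i f e)" using rotationD(2)[OF h s] k by simp
  moreover have "rotv i v 1 = v i" "rotv i v (Suc l) = v (Suc l)" using s l by (auto simp: rotation_def rotv_def)
  ultimately show ?thesis using k l by (auto simp: NI_def)
qed

text \<open>The new start v_i gains the vertices of \<open>k\<close> as free neighbours, while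
  indices of \<open>YK\<close> beyond i are untouched. So the disjointness results for the rotated
  path restrict edges of the original one.\<close>

lemma rot_avoid:
  assumes h: "ham_path v e" and s: "rotation i f v e" and k: "k \<in> insert (e i) (free_edges e)" "k \<noteq> f" "v i \<in> k"
    and l: "i < l" "l < n" "v (Suc l) \<in> k"
  shows "l \<notin> YK v e" "i < l - 1 \<Longrightarrow> l - 1 \<notin> YK v e"
proof -
  note R = rotationD(1)[OF h s]
  have N: "l \<in> NI (rotv i v) (rote i f e)" by (rule rot_NI[OF h s k l])
  show "l \<notin> YK v e" using NI_YK[OF R N] stp_YK_gt[OF h s _ l(1)] by blast
  assume "i < l - 1"
  then show "l - 1 \<notin> YK v e" using XI_shift_YK[OF R, of l] N stp_YK_gt[OF h s, of "l - 1"] by (auto simp: XI_def)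
qed

text \<open>Rotating at $i$ frees $e_i$, so each $e_i$ through $v_1$ leads to free neighbours only; thus all edges
at $v_1$ live on the $t$ free neighbours.\<close>

lemma start_star_false:
  assumes h: "ham_path v e" and c: "card (NI v e) = t"
    and full: "\<And>l. 1 \<le> l \<Longrightarrow> l < n \<Longrightarrow> l \<notin> NK v e \<Longrightarrow> l - 1 \<notin> NK v e \<Longrightarrow> l \<in> NI v e"
    and B: "\<And>i. i \<in> BI v e \<Longrightarrow> {1..i} \<subseteq> NI v e"
  shows False
proof -
  have "card {f \<in> E. v 1 \<in> f} \<le> card ((\<lambda>i. v (Suc i)) ` NI v e) choose (r - 1)"
  proof (rule card_star_le[where x = "v 1"])
    fix f assume f: "f \<in> {f \<in> E. v 1 \<in> f}"
    have "y \<in> (\<lambda>i. v (Suc i)) ` NI v e" if y: "y \<in> f" "y \<noteq> v 1" for y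
    proof -
      obtain j where j: "1 \<le> j" "j \<le> n" "y = v j" using hp_idx[OF h, of y] EV f y by blast
      define l where "l = j - 1"
      have "j \<noteq> 1" using j y by auto
      then have l: "1 \<le> l" "l < n" "y = v (Suc l)" using j by (auto simp: l_def)
      have "l \<in> NI v e"
      proof (cases "f \<in> free_edges e")
        case True then show ?thesis using l y f by (auto simp: NI_def)
      next
        case False
        then obtain i where i: "1 \<le> i" "i < n" "f = e i" using f by (auto simp: free_edges_def)
        then have iB: "i \<in> BI v e" using f by (simp add: BI_def)
        show ?thesis
        proof (cases "l \<le> i")
          case True then show ?thesis using B[OF iB] l by auto
        next
          case nl: False
          have iN: "i \<in> NI v e" using B[OF iB] i by auto
          then obtain g where g: "g \<in> free_edges e" "rotation i g v e" using stp_NI by blast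
          have ge: "e i \<noteq> g" using path_edge_not_free[OF i(1,2)] g by auto
          have il: "i < l" using nl by simp
          note RA = rot_avoid[OF h g(2) _ ge _ il l(2)]
          have vv: "v i \<in> e i" "v (Suc l) \<in> e i" using hpD(4)[OF h i(1,2)] y l i by auto
          have "l \<notin> NK v e" using RA(1) vv NI_XI(3) by blast
          moreover have "l - 1 \<notin> NK v e"
          proof (cases "l - 1 = i")
            case True then show ?thesis using NI_YK[OF h iN] NI_XI(3) by blast
          next
            case False then show ?thesis using RA(2) vv NI_XI(3) il by fastforce
          qed
          ultimately show ?thesis using full l by blast
        qed
      qed
      then show ?thesis using l by blast
    qed
    then show "f \<in> E \<and> v 1 \<in> f \<and> f - {v 1} \<subseteq> (\<lambda>i. v (Suc i)) ` NI v e" using f by blast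
  qed simp
  moreover have "card ((\<lambda>i. v (Suc i)) ` NI v e) \<le> t" using c card_image_le[OF idx_fin(1)] by metis
  then have "card ((\<lambda>i. v (Suc i)) ` NI v e) choose (r - 1) \<le> t choose (r - 1)"
    by (rule binomial_right_mono)
  ultimately have "hdegree E (v 1) \<le> t choose (r - 1)" unfolding hdegree_def by linarith
  then show False using deg[of "v 1"] hpD(7)[OF h, of 1] n4 by simp
qed

lemma end_star_false:
  assumes h: "ham_path v e" and c: "card (NK v e) = t"
    and full: "\<And>l. 1 \<le> l \<Longrightarrow> l < n \<Longrightarrow> l \<notin> NI v e \<Longrightarrow> l + 1 \<notin> NI v e \<Longrightarrow> l \<in> NK v e"
    and B: "\<And>i. i \<in> BK v e \<Longrightarrow> {i..<n} \<subseteq> NK v e"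
  shows False
proof (rule start_star_false[OF hp_rev(1)[OF h]])
  show "card (NI (revv v) (reve e)) = t" using card_rev(1)[OF h] c by simp
  note M = rev_mem[OF h]
  fix l assume l: "1 \<le> l" "l < n"
  { assume a: "l \<notin> NK (revv v) (reve e)" "l - 1 \<notin> NK (revv v) (reve e)"
    define j where "j = n - l"
    have j: "1 \<le> j" "j < n" "l = n - j" using l by (auto simp: j_def)
    have "j \<notin> NI v e" using M(2)[OF j(1,2)] a(1) j by simp
    moreover have "j + 1 \<notin> NI v e"
    proof
      assume J: "j + 1 \<in> NI v e"
      then have "j + 1 < n" by (auto simp: NI_def)
      moreover have "n - (j + 1) = l - 1" using j by simp
      ultimately show False using M(2)[of "j + 1"] J a(2) by simp
    qed
    ultimately show "l \<in> NI (revv v) (reve e)" using full[of j] M(1)[OF j(1,2)] j by simp }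
next
  note M = rev_mem[OF h]
  fix i assume i: "i \<in> BI (revv v) (reve e)"
  define j where "j = n - i"
  have j: "1 \<le> j" "j < n" "i = n - j" using i by (auto simp: j_def BI_def)
  have jB: "j \<in> BK v e" using M(3)[OF j(1,2)] i j by simp
  show "{1..i} \<subseteq> NI (revv v) (reve e)"
  proof
    fix x assume x: "x \<in> {1..i}"
    then have "n - x \<in> NK v e" "1 \<le> n - x" "n - x < n" "n - (n - x) = x" using B[OF jB] j by auto
    then show "x \<in> NI (revv v) (reve e)" using M(1)[of "n - x"] by simp
  qed
qed

text \<open>The vertex v_m just after the blank, m = z + 1, has too small a degree. Rotations
  confine its free neighbours to positions z - 1, z, m + 1, ..., s and its path edges to indices z -
  1, z, m, ..., s - 1. Both sets have a = t - k + 2 elements. For k >= 3 this is at most t - 1, and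
  C(t-1, r-1) + (t - 1) does not exceed C(t, r-1).\<close>

lemma inner_vertex_false:
  assumes h: "ham_path v e" and o: "k < z" "z < s" "s \<le> n" "k + (s - Suc z) = t"
    and A: "NI v e = {1..<Suc k} \<union> {Suc z..<s}" and B: "NK v e = {Suc k..<z} \<union> {s..<n}"
    and q: "Suc k < z" and y: "Suc z < s" and k3: "3 \<le> k"
  shows False
proof -
  note H = hpD[OF h]
  define m where "m = Suc z"
  have mN: "m \<in> NI v e" and zN: "z \<notin> NI v e" and m: "1 \<le> m" "m < s" "m < n" using A o y by (auto simp: m_def)
  obtain f where f: "f \<in> free_edges e" "rotation m f v e" using stp_NI[OF mN] by blast
  note R = rotationD(1)[OF h f(2)]
  let ?v = "rotv m v" and ?e = "rote m f e"
  have zf: "v m \<notin> g" if "g \<in> free_edges e" "v 1 \<in> g" for g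
    using that zN o m by (auto simp: NI_def m_def)
  \<comment> \<open>Rotating at j would turn z into a free index of the new start v_j, although z -
    1 lies in \<open>NK\<close>.\<close>
  have low: "v m \<notin> g" if j: "1 \<le> j" "j \<le> k" and g: "g \<in> insert (e j) (free_edges e)" "v j \<in> g" for j g
  proof
    assume vm: "v m \<in> g"
    have "j \<in> NI v e" using A j by auto
    then obtain f' where f': "f' \<in> free_edges e" "rotation j f' v e" using stp_NI by blast
    then have "v 1 \<in> f'" by (simp add: rotation_def)
    then have "g \<noteq> f'" using zf[OF f'(1)] vm by auto
    then have "z - 1 \<notin> YK v e" using rot_avoid(2)[OF h f'(2) g(1) _ g(2), of z] vm j q o by (auto simp: m_def)
    moreover have "z - 1 \<in> NK v e" using B q by auto
    ultimately show False using NI_XI(3) by blast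
  qed
  have mid: "m - j \<in> NK ?v ?e" if "k < j" "j < z - 1" for j
  proof -
    have "j + 1 \<in> NK v e" using B that by auto
    moreover have "j + 1 \<le> m" "m + 1 - (j + 1) = m - j" using that by (auto simp: m_def)
    ultimately show ?thesis using stp_NK_le[OF h f(2), of "j + 1"] by simp
  qed
  have high: "j \<in> NK ?v ?e" if "s \<le> j" "j < n" for j
    using stp_NK_gt[OF h f(2)] B that m by auto
  let ?I = "{z - 1, z} \<union> {Suc m..s}"
  have free: "g - {v m} \<subseteq> v ` ?I" if g: "g \<in> free_edges e" "v m \<in> g" for g
  proof
    fix w assume w: "w \<in> g - {v m}"
    then obtain j where j: "1 \<le> j" "j \<le> n" "w = v j" using hp_idx[OF h, of w] EV[OF Fr_sub[OF g(1)]] by blast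
    have gf: "g \<noteq> f" using zf[of f] f g by (auto simp: rotation_def)
    have gF: "g \<in> free_edges ?e" using rotationD(2)[OF h f(2)] g gf by simp
    have jm: "j \<noteq> m" using w j by auto
    have 1: "\<not> j \<le> k" using low[of j g] j g w by auto
    have 2: "\<not> (k < j \<and> j < z - 1)"
    proof
      assume kj: "k < j \<and> j < z - 1"
      have "?v (Suc (m - j)) = v j" "1 \<le> m - j" "m - j < n" 
        using kj m j by (auto simp: rotv_def m_def)
      moreover note rot_simps(1)[OF m(1)]
      ultimately
have "m - j \<in> NI ?v ?e" using gF g w j by (auto simp: NI_def)
      then show False using NI_NK_disjoint[OF R] mid kj by blast
    qed
    have 3: "\<not> s < j"
    proof
      assume sj: "s < j"
      then have "Suc (j - 1) = j" by simp
      then have "j - 1 \<in> NI ?v ?e" using rot_NI[OF h f(2) _ gf g(2), of "j - 1"] g w j m sj by auto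
      moreover have "j - 1 \<in> NK ?v ?e" using high[of "j - 1"] sj j by auto
      ultimately show False using NI_NK_disjoint[OF R] by blast
    qed
    have "j \<in> ?I" using 1 2 3 jm by (auto simp: m_def)
    then show "w \<in> v ` ?I" using j by blast
  qed
  have path: "j \<in> {z - 1, z} \<union> {m..<s}" if j: "j \<in> {1..<n}" "v m \<in> e j" for j
  proof -
    have 1: "\<not> j \<le> k" using low[of j "e j"] j H(4)[of j] by auto
    have 2: "\<not> (k < j \<and> j < z - 1)"
    proof
      assume kj: "k < j \<and> j < z - 1"
      have "?e (m - j) = e j" "1 \<le> m - j" "m - j < n"
        using kj m j by (auto simp: rote_def m_def)
      then have "m - j \<in> XI ?v ?e" using j rot_simps(1)[OF m(1), of v] by (auto simp: XI_def BI_def)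
      then show False using XI_NK[OF R] mid kj by blast
    qed
    have 3: "\<not> s \<le> j"
    proof
      assume sj: "s \<le> j"
      then have "?e j = e j" using m by (auto simp: rote_def)
      then have "j \<in> XI ?v ?e" using j rot_simps(1)[OF m(1), of v] by (auto simp: XI_def BI_def)
      then show False using XI_NK[OF R] high sj j by auto
    qed
    show ?thesis using 1 2 3 by (auto simp: m_def)
  qed
  define a where "a = s - m + 2"
  have zz: "z - 1 \<noteq> z" "z - 1 < m" using q by (auto simp: m_def)
  have cI: "card ?I = a"
  proof -
    have "card ?I = card {z - 1, z} + card {Suc m..s}"
      by (rule card_Un_disjoint) (auto simp: m_def)
    then show ?thesis using zz m by (simp add: a_def)
  qed
  have "card {g \<in> free_edges e. v m \<in> g} \<le> card (v ` ?I) choose (r - 1)"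
    by (rule card_star_le[where x = "v m"]) (use free Fr_sub in auto)
  also have "card (v ` ?I) \<le> a" using card_image_le[of ?I v] cI by simp
  then have "card (v ` ?I) choose (r - 1) \<le> a choose (r - 1)" by (rule binomial_right_mono)
  finally have F1: "card {g \<in> free_edges e. v m \<in> g} \<le> a choose (r - 1)" .
  have "card {j \<in> {1..<n}. v m \<in> e j} \<le> card ({z - 1, z} \<union> {m..<s})"
  proof (rule card_mono)
    show "{j \<in> {1..<n}. v m \<in> e j} \<subseteq> {z - 1, z} \<union> {m..<s}" using path by blast
  qed simp
  also have "\<dots> \<le> a" using card_Un_le[of "{z - 1, z}" "{m..<s}"] zz m by (simp add: a_def)
  finally have F2: "card {j \<in> {1..<n}. v m \<in> e j} \<le> a" .
  have at: "a \<le> t - 1" using o(4) k3 by (simp add: a_def m_def)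
  have "a choose (r - 1) \<le> t - 1 choose (r - 1)" by (rule binomial_right_mono[OF at])
  then have "hdegree E (v m) \<le> t choose (r - 1)"
    using hdegree_split[OF h, of "v m"] F1 F2 choose_pascal choose_pred_ge(1) at by linarith
  then show False using deg[of "v m"] H(7)[of m] m by simp
qed

text \<open>In every other shape of the word, either all edges of one end live on its t free
  neighbours or the vertex behind the blank has too small a degree.\<close>

lemma good_path:
  assumes h: "ham_path v e" and n: "n = 2 * t + 2" and c: "t \<le> card (NI v e)" "t \<le> card (NK v e)"
  shows "NI v e = {1..<Suc t} \<and> NK v e = {Suc (Suc t)..<n}"
proof -
  have BA: "i - 1 \<notin> NK v e" if "i \<in> XI v e" "2 \<le> i" for i using XI_shift_YK[OF h that] NI_XI(3) by blast
  have AB: "NI v e \<inter> NK v e = {}" by (rule NI_NK_disjoint[OF h])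
  have BIX: "i \<notin> NK v e \<and> (2 \<le> i \<longrightarrow> i - 1 \<notin> NK v e) \<and> 1 \<le> i \<and> i < n" if "i \<in> BI v e" for i
    using BA[of i] XI_NK[OF h, of i] that by (auto simp: BI_def XI_def)
  have BKX: "i \<notin> NI v e \<and> i + 1 \<notin> NI v e \<and> 1 \<le> i \<and> i < n" if i: "i \<in> BK v e" for i
  proof -
    have "i + 1 \<notin> NI v e"
    proof
      assume "i + 1 \<in> NI v e"
      then have "i + 1 \<in> XI v e" by (simp add: XI_def)
      then show False using XI_shift_YK[OF h, of "i + 1"] i by (auto simp: YK_def BK_def)
    qed
    then show ?thesis using NI_BK_disjoint[OF h, of i] i by (auto simp: BK_def)
  qed
  have BA': "i - 1 \<notin> NK v e" if "i \<in> NI v e" "2 \<le> i" for i using BA that NI_XI(1) by blast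
  consider (1) a where "a = t \<or> a = t + 1" "NI v e = {1..<Suc a}" "NK v e = {Suc a..<n}"
    | (2) k z s where "k < z" "z < s" "s \<le> n" "NI v e = {1..<Suc k} \<union> {Suc z..<s}"
      "NK v e = {Suc k..<z} \<union> {s..<n}" "k + (s - Suc z) = t"
    by (rule two_letter_word[OF idx_sub(1)[of v e] idx_sub(3)[of v e] AB _ n c]) (use BA' in blast)+
  then show ?thesis
  proof cases
    case (1 a)
    show ?thesis
    proof (cases "a = t")
      case True
      show ?thesis
      proof (rule FalseE, rule start_star_false[OF h])
        show "card (NI v e) = t" using 1 True by simp
        show "l \<in> NI v e" if "1 \<le> l" "l < n" "l \<notin> NK v e" for l using that 1 by auto
        show "{1..i} \<subseteq> NI v e" if "i \<in> BI v e" for i using BIX[OF that] 1 by auto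
      qed
    next
      case False
      then have a: "a = t + 1" using 1 by simp
      show ?thesis
      proof (rule FalseE, rule end_star_false[OF h])
        show "card (NK v e) = t" using 1 a n by simp
        show "l \<in> NK v e" if "1 \<le> l" "l < n" "l \<notin> NI v e" for l using that 1 by auto
        show "{i..<n} \<subseteq> NK v e" if "i \<in> BK v e" for i using BKX[OF that] 1 by auto
      qed
    qed
  next
    case (2 k z s)
    note o = 2(1-3,6) and A = 2(4) and B = 2(5)
    have cA: "card (NI v e) = t"
    proof -
      have "card (NI v e) = card {1..<Suc k} + card {Suc z..<s}" unfolding A
        by (rule card_Un_disjoint) (use o in auto)
      then show ?thesis using o by simp
    qed
    have cB: "card (NK v e) = t"
    proof -
      have "card (NK v e) = card {Suc k..<z} + card {s..<n}" unfolding B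
        by (rule card_Un_disjoint) (use o in auto)
      then show ?thesis using o n by simp
    qed
    show ?thesis
    proof (cases "s = Suc z")
      case y0: True
      then have kt: "k = t" using o by simp
      show ?thesis
      proof (cases "z = Suc k")
        case True then show ?thesis using A B y0 kt by auto
      next
        case False
        then have q: "Suc k < z" using o by simp
        show ?thesis
        proof (rule FalseE, rule start_star_false[OF h cA])
          have *: "l \<in> NI v e" if "1 \<le> l" "l < n" "l \<notin> NK v e" "2 \<le> l \<Longrightarrow> l - 1 \<notin> NK v e" for l
          proof -
            have "l \<noteq> z" using that(4) B q by auto
            then show ?thesis using that A B y0 by auto
          qed
          show "l \<in> NI v e" if "1 \<le> l" "l < n" "l \<notin> NK v e" "l - 1 \<notin> NK v e" for l using * that by blast
          show "{1..i} \<subseteq> NI v e" if "i \<in> BI v e" for i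
          proof -
            have "i \<in> NI v e" using *[of i] BIX[OF that] by blast
            then have "i \<le> k" using A y0 by auto
            then show ?thesis unfolding A by auto
          qed
        qed
      qed
    next
      case False
      then have y: "Suc z < s" using o by simp
      show ?thesis
      proof (cases "z = Suc k")
        case True
        show ?thesis
        proof (rule FalseE, rule end_star_false[OF h cB])
          show *: "l \<in> NK v e" if "1 \<le> l" "l < n" "l \<notin> NI v e" "l + 1 \<notin> NI v e" for l
          proof -
            have "l \<noteq> z" using that(4) A y by auto
            then show ?thesis using that A B True by auto
          qed
          show "{i..<n} \<subseteq> NK v e" if "i \<in> BK v e" for i
          proof -
            have "i \<in> NK v e" using *[of i] BKX[OF that] by blast
            then have "s \<le> i" using B True by auto
            then show ?thesis unfolding B by auto
          qed
        qed
      next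
        case False
        then have q: "Suc k < z" using o by simp
        have *: "l \<in> NI v e" if "1 \<le> l" "l < n" "l \<notin> NK v e" "2 \<le> l \<Longrightarrow> l - 1 \<notin> NK v e" for l
        proof -
          have "l \<noteq> z" using that(4) B q by auto
          then show ?thesis using that A B by auto
        qed
        have "1 \<in> NI v e" using *[of 1] BIX[OF one_in_BI(1)[OF h]] n4 by auto
        then have k1: "1 \<le> k" using A q by auto
        show ?thesis
        proof (cases "3 \<le> k")
          case True then show ?thesis using inner_vertex_false[OF h o A B q y] by blast
        next
          case k2: False
          show ?thesis
          proof (rule FalseE, rule start_star_false[OF h cA])
            show "l \<in> NI v e" if "1 \<le> l" "l < n" "l \<notin> NK v e" "l - 1 \<notin> NK v e" for l using * that by blast
            show "{1..i} \<subseteq> NI v e" if i: "i \<in> BI v e" for i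
            proof -
              have iN: "i \<in> NI v e" using *[of i] BIX[OF i] by blast
              \<comment> \<open>Rotating at such an i along a free edge releases e_i, which joins
                the new start to v_1, now at position i; so i - 1 becomes a free index. The old
                index k + 1 of \<open>NK\<close> moves to i - k, and for k = 1 or k = 2 the two
                collide.\<close>
              have "\<not> z < i"
              proof
                assume zi: "z < i"
                have i': "1 \<le> i" "i < n" using BIX[OF i] by auto
                obtain f where f: "f \<in> free_edges e" "rotation i f v e" using stp_NI[OF iN] by blast
                note R = rotationD[OF h f(2)]
                let ?v = "rotv i v" and ?e = "rote i f e"
                have "e i \<noteq> f" using path_edge_not_free[OF i'] f by auto
                then have "e i \<in> free_edges ?e" using R(2) by blast
                moreover have "?v 1 = v i" "?v (Suc (i - 1)) = v 1" using rot_simps(1)[OF i'(1)] rot_simps(3)[of i i] i' by auto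
                ultimately have N: "i - 1 \<in> NI ?v ?e"
                  using i hpD(4)[OF h i'] zi q i' by (auto simp: NI_def BI_def)
                have "k + 1 \<in> NK v e" using B q by auto
                then have K: "i + 1 - (k + 1) \<in> NK ?v ?e" using stp_NK_le[OF h f(2), of "k + 1"] zi q by simp
                show False
                proof (cases "k = 1")
                  case True
                  then have "i + 1 - (k + 1) = i - 1" by arith
                  then have "i - 1 \<in> NK ?v ?e" using K by (simp only:)
                  then show False using N NI_NK_disjoint[OF R(1)] by blast
                next
                  case False
                  then have "i + 1 - (k + 1) = i - 1 - 1" "2 \<le> i - 1" using k1 k2 zi q by auto
                  then have "i - 1 - 1 \<in> YK ?v ?e" using K by (simp add: YK_def)
                  then show False using XI_shift_YK[OF R(1), of "i - 1"] N \<open>2 \<le> i - 1\<close> by (auto simp: XI_def)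
                qed
              qed
              then have "i \<le> k" using iN A by auto
              then show ?thesis unfolding A by auto
            qed
          qed
        qed
      qed
    qed
  qed
qed

section \<open>Path edges that cross from one half to the other\<close>

lemma BI_le:
  assumes h: "ham_path v e" and Y: "{Suc (Suc t)..<n} \<subseteq> YK v e" and C: "Suc t \<in> YK v e \<or> Suc (Suc t) \<in> NK v e"
  shows "BI v e \<subseteq> {1..Suc t}"
proof
  fix i assume i: "i \<in> BI v e"
  then have i': "1 \<le> i" "i < n" "i \<in> XI v e" by (auto simp: BI_def XI_def)
  have "\<not> Suc (Suc t) \<le> i - 1"
  proof
    assume a: "Suc (Suc t) \<le> i - 1"
    then have "i - 1 \<in> YK v e" using Y i' by auto
    then show False using XI_shift_YK[OF h i'(3)] a by simp
  qed
  \<comment> \<open>\<open>C\<close> excludes t + 2 either through its predecessor or directly.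
    \<open>left_false\<close> supplies the first alternative, \<open>even_cross\<close> the
    second.\<close>
  moreover have "i \<noteq> Suc (Suc t)"
  proof
    assume a: "i = Suc (Suc t)"
    then have "i - 1 = Suc t" by arith
    then show False using C XI_shift_YK[OF h i'(3)] XI_NK[OF h i'(3)] a by auto
  qed
  ultimately show "i \<in> {1..Suc t}" using i' by auto
qed

text \<open>Apart from e_(t+1), all edges at v_1 stay within the first t + 1 vertices: free ones by
  \<open>N\<close>, and e_i with i <= t because releasing it by a rotation would conflict with
  \<open>Y\<close> (or because of \<open>nc\<close>). There are only C(t, r-1) such sets, so the
  degree requires all of them and e_(t+1) too.\<close>

lemma left_tight:
  assumes h: "ham_path v e" and N: "NI v e = {1..<Suc t}" and Y: "{Suc (Suc t)..<n} \<subseteq> YK v e"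
    and C: "Suc t \<in> YK v e \<or> Suc (Suc t) \<in> NK v e"
    and nc: "\<And>i. 1 \<le> i \<Longrightarrow> i \<le> t \<Longrightarrow> v 1 \<in> e i \<Longrightarrow> v (Suc (Suc t)) \<notin> e i"
  shows "Suc t \<in> BI v e" "\<And>k. k \<subseteq> v ` {1..Suc t} \<Longrightarrow> card k = r \<Longrightarrow> v 1 \<in> k \<Longrightarrow> k \<in> E"
proof -
  note H = hpD[OF h]
  let ?W = "v ` {1..Suc t}"
  have tn: "Suc (Suc t) < n" using nt t3 by auto
  have BI: "BI v e \<subseteq> {1..Suc t}" by (rule BI_le[OF h Y C])
  have sub: "k \<subseteq> ?W" if k: "k \<in> E" "v 1 \<in> k" "k \<noteq> e (Suc t)" for k
  proof
    fix y assume y: "y \<in> k"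
    then obtain j where j: "1 \<le> j" "j \<le> n" "y = v j" using hp_idx[OF h, of y] EV k by blast
    have "j \<le> Suc t"
    proof (rule ccontr)
      assume jt: "\<not> j \<le> Suc t"
      define l where "l = j - 1"
      have l: "Suc t \<le> l" "l < n" "j = Suc l" using jt j by (auto simp: l_def)
      show False
      proof (cases "k \<in> free_edges e")
        case True
        then have "l \<in> NI v e" using k y j l by (auto simp: NI_def)
        then show False using N l by auto
      next
        case False
        then have "k \<in> e ` {1..<n}" using k(1) by (simp add: free_edges_def)
        then obtain i where i: "1 \<le> i" "i < n" "k = e i" by auto
        then have "i \<in> BI v e" using k by (simp add: BI_def)
        then have it: "i \<le> t" using BI i k(3) by (cases "i = Suc t") auto
        have "i \<in> NI v e" using N it i by auto
        then obtain f where f: "f \<in> free_edges e" "rotation i f v e" using stp_NI by blast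
        have ne: "e i \<noteq> f" using path_edge_not_free[OF i(1,2)] f by auto
        show False
        proof (cases "l = Suc t")
          case True then show False using nc[OF i(1) it] k y i j l by simp
        next
          case False
          then have "l \<in> YK v e" using Y l by auto
          moreover have "l \<notin> YK v e"
            by (rule rot_avoid(1)[OF h f(2) _ ne H(4)[OF i(1,2)]]) (use it l y i j in auto)
          ultimately show False by blast
        qed
      qed
    qed
    then show "y \<in> ?W" using j by auto
  qed
  let ?G = "{k \<in> E. v 1 \<in> k}" and ?A = "{k. k \<subseteq> ?W \<and> card k = r \<and> v 1 \<in> k}"
  have fG: "finite ?G" using finE by simp
  have D: "(t choose (r - 1)) + 1 \<le> card ?G" using deg[of "v 1"] H(7)[of 1] n4 by (simp add: hdegree_def)
  have fA: "finite ?A" by (rule finite_subset[of _ "Pow ?W"]) auto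
  have cA: "card ?A \<le> t choose (r - 1)"
  proof -
    have "card (?W - {v 1}) = t"
    proof -
      have "card ?W = Suc t" by (subst card_v_image[OF h]) (use tn in auto)
      then show ?thesis by (subst card_Diff_singleton) auto
    qed
    then have "card {B. B \<subseteq> ?W - {v 1} \<and> card B = r - 1} = t choose (r - 1)"
      by (subst n_subsets) auto
    moreover have "?A \<subseteq> insert (v 1) ` {B. B \<subseteq> ?W - {v 1} \<and> card B = r - 1}"
    proof
      fix k assume k: "k \<in> ?A"
      then have "k = insert (v 1) (k - {v 1})" "card (k - {v 1}) = r - 1" by (auto simp: card_Diff_singleton)
      then show "k \<in> insert (v 1) ` {B. B \<subseteq> ?W - {v 1} \<and> card B = r - 1}" using k by blast
    qed
    ultimately show ?thesis
      using surj_card_le[of "{B. B \<subseteq> ?W - {v 1} \<and> card B = r - 1}" ?A "insert (v 1)"] by auto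
  qed
  have GA: "?G - {e (Suc t)} \<subseteq> ?A" using sub Er by auto
  have c1: "card (?G - {e (Suc t)}) \<le> card ?A" by (rule card_mono[OF fA GA])
  have "e (Suc t) \<in> ?G"
  proof (rule ccontr)
    assume "e (Suc t) \<notin> ?G"
    then have "?G - {e (Suc t)} = ?G" by blast
    then show False using c1 cA D by simp
  qed
  then show "Suc t \<in> BI v e" using tn by (simp add: BI_def)
  have "card (?G - {e (Suc t)}) = card ?G - 1"
    using \<open>e (Suc t) \<in> ?G\<close> by (rule card_Diff_singleton)
  then have "card ?A \<le> card (?G - {e (Suc t)})" using cA D by simp
  then have GA': "?G - {e (Suc t)} = ?A" by (rule card_seteq[OF fA GA])
  fix k assume "k \<subseteq> ?W" "card k = r" "v 1 \<in> k"
  then have "k \<in> ?A" by simp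
  then show "k \<in> E" unfolding GA'[symmetric] by simp
qed

text \<open>Suppose there is no crossing edge. The star at v_1 is then complete inside its half.
  Take v_i outside e_(t+1). After any rotation at i the start misses e_(t+1), so by
  \<open>left_tight\<close> it has fewer than t free neighbours and must lie in all of the first t
  path edges, including the edge of the rotation. But the star contains a free edge through v_1 and
  v_(i+1) that avoids v_i, and one can rotate along it.\<close>

lemma left_cross:
  assumes h: "ham_path v e" and N: "NI v e = {1..<Suc t}" and Y: "{Suc (Suc t)..<n} \<subseteq> YK v e"
    and C: "Suc t \<in> YK v e \<or> Suc (Suc t) \<in> NK v e"
    and U: "\<And>i f. rotation i f v e \<Longrightarrow> i \<le> t \<Longrightarrow> f \<in> free_edges e \<Longrightarrow> t \<le> card (NI (rotv i v) (rote i f e)) \<Longrightarrow>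
      NI (rotv i v) (rote i f e) = {1..<Suc t}"
    and nc: "\<And>i. 1 \<le> i \<Longrightarrow> i \<le> t \<Longrightarrow> v 1 \<in> e i \<Longrightarrow> v (Suc (Suc t)) \<notin> e i"
  shows "\<exists>i f l. rotation i f v e \<and> i \<le> t \<and> f \<in> free_edges e \<and> NI (rotv i v) (rote i f e) = {1..<Suc t} \<and>
    1 \<le> l \<and> l \<le> t \<and> rotv i v 1 \<in> rote i f e l \<and> rotv i v (Suc (Suc t)) \<in> rote i f e l"
proof (rule ccontr)
  assume no: "\<not> ?thesis"
  note H = hpD[OF h]
  note T = left_tight[OF h N Y C nc]
  have tn: "Suc (Suc t) < n" using nt t3 by auto
  let ?W = "v ` {1..Suc t}"
  have e1: "v 1 \<in> e (Suc t)" "v (Suc t) \<in> e (Suc t)" "v (Suc (Suc t)) \<in> e (Suc t)" "e (Suc t) \<in> E"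
    using T(1) H(4)[of "Suc t"] H(5)[of "Suc t"] H(6)[of "Suc t"] tn by (auto simp: BI_def)
  have cW: "card ?W = Suc t" by (subst card_v_image[OF h]) (use tn in auto)
  have nW: "v (Suc (Suc t)) \<notin> ?W" using v_mem_image[OF h, of "Suc (Suc t)" "{1..Suc t}"] tn by auto
  obtain i where i: "1 \<le> i" "i \<le> t" "v i \<notin> e (Suc t)"
  proof -
    have "\<not> ?W \<subseteq> e (Suc t)"
    proof
      assume "?W \<subseteq> e (Suc t)"
      then have "card ?W \<le> card (e (Suc t))" using card_mono finite_edge[OF e1(4)] by blast
      then show False using cW Er[OF e1(4)] rt by simp
    qed
    then obtain y where "y \<in> ?W" "y \<notin> e (Suc t)" by blast
    then obtain x where x: "1 \<le> x" "x \<le> Suc t" "v x \<notin> e (Suc t)" by auto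
    then have "x \<noteq> Suc t" using e1 by auto
    then show thesis using that[of x] x by simp
  qed
  have all: "rotv i v 1 \<in> rote i f e l" if f: "rotation i f v e" "f \<in> free_edges e" and l: "1 \<le> l" "l \<le> t" for f l
  proof -
    let ?v = "rotv i v" and ?e = "rote i f e"
    note R = rotationD(1)[OF h f(1)]
    have Y': "{Suc (Suc t)..<n} \<subseteq> YK ?v ?e" using stp_YK_gt[OF h f(1)] Y i by auto
    have C': "Suc t \<in> YK ?v ?e \<or> Suc (Suc t) \<in> NK ?v ?e"
      using C stp_YK_gt[OF h f(1), of "Suc t"] stp_NK_gt[OF h f(1), of "Suc (Suc t)"] i by auto
    have v1: "?v 1 = v i" by (rule rot_simps(1)[OF i(1)])
    have "?e (Suc t) = e (Suc t)" using i by (simp add: rote_def)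
    then have nB: "Suc t \<notin> BI ?v ?e" using v1 i by (simp add: BI_def)
    have "card (NI ?v ?e) \<le> t - 1"
    proof (rule ccontr)
      assume "\<not> card (NI ?v ?e) \<le> t - 1"
      then have N': "NI ?v ?e = {1..<Suc t}" using U[OF f(1) i(2) f(2)] by simp
      have nc': "\<And>l. 1 \<le> l \<Longrightarrow> l \<le> t \<Longrightarrow> ?v 1 \<in> ?e l \<Longrightarrow> ?v (Suc (Suc t)) \<notin> ?e l"
        using no f i N' by blast
      show False using left_tight(1)[OF R N' Y' C' nc'] nB by blast
    qed
    then have c: "t \<le> card (BI ?v ?e)" by (rule few_free_BI_t[OF R])
    have sub: "BI ?v ?e \<subseteq> {1..t}"
    proof
      fix x assume x: "x \<in> BI ?v ?e"
      then have "x \<in> {1..Suc t}" "x \<noteq> Suc t" using BI_le[OF R Y' C'] nB by auto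
      then show "x \<in> {1..t}" by simp
    qed
    have "BI ?v ?e = {1..t}" by (rule card_seteq) (use sub c in auto)
    then have "l \<in> BI ?v ?e" using l by auto
    then show ?thesis by (simp add: BI_def)
  qed
  have iN: "i \<in> NI v e" using N i by auto
  then obtain f where f: "f \<in> free_edges e" "rotation i f v e" using stp_NI by blast
  have vi: "v i \<in> e l" if l: "1 \<le> l" "l \<le> t" for l
  proof -
    consider "l = i" | "i < l" | "l < i" by linarith
    then show ?thesis
    proof cases
      case 1 then show ?thesis using H(4)[of i] i tn by simp
    next
      case 2
      then show ?thesis using all[OF f(2,1) l] rot_simps(1)[OF i(1)] rot_simps(4)[of i l] by simp
    next
      case 3
      then have "1 \<le> i - l" "i - l \<le> t" "i - l < i" "i - (i - l) = l" using i l by auto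
      then show ?thesis using all[OF f(2,1), of "i - l"] rot_simps(1)[OF i(1)] rot_simps(6)[of "i - l" i] by simp
    qed
  qed
  have i2: "i \<noteq> 1" using i e1 by auto
  have Sin: "i < n" "Suc i \<le> n" using i tn by auto
  have d: "v 1 \<noteq> v i" "v 1 \<noteq> v (Suc i)" "v i \<noteq> v (Suc i)" using H(8)[of 1 i] H(8)[of 1 "Suc i"] H(8)[of i "Suc i"] i i2 Sin by auto
  have inW: "v 1 \<in> ?W" "v i \<in> ?W" "v (Suc i) \<in> ?W" using i by auto
  let ?R = "?W - {v 1, v i, v (Suc i)}"
  have "card ?R = card ?W - card {v 1, v i, v (Suc i)}" using inW by (intro card_Diff_subset) auto
  moreover have "card {v 1, v i, v (Suc i)} = 3" using d by simp
  ultimately have "r - 2 \<le> card ?R" using cW rt by simp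
  then obtain B where B: "B \<subseteq> ?R" "card B = r - 2" "finite B" by (rule obtain_subset_with_card_n)
  define g where "g = insert (v 1) (insert (v (Suc i)) B)"
  have g1: "v 1 \<notin> B" "v (Suc i) \<notin> B" using B by auto
  have gW: "g \<subseteq> ?W" "v 1 \<in> g" "v (Suc i) \<in> g" "v i \<notin> g" using B inW d by (auto simp: g_def)
  have "card g = r" using g1 d B r3 by (simp add: g_def)
  then have gE: "g \<in> E" using T(2) gW by blast
  \<comment> \<open>Not a path edge: e_1, ..., e_t contain v_i, e_(t+1) contains v_(t+2), and later
    path edges miss v_1.\<close>
  have gF: "g \<in> free_edges e"
  proof (rule ccontr)
    assume "g \<notin> free_edges e"
    then obtain l where l: "1 \<le> l" "l < n" "g = e l" using gE by (auto simp: free_edges_def)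
    then have "l \<in> BI v e" using gW by (simp add: BI_def)
    then have "l \<le> Suc t" using BI_le[OF h Y C] by auto
    moreover have "l \<noteq> Suc t" using e1 l gW nW by auto
    ultimately show False using vi[of l] l gW by auto
  qed
  have "rotation i g v e" using gF gW i Sin by (simp add: rotation_def)
  then have "rotv i v 1 \<in> rote i g e i" using all[OF _ gF, of i] i by simp
  then show False using rot_simps(1)[OF i(1), of v] rot_simps(5)[of i g e] gW by simp
qed

text \<open>Here t + 1 lies in \<open>YK\<close>, so one crossing edge suffices: once released, it
  makes t + 1 a free index of the new start.\<close>

lemma left_false:
  assumes h: "ham_path v e" and c: "t \<le> card (NI v e)" and Y: "{Suc t..<n} \<subseteq> YK v e"
  shows False
proof -
  have N: "NI v' e' = {1..<Suc t}" if h': "ham_path v' e'" "t \<le> card (NI v' e')" "{Suc t..<n} \<subseteq> YK v' e'" for v' e'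
  proof (rule card_seteq)
    show "NI v' e' \<subseteq> {1..<Suc t}"
    proof
      fix x assume x: "x \<in> NI v' e'"
      then have "x \<notin> YK v' e'" "1 \<le> x" "x < n" using NI_YK[OF h'(1)] by (auto simp: NI_def)
      then show "x \<in> {1..<Suc t}" using h'(3) by (cases "Suc t \<le> x") auto
    qed
  qed (use h' in auto)
  have nc: False if h': "ham_path v' e'" "NI v' e' = {1..<Suc t}" "{Suc t..<n} \<subseteq> YK v' e'"
    and i: "1 \<le> i" "i \<le> t" "v' 1 \<in> e' i" "v' (Suc (Suc t)) \<in> e' i" for v' e' i
  proof -
    have "i \<in> NI v' e'" using i h' by auto
    then obtain f where f: "f \<in> free_edges e'" "rotation i f v' e'" using stp_NI by blast
    have ii: "i < n" using f(2) by (simp add: rotation_def)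
    have ne: "e' i \<noteq> f" using path_edge_not_free[OF i(1) ii] f by auto
    have tn: "Suc t < n" using nt t3 by auto
    have "Suc t \<notin> YK v' e'"
      by (rule rot_avoid(1)[OF h'(1) f(2) _ ne hpD(4)[OF h'(1) i(1) ii]]) (use i tn in auto)
    then show False using h'(3) tn by auto
  qed
  have tn: "Suc t < n" using nt t3 by auto
  have Y2: "{Suc (Suc t)..<n} \<subseteq> YK v e" "Suc t \<in> YK v e \<or> Suc (Suc t) \<in> NK v e" using Y tn by auto
  have Y': "{Suc t..<n} \<subseteq> YK (rotv i v) (rote i f e)" if "rotation i f v e" "i \<le> t" for i f
    using stp_YK_gt[OF h that(1)] that(2) Y by auto
  have U: "NI (rotv i v) (rote i f e) = {1..<Suc t}"
    if "rotation i f v e" "i \<le> t" "f \<in> free_edges e" "t \<le> card (NI (rotv i v) (rote i f e))" for i f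
    using N[OF rotationD(1)[OF h that(1)] that(4) Y'[OF that(1,2)]] .
  have nc': "\<And>i. 1 \<le> i \<Longrightarrow> i \<le> t \<Longrightarrow> v 1 \<in> e i \<Longrightarrow> v (Suc (Suc t)) \<notin> e i"
    using nc[OF h N[OF h c Y] Y] by blast
  obtain i f l where w: "rotation i f v e" "i \<le> t" "NI (rotv i v) (rote i f e) = {1..<Suc t}"
    "1 \<le> l" "l \<le> t" "rotv i v 1 \<in> rote i f e l" "rotv i v (Suc (Suc t)) \<in> rote i f e l"
    using left_cross[OF h N[OF h c Y] Y2 U nc'] by blast
  show False using nc[OF rotationD(1)[OF h w(1)] w(3) Y'[OF w(1,2)] w(4-7)] .
qed

lemma odd_false:
  assumes h: "ham_path v e" and n: "n = 2 * t + 1" and c: "t \<le> card (NI v e)"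
  shows False
proof (rule left_false[OF h c])
  have dis: "NI v e \<inter> YK v e = {}" using NI_YK[OF h] by blast
  have sub: "NI v e \<union> YK v e \<subseteq> {1..<n}" using idx_sub XY_sub by blast
  have "card (NI v e \<union> YK v e) = card (NI v e) + card (YK v e)"
    by (rule card_Un_disjoint[OF idx_fin(1) XY_sub(4) dis])
  moreover have "card (NI v e \<union> YK v e) \<le> 2 * t" using card_mono[OF _ sub] n by simp
  ultimately have cN: "card (NI v e) = t" "card (NI v e \<union> YK v e) = 2 * t" using c card_YK[OF h] by auto
  have U: "NI v e \<union> YK v e = {1..<n}" by (rule card_seteq[OF _ sub]) (use cN n in auto)
  have "NI v e = {1..<1 + card (NI v e)}"
  proof (rule down_closed_interval[OF idx_fin(1)])
    fix i assume i: "i \<in> NI v e" "1 < i"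
    then have "i - 1 \<in> NI v e \<union> YK v e" unfolding U by (auto simp: NI_def)
    then show "i - 1 \<in> NI v e" using XI_shift_YK[OF h, of i] i by (auto simp: XI_def)
  qed (auto simp: NI_def)
  then have "NI v e = {1..<Suc t}" unfolding cN(1) Suc_eq_plus1_left .
  then have "NI v e \<inter> {Suc t..<n} = {}" by auto
  moreover have "{Suc t..<n} \<subseteq> NI v e \<union> YK v e" unfolding U by auto
  ultimately show "{Suc t..<n} \<subseteq> YK v e" by blast
qed

text \<open>Agreement beyond t allows a second application to the reversed path: the first crossing
  edge then sits beyond t and survives, together with its vertices at positions t + 1 and n.\<close>

lemma even_cross:
  assumes h: "ham_path v e" and n: "n = 2 * t + 2" and c: "t \<le> card (NI v e)" "t \<le> card (NK v e)"
  shows "\<exists>v' e' i. ham_path v' e' \<and> t \<le> card (NI v' e') \<and> t \<le> card (NK v' e') \<and>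
    1 \<le> i \<and> i \<le> t \<and> v' 1 \<in> e' i \<and> v' (Suc (Suc t)) \<in> e' i \<and> (\<forall>j>t. v' j = v j \<and> e' j = e j)"
proof (cases "\<exists>i. 1 \<le> i \<and> i \<le> t \<and> v 1 \<in> e i \<and> v (Suc (Suc t)) \<in> e i")
  case True then show ?thesis using h c by blast
next
  case False
  then have nc: "\<And>i. 1 \<le> i \<Longrightarrow> i \<le> t \<Longrightarrow> v 1 \<in> e i \<Longrightarrow> v (Suc (Suc t)) \<notin> e i" by blast
  note G = good_path[OF h n c]
  have N: "NI v e = {1..<Suc t}" and K: "NK v e = {Suc (Suc t)..<n}" using G by auto
  have Y: "{Suc (Suc t)..<n} \<subseteq> YK v e" using K by (auto simp: YK_def)
  have C: "Suc t \<in> YK v e \<or> Suc (Suc t) \<in> NK v e" using K n t3 by auto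
  have cK: "t \<le> card (NK (rotv i v) (rote i f e))" if "rotation i f v e" for i f
    using stp_card_NK[OF h that] c(2) by simp
  have U: "NI (rotv i v) (rote i f e) = {1..<Suc t}"
    if "rotation i f v e" "i \<le> t" "f \<in> free_edges e" "t \<le> card (NI (rotv i v) (rote i f e))" for i f
    using good_path[OF rotationD(1)[OF h that(1)] n that(4) cK[OF that(1)]] by blast
  obtain i f l where w: "rotation i f v e" "i \<le> t" "NI (rotv i v) (rote i f e) = {1..<Suc t}"
    "1 \<le> l" "l \<le> t" "rotv i v 1 \<in> rote i f e l" "rotv i v (Suc (Suc t)) \<in> rote i f e l"
    using left_cross[OF h N Y C U nc] by blast
  have "\<forall>j>t. rotv i v j = v j \<and> rote i f e j = e j" using w(2) by (simp add: rot_simps)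
  moreover have "t \<le> card (NI (rotv i v) (rote i f e))" using w(3) by simp
  ultimately show ?thesis using rotationD(1)[OF h w(1)] cK[OF w(1)] w(4-7) by blast
qed

text \<open>On these paths the middle index t + 1 is in neither \<open>NI\<close> nor
  \<open>NK\<close>. Releasing the left crossing edge puts it into \<open>NI\<close>; releasing the
  right one joins the new end to the vertex at t + 1, which then conflicts with that.\<close>

lemma even_false:
  assumes h: "ham_path v e" and n: "n = 2 * t + 2" and c: "t \<le> card (NI v e)" "t \<le> card (NK v e)"
  shows False
proof -
  obtain v1 e1 i where 1: "ham_path v1 e1" "t \<le> card (NI v1 e1)" "t \<le> card (NK v1 e1)"
    "1 \<le> i" "i \<le> t" "v1 1 \<in> e1 i" "v1 (Suc (Suc t)) \<in> e1 i"
    using even_cross[OF h n c] by blast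
  have c': "t \<le> card (NI (revv v1) (reve e1))" "t \<le> card (NK (revv v1) (reve e1))"
    using card_rev[OF 1(1)] 1(2,3) by auto
  obtain w d j where 2: "ham_path w d" "t \<le> card (NI w d)" "t \<le> card (NK w d)"
    "1 \<le> j" "j \<le> t" "w 1 \<in> d j" "w (Suc (Suc t)) \<in> d j" and ag: "\<forall>j>t. w j = revv v1 j \<and> d j = reve e1 j"
    using even_cross[OF hp_rev(1)[OF 1(1)] n c'] by blast
  have N: "NI w d = {1..<Suc t}" and K: "NK w d = {Suc (Suc t)..<n}" using good_path[OF 2(1) n 2(2,3)] by auto
  define m where "m = n - i"
  have m: "Suc (Suc t) \<le> m" "m < n" using n 1 by (auto simp: m_def)
  have q: "n + 1 - n = 1" "n + 1 - Suc t = Suc (Suc t)" "n - m = i" using n 1 by (auto simp: m_def)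
  have "w n = v1 1" using ag[rule_format, of n] m q(1) unfolding revv_def by simp
  moreover have "w (Suc t) = v1 (Suc (Suc t))" using ag[rule_format, of "Suc t"] q(2) unfolding revv_def by simp
  moreover have "d m = e1 i" using ag[rule_format, of m] m q(3) unfolding reve_def by simp
  ultimately have D: "w n \<in> d m" "w (Suc t) \<in> d m" using 1 by auto
  have jN: "j \<in> NI w d" using N 2 by auto
  then obtain f where f: "f \<in> free_edges d" "rotation j f w d" using stp_NI by blast
  let ?w = "rotv j w" and ?d = "rote j f d"
  note R = rotationD(1)[OF 2(1) f(2)]
  have jn: "j < n" using 2 n by simp
  have tn: "Suc t < n" using n by simp
  have ne: "d j \<noteq> f" using path_edge_not_free[OF 2(4) jn] f by auto
  have T: "Suc t \<in> NI ?w ?d"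
    by (rule rot_NI[OF 2(1) f(2) _ ne hpD(4)[OF 2(1,4) jn]]) (use 2 tn in auto)
  have M: "m \<in> NK ?w ?d" using stp_NK_gt[OF 2(1) f(2)] K m 2 by auto
  have D': "?w (Suc t) \<in> ?d m" "?w (Suc m) \<in> ?d m"
    using D m 2 hpD(5)[OF 2(1), of m] by (auto simp: rotv_def rote_def)
  let ?x = "revv ?w" and ?g = "reve ?d"
  note R2 = hp_rev[OF R]
  have "n - m \<in> NI ?x ?g" using rev_mem(1)[OF R, of m] M m by simp
  then obtain f2 where f2: "f2 \<in> free_edges ?g" "rotation (n - m) f2 ?x ?g" using stp_NI by blast
  have nm: "1 \<le> n - m" "n - m < n" "n - m < Suc t" using m n by auto
  have ne2: "?g (n - m) \<noteq> f2" using path_edge_not_free[OF nm(1,2)] f2 by auto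
  have xs: "?x (Suc (Suc t)) = ?w (Suc t)" "?g (n - m) = ?d m"
  proof -
    have "n + 1 - Suc (Suc t) = Suc t" "n - (n - m) = m" using n m by auto
    then show "?x (Suc (Suc t)) = ?w (Suc t)" "?g (n - m) = ?d m" unfolding revv_def reve_def by simp_all
  qed
  have "Suc t \<notin> YK ?x ?g"
    by (rule rot_avoid(1)[OF R2(1) f2(2) _ ne2 hpD(4)[OF R2(1) nm(1,2)]]) (use nm tn xs D' in auto)
  moreover have "n - (Suc t) = Suc t" using n by simp
  then have "Suc t \<in> NK ?x ?g" using rev_mem(2)[OF R, of "Suc t"] T tn by simp
  ultimately show False by (simp add: YK_def)
qed

end

section \<open>Double counting: a path with t free neighbours at both ends\<close>

context unif
begin

lemma sum_card_incidence:
  assumes "finite S" "finite L"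
  shows "(\<Sum>x\<in>S. card {l \<in> L. x \<in> e l}) = (\<Sum>l\<in>L. card {x \<in> S. x \<in> e l})"
  using sum_multicount_gen[OF assms, of "\<lambda>x l. x \<in> e l" "\<lambda>l. card {x \<in> S. x \<in> e l}"] by simp

lemma card_edge_Int: "k \<in> E \<Longrightarrow> card {x \<in> S. x \<in> k} \<le> r"
  using card_mono[OF finite_edge, of k "{x \<in> S. x \<in> k}"] Er[of k] by auto

lemma path_degree_same:
  assumes "ham_path v e" "ham_path v' e'" "free_edges e' = free_edges e"
  shows "card {l \<in> {1..<n}. x \<in> e' l} = card {l \<in> {1..<n}. x \<in> e l}"
  using hdegree_split[OF assms(1), of x] hdegree_split[OF assms(2), of x] assms(3) by simp

text \<open>Rotation along e_i changes no free edge, so every vertex keeps its number of path edges.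
  Bounds proved for a first vertex thus hold for v_i on the original path.\<close>

lemma same_step:
  assumes h: "ham_path v e" and i: "i \<in> BI v e"
  defines "v' \<equiv> rotv i v" and "e' \<equiv> rote i (e i) e"
  shows "ham_path v' e'" "free_edges e' = free_edges e" "v' 1 = v i" "card {l \<in> {1..<n}. v i \<in> e l} = card (BI v' e')" "v' n = v n"
    "rotation i (e i) v e"
proof -
  have i': "1 \<le> i" "i < n" "v 1 \<in> e i" using i by (auto simp: BI_def)
  show h': "ham_path v' e'" "free_edges e' = free_edges e" using hp_rot_same[OF h i'] by (auto simp: v'_def e'_def)
  show 1: "v' 1 = v i" unfolding v'_def by (rule rot_simps(1)[OF i'(1)])
  show "card {l \<in> {1..<n}. v i \<in> e l} = card (BI v' e')"
    unfolding BI_def 1 by (rule path_degree_same[OF h h', symmetric])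
  show "v' n = v n" using i' by (simp add: v'_def rotv_def)
  show "rotation i (e i) v e" by (rule stp_BI[OF h i])
qed

end

context dirac
begin

text \<open>By \<open>even_false\<close> the start of such a path has fewer than t free neighbours,
  hence at least t path edges, and rotations at the start preserve the situation. All starts reached
  this way compete for the first t + 1 path edges.\<close>

lemma many_free_end_false:
  assumes h0: "ham_path v0 e0" and n: "n = 2 * t + 2" and c0: "t \<le> card (NK v0 e0)"
  shows False
proof -
  let ?Q = "\<lambda>v e. ham_path v e \<and> t \<le> card (NK v e)"
  have NI: "card (NI v e) \<le> t - 1" if "?Q v e" for v e
    using even_false[of v e] that n by fastforce
  have BIt: "t \<le> card (BI v e)" if "?Q v e" for v e using few_free_BI_t[of v e] NI[OF that] that by blast
  have rot: "?Q (rotv i v) (rote i f e)" if "?Q v e" "rotation i f v e" for v e i f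
    using rotationD(1)[of v e i f] stp_card_NK[of v e i f] that by auto
  have same: "?Q (rotv i v) (rote i (e i) e)" if "?Q v e" "i \<in> BI v e" for v e i
    using rot[OF that(1) stp_BI] that by blast
  let ?K = "{Suc (Suc t)..<n}"
  have BInot: "i \<notin> NK v e" "2 \<le> i \<Longrightarrow> i - 1 \<notin> NK v e" "1 \<le> i" "i < n" if q: "?Q v e" "i \<in> XI v e" for v e i
    using XI_NK[of v e i] XI_shift_YK[of v e i] q XY_sub(1)[of v e] by (auto simp: YK_def)
  \<comment> \<open>Unless \<open>NK\<close> is the final interval, at most t indices are compatible
    with it, so \<open>BI\<close> must use all of them.\<close>
  have tight: "l \<in> BI v e" if q: "?Q v e" "NK v e \<noteq> ?K" and l: "1 \<le> l" "l < n" "l \<notin> NK v e" "2 \<le> l \<longrightarrow> l - 1 \<notin> NK v e" for v e l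
  proof -
    let ?C = "{1..<n} - NK v e"
    define I where "I = {l \<in> {1..<n}. l \<notin> NK v e \<and> (2 \<le> l \<longrightarrow> l - 1 \<notin> NK v e)}"
    have fI: "finite I" by (simp add: I_def)
    have sub: "BI v e \<subseteq> I" using BInot[OF q(1)] NI_XI(2)[of v e] by (auto simp: I_def)
    have cC: "card ?C = 2 * t + 1 - card (NK v e)" using card_Diff_subset[OF idx_fin(3) idx_sub(3), of v e] n by simp
    have IC: "I \<subseteq> ?C" by (auto simp: I_def)
    have "card I \<le> t"
    proof (cases "card (NK v e) = t")
      case False
      then have "t < card (NK v e)" using q by simp
      then have "card ?C \<le> t" unfolding cC by linarith
      then show ?thesis using card_mono[OF _ IC] by simp
    next
      case True
      then have C1: "card ?C = Suc t" using cC by simp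
      have "I \<noteq> ?C"
      proof
        assume IC': "I = ?C"
        have fC: "finite ?C" by simp
        have "?C = {1..<1 + card ?C}"
        proof (rule down_closed_interval[OF fC])
          fix i assume i: "i \<in> ?C" "1 < i"
          then have "i \<in> I" using IC' by simp
          then have "i - 1 \<notin> NK v e" using i by (auto simp: I_def)
          then show "i - 1 \<in> ?C" using i by auto
        qed auto
        then have C: "?C = {1..<Suc (Suc t)}" unfolding C1 Suc_eq_plus1_left .
        have "NK v e = {1..<n} - ?C" using idx_sub(3)[of v e] by blast
        also have "\<dots> = ?K" unfolding C by auto
        finally show False using q(2) by simp
      qed
      then have "card I < card ?C" using IC by (intro psubset_card_mono) auto
      then show ?thesis using C1 by simp
    qed
    then have "BI v e = I" using BIt[OF q(1)] by (intro card_seteq[OF fI sub]) simp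
    then show ?thesis using l by (auto simp: I_def)
  qed
  \<comment> \<open>Otherwise the last index l of \<open>BI\<close> stays in \<open>BI\<close> after
    rotating at any other one, so e_l contains all vertices with index in \<open>BI\<close> and
    v_(l+1), more than r.\<close>
  have NKK: "NK v e = ?K" if q: "?Q v e" for v e
  proof (rule ccontr)
    assume nK: "NK v e \<noteq> ?K"
    have h: "ham_path v e" using q by blast
    have 1: "1 \<in> BI v e" using one_in_BI[OF h] by simp
    define l where "l = Max (BI v e)"
    have lB: "l \<in> BI v e" unfolding l_def using 1 by (intro Max_in) auto
    have lmax: "i \<in> BI v e \<Longrightarrow> i \<le> l" for i unfolding l_def by simp
    have l: "1 \<le> l" "l < n" using lB by (auto simp: BI_def)
    have lX: "l \<in> XI v e" using lB by (simp add: XI_def)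
    have vi: "v i \<in> e l" if iB: "i \<in> BI v e" for i
    proof (cases "i = l")
      case True then show ?thesis using hpD(4)[OF h l] by simp
    next
      case False
      then have il: "i < l" using lmax[OF iB] by simp
      let ?v = "rotv i v" and ?e = "rote i (e i) e"
      note S = same_step[OF h iB]
      have i: "1 \<le> i" "i < n" using iB by (auto simp: BI_def)
      have q': "?Q ?v ?e" by (rule same[OF q iB])
      have "i \<in> BI ?v ?e" using S(3) hpD(4)[OF h i] i rot_simps(5)[of i "e i" e] by (simp add: BI_def)
      then have iK: "i \<notin> NK ?v ?e" using BInot(1)[OF q', of i] by (simp add: XI_def)
      have nK': "NK ?v ?e \<noteq> ?K"
      proof
        assume K: "NK ?v ?e = ?K"
        then have it: "i \<le> Suc t" using iK i by auto
        have "NK v e \<subseteq> ?K"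
        proof
          fix x assume x: "x \<in> NK v e"
          show "x \<in> ?K"
          proof (cases "i < x")
            case True then show ?thesis using stp_NK_gt[OF h S(6) x] K by simp
          next
            case False
            then have "i + 1 - x \<in> ?K" using stp_NK_le[OF h S(6) x] K by simp
            then show ?thesis using it x by (auto simp: NK_def)
          qed
        qed
        then have "NK v e = ?K" using q n by (intro card_seteq) auto
        then show False using nK by blast
      qed
      have up: "x \<notin> NK ?v ?e" if "i < x" "x \<notin> NK v e" for x
        using that S(2,5) by (auto simp: NK_def rot_simps(2))
      have "l \<notin> NK ?v ?e" using up[OF il] BInot(1)[OF q lX] by blast
      moreover have "2 \<le> l \<longrightarrow> l - 1 \<notin> NK ?v ?e"
      proof
        assume l2: "2 \<le> l"
        show "l - 1 \<notin> NK ?v ?e"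
        proof (cases "l - 1 = i")
          case True then show ?thesis using iK by simp
        next
          case False
          then have "i < l - 1" using il by simp
          then show ?thesis using up BInot(2)[OF q lX l2] by blast
        qed
      qed
      ultimately have "l \<in> BI ?v ?e" using tight[OF q' nK' l] by blast
      then show ?thesis using S(3) il by (simp add: BI_def rot_simps(4))
    qed
    have sub: "v ` insert (Suc l) (BI v e) \<subseteq> e l" using vi hpD(5)[OF h l] by auto
    have "card (v ` insert (Suc l) (BI v e)) = card (insert (Suc l) (BI v e))"
      by (rule card_v_image[OF h]) (use l BI_sub in auto)
    moreover have "Suc l \<notin> BI v e" using lmax by fastforce
    then have "card (insert (Suc l) (BI v e)) = Suc (card (BI v e))" by simp
    ultimately have "Suc t \<le> card (v ` insert (Suc l) (BI v e))" using BIt[OF q] by simp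
    also have "\<dots> \<le> r" using card_mono[OF finite_edge sub] hpD(6)[OF h l] Er by simp
    finally show False using rt by simp
  qed
  have Xsub: "XI v e \<subseteq> {1..Suc t}" if q: "?Q v e" for v e
  proof
    fix i assume i: "i \<in> XI v e"
    then show "i \<in> {1..Suc t}" using BInot[OF q i] NKK[OF q] by auto
  qed
  have Bsub: "BI v e \<subseteq> {1..Suc t}" if q: "?Q v e" for v e using Xsub[OF q] NI_XI(2)[of v e] by blast
  have tn: "Suc (Suc t) < n" using n t3 by simp
  have pd: "t \<le> card {l \<in> {1..Suc t}. v i \<in> e l}" if q: "?Q v e" and iB: "i \<in> BI v e" for v e i
  proof -
    have h: "ham_path v e" using q by blast
    note S = same_step[OF h iB]
    note q' = same[OF q iB]
    have "{l \<in> {1..<n}. v i \<in> e l} \<subseteq> {l \<in> {1..Suc t}. v i \<in> e l}"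
    proof
      fix l assume l: "l \<in> {l \<in> {1..<n}. v i \<in> e l}"
      have "l \<le> Suc t"
      proof (cases "i < l")
        case True
        then have "l \<in> BI (rotv i v) (rote i (e i) e)" using l S(3) by (simp add: BI_def rot_simps(4))
        then show ?thesis using Bsub[OF q'] by auto
      next
        case False
        then show ?thesis using Bsub[OF q] iB by auto
      qed
      then show "l \<in> {l \<in> {1..Suc t}. v i \<in> e l}" using l by simp
    qed
    then have "card {l \<in> {1..<n}. v i \<in> e l} \<le> card {l \<in> {1..Suc t}. v i \<in> e l}" by (rule card_mono[rotated]) simp
    then show ?thesis using S(4) BIt[OF q'] by simp
  qed
  have count: "card (BI v e) * t \<le> (\<Sum>l\<in>{1..Suc t}. card {x \<in> v ` BI v e. x \<in> e l})" if q: "?Q v e" for v e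
  proof -
    have "card (BI v e) * t = (\<Sum>x\<in>v ` BI v e. t)" using card_v_image[of v e "BI v e"] BI_sub[of v e] q by simp
    also have "\<dots> \<le> (\<Sum>x\<in>v ` BI v e. card {l \<in> {1..Suc t}. x \<in> e l})"
      by (rule sum_mono) (use pd[OF q] in auto)
    also have "\<dots> = (\<Sum>l\<in>{1..Suc t}. card {x \<in> v ` BI v e. x \<in> e l})" by (rule sum_card_incidence) auto
    finally show ?thesis .
  qed
  have eE: "e l \<in> E" if "?Q v e" "l \<in> {1..Suc t}" for v e l
    using hpD(6)[of v e l] that tn by auto
  have q0: "?Q v0 e0" using h0 c0 by blast
  have "r = 3 \<and> r < t \<or> r = t"
  proof (rule ccontr)
    assume "\<not> ?thesis"
    then have "4 \<le> r" "r < t" using r3 rt by auto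
    then have "t + 1 \<le> t - 1 choose (r - 2)" by (rule choose_pred_ge(2))
    moreover have "1 + (t - 1 choose (r - 2)) \<le> card (BI v0 e0)" by (rule few_free_BI[OF h0 NI[OF q0]])
    moreover have "card (BI v0 e0) \<le> Suc t" using card_mono[OF _ Bsub[OF q0]] by simp
    ultimately show False by linarith
  qed
  then show False
  proof
    assume r: "r = 3 \<and> r < t"
    have "(\<Sum>l\<in>{1..Suc t}. card {x \<in> v0 ` BI v0 e0. x \<in> e0 l}) \<le> (\<Sum>l\<in>{1..Suc t}. 3)"
      using card_edge_Int[OF eE[OF q0]] r by (intro sum_mono) auto
    then have "card (BI v0 e0) * t \<le> 3 * Suc t" using count[OF q0] by (simp add: mult.commute)
    moreover have "t * t \<le> card (BI v0 e0) * t" using BIt[OF q0] by simp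
    moreover have "4 * t \<le> t * t" using r by simp
    ultimately show False using r by simp
  next
    assume r: "r = t"
    have ct: "t choose (r - 1) = t" "t - 1 choose (r - 1) = 1" using r choose_top[OF t3] by auto
    \<comment> \<open>With t + 1 such vertices the count would need t(t + 1) incidences; but e_(t+1)
      also contains v_(t+2), so there are at most t t + (t - 1).\<close>
    have cB: "card (BI v e) = t" if q: "?Q v e" for v e
    proof (rule ccontr)
      assume "card (BI v e) \<noteq> t"
      then have B: "BI v e = {1..Suc t}" using BIt[OF q] Bsub[OF q] by (intro card_seteq) auto
      have h: "ham_path v e" using q by blast
      let ?c = "\<lambda>l. card {x \<in> v ` BI v e. x \<in> e l}"
      have "v (Suc (Suc t)) \<notin> v ` BI v e"
        using v_mem_image[OF h, of "Suc (Suc t)" "BI v e"] tn BI_sub[of v e] B by simp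
      then have "{x \<in> v ` BI v e. x \<in> e (Suc t)} \<subseteq> e (Suc t) - {v (Suc (Suc t))}" by blast
      then have "?c (Suc t) \<le> card (e (Suc t) - {v (Suc (Suc t))})"
        using finite_edge eE[OF q] by (intro card_mono) auto
      also have "\<dots> = t - 1" using hpD(5)[OF h, of "Suc t"] tn Er[OF eE[OF q, of "Suc t"]] r by (simp add: card_Diff_singleton)
      finally have 1: "?c (Suc t) \<le> t - 1" .
      have "(\<Sum>l\<in>{1..t}. ?c l) \<le> (\<Sum>l\<in>{1..t}. t)"
        using card_edge_Int[OF eE[OF q]] r by (intro sum_mono) auto
      moreover have "(\<Sum>l\<in>{1..Suc t}. ?c l) = (\<Sum>l\<in>{1..t}. ?c l) + ?c (Suc t)" by simp
      ultimately have "(\<Sum>l\<in>{1..Suc t}. ?c l) \<le> t * t + (t - 1)" using 1 by simp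
      moreover have "card (BI v e) = Suc t" using B by simp
      ultimately have "Suc t * t \<le> t * t + (t - 1)" using count[OF q] by simp
      then show False using t3 by simp
    qed
    \<comment> \<open>The degree is at least t + 1, of which t fall on the path, and C(t-1, t-1) = 1
      bounds the rest.\<close>
    have ex1: "\<exists>f. {f \<in> free_edges e. v 1 \<in> f} = {f}" if q: "?Q v e" for v e
    proof -
      have h: "ham_path v e" using q by blast
      have "card {f \<in> free_edges e. v 1 \<in> f} \<le> card (NI v e) choose (r - 1)" by (rule card_free_start[OF h])
      also have "\<dots> \<le> t - 1 choose (r - 1)" by (rule binomial_right_mono[OF NI[OF q]])
      finally have "card {f \<in> free_edges e. v 1 \<in> f} \<le> 1" using ct by simp
      moreover have "t + 1 \<le> card {f \<in> free_edges e. v 1 \<in> f} + t"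
        using deg[of "v 1"] hpD(7)[OF h, of 1] n4 hdegree_start_eq[OF h] cB[OF q] ct by simp
      ultimately have "card {f \<in> free_edges e. v 1 \<in> f} = 1" by simp
      then show ?thesis by (meson card_1_singletonE)
    qed
    have init: "v ` {1..t} \<in> free_edges e \<and> NI v e = {1..<t} \<and> NI v e \<subseteq> BI v e" if q: "?Q v e" for v e
    proof -
      have h: "ham_path v e" using q by blast
      have "XI v e \<noteq> {1..Suc t}"
      proof
        assume X: "XI v e = {1..Suc t}"
        have "{Suc t..<n} \<subseteq> YK (revv v) (reve e)"
        proof
          fix x assume x: "x \<in> {Suc t..<n}"
          then have "n - x \<in> XI v e" "1 \<le> n - x" "n - x < n" "n - (n - x) = x" unfolding X using n by auto
          then show "x \<in> YK (revv v) (reve e)" using rev_mem(6)[OF h, of "n - x"] by simp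
        qed
        then show False using left_false[OF hp_rev(1)[OF h]] card_rev(1)[OF h] q by simp
      qed
      then have "card (XI v e) < Suc t" using psubset_card_mono[of "{1..Suc t}" "XI v e"] Xsub[OF q] by auto
      then have "BI v e = XI v e" using cB[OF q] by (intro card_seteq[OF XY_sub(3) NI_XI(2)]) simp
      then have NB: "NI v e \<subseteq> BI v e" by (simp add: NI_XI)
      obtain f where f: "{f \<in> free_edges e. v 1 \<in> f} = {f}" using ex1[OF q] by blast
      then have fF: "f \<in> free_edges e" "v 1 \<in> f" by auto
      have NIf: "NI v e = {i \<in> {1..<n}. v (Suc i) \<in> f}"
      proof -
        have "(\<exists>g\<in>free_edges e. v 1 \<in> g \<and> v (Suc i) \<in> g) \<longleftrightarrow> v (Suc i) \<in> f" for i using f by blast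
        then show ?thesis unfolding NI_def by simp
      qed
      have cN: "card (NI v e) = t - 1" unfolding NIf using edge_start_card(2)[OF h Fr_sub[OF fF(1)] fF(2)] r by simp
      \<comment> \<open>For i in \<open>NI\<close>, v_i lies in just one free edge g. After rotating
        along \<open>f\<close> its only free edge is e_i, so g has been consumed: g = f and i - 1 is
        in \<open>NI\<close>.\<close>
      have "NI v e = {1..<1 + card (NI v e)}"
      proof (rule down_closed_interval[OF idx_fin(1)])
        fix i assume i: "i \<in> NI v e" "1 < i"
        then have s: "rotation i f v e" using NIf fF by (auto simp: rotation_def)
        have iB: "i \<in> BI v e" using NB i by blast
        have i': "1 \<le> i" "i < n" using iB by (auto simp: BI_def)
        note S = same_step[OF h iB]
        obtain g where g: "g \<in> free_edges e" "v i \<in> g" using ex1[OF same[OF q iB]] S(2,3) by auto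
        obtain g' where g': "{k \<in> free_edges (rote i f e). rotv i v 1 \<in> k} = {g'}" using ex1[OF rot[OF q s]] by blast
        have v1: "rotv i v 1 = v i" by (rule rot_simps(1)[OF i'(1)])
        have ne: "e i \<notin> free_edges e" by (rule path_edge_not_free[OF i'])
        have "e i \<in> {k \<in> free_edges (rote i f e). rotv i v 1 \<in> k}"
          using rotationD(2)[OF h s] ne fF(1) hpD(4)[OF h i'] v1 by auto
        then have eg: "e i = g'" using g' by simp
        have "g = f"
        proof (rule ccontr)
          assume "g \<noteq> f"
          then have "g \<in> {k \<in> free_edges (rote i f e). rotv i v 1 \<in> k}" using rotationD(2)[OF h s] g v1 by simp
          then show False using g' eg ne g(1) by simp
        qed
        then have "v (Suc (i - 1)) \<in> f" using g i by simp
        then show "i - 1 \<in> NI v e" unfolding NIf using i i' by auto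
      qed (auto simp: NI_def)
      then have N: "NI v e = {1..<t}" unfolding cN using t3 by simp
      have "f = insert (v 1) ((\<lambda>i. v (Suc i)) ` {1..<t})"
        using edge_start_card(1)[OF h Fr_sub[OF fF(1)] fF(2)] NIf N by simp
      also have "(\<lambda>i. v (Suc i)) ` {1..<t} = v ` Suc ` {1..<t}" by (rule image_image[symmetric])
      also have "Suc ` {1..<t} = {Suc 1..<Suc t}" by simp
      also have "insert (v 1) (v ` {Suc 1..<Suc t}) = v ` insert 1 {Suc 1..<Suc t}" by simp
      also have "insert 1 {Suc 1..<Suc t} = {1..t}" using t3 by auto
      finally show ?thesis using fF N NB by simp
    qed
    have NB0: "NI v0 e0 = {1..<t}" and F0: "v0 ` {1..t} \<in> free_edges e0" and NB: "NI v0 e0 \<subseteq> BI v0 e0"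
      using init[OF q0] by auto
    \<comment> \<open>The free edge on the first t vertices is not a path edge, so each e_l holds at
      most t - 1 of them, and (t + 1)(t - 1) < t t.\<close>
    have Bne: "BI v0 e0 \<noteq> {1..t}"
    proof
      assume B: "BI v0 e0 = {1..t}"
      have "card {x \<in> v0 ` BI v0 e0. x \<in> e0 l} \<le> t - 1" if l: "l \<in> {1..Suc t}" for l
      proof -
        have cf: "card (v0 ` {1..t}) = t" using Er[OF Fr_sub[OF F0]] r by simp
        have "e0 l \<noteq> v0 ` {1..t}" using path_edge_not_free[of l e0] l tn F0 by auto
        moreover have "card (e0 l) = t" "finite (e0 l)" using Er[OF eE[OF q0 l]] r finite_edge[OF eE[OF q0 l]] by auto
        ultimately have "\<not> v0 ` {1..t} \<subseteq> e0 l" using cf card_subset_eq by metis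
        then have "{x \<in> v0 ` {1..t}. x \<in> e0 l} \<subset> v0 ` {1..t}" by blast
        then have "card {x \<in> v0 ` {1..t}. x \<in> e0 l} < t" using psubset_card_mono[of "v0 ` {1..t}"] cf by simp
        then show ?thesis unfolding B by simp
      qed
      then have "(\<Sum>l\<in>{1..Suc t}. card {x \<in> v0 ` BI v0 e0. x \<in> e0 l}) \<le> (\<Sum>l\<in>{1..Suc t}. t - 1)" by (rule sum_mono)
      then have "t * t \<le> Suc t * (t - 1)" using count[OF q0] cB[OF q0] by simp
      moreover obtain s where "t = Suc s" using t3 by (cases t) auto
      then have "Suc t * (t - 1) < t * t" by simp
      ultimately show False by simp
    qed
    have "Suc t \<in> BI v0 e0"
    proof (rule ccontr)
      assume nS: "Suc t \<notin> BI v0 e0"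
      have "BI v0 e0 \<subseteq> {1..t}"
      proof
        fix x assume x: "x \<in> BI v0 e0"
        then have "x \<in> {1..Suc t}" "x \<noteq> Suc t" using Bsub[OF q0] nS by auto
        then show "x \<in> {1..t}" by simp
      qed
      then have "BI v0 e0 = {1..t}" using cB[OF q0] by (intro card_seteq) auto
      then show False using Bne by blast
    qed
    note S = same_step[OF h0 this] and q1 = same[OF q0 this]
    \<comment> \<open>Rotating along e_(t+1) shows that v_2, ..., v_(t+1) form a free edge as well.
      But v_2 can be brought to the front and so has only one free edge.\<close>
    have F1: "rotv (Suc t) v0 ` {1..t} \<in> free_edges e0" using init[OF q1] S(2) by simp
    have im: "rotv (Suc t) v0 ` {1..t} = v0 ` {2..Suc t}"
    proof -
      have "rotv (Suc t) v0 ` {1..t} = v0 ` (\<lambda>j. Suc t + 1 - j) ` {1..t}"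
        unfolding image_image by (rule image_cong) (auto simp: rotv_def)
      also have "(\<lambda>j. Suc t + 1 - j) ` {1..t} = {2..Suc t}"
      proof
        show "{2..Suc t} \<subseteq> (\<lambda>j. Suc t + 1 - j) ` {1..t}"
        proof
          fix x assume "x \<in> {2..Suc t}"
          then show "x \<in> (\<lambda>j. Suc t + 1 - j) ` {1..t}" by (intro image_eqI[of _ _ "Suc t + 1 - x"]) auto
        qed
      qed auto
      finally show ?thesis .
    qed
    have "2 \<in> BI v0 e0" using NB NB0 t3 by auto
    note S2 = same_step[OF h0 this] and q2 = same[OF q0 this]
    obtain g where g: "{f \<in> free_edges e0. v0 2 \<in> f} = {g}" using ex1[OF q2] S2(2,3) by auto
    have m: "v0 2 \<in> v0 ` {1..t}" "v0 2 \<in> v0 ` {2..Suc t}" "v0 1 \<in> v0 ` {1..t}"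
      using t3 by (simp_all add: imageI)
    have "v0 ` {1..t} \<in> {f \<in> free_edges e0. v0 2 \<in> f}" "v0 ` {2..Suc t} \<in> {f \<in> free_edges e0. v0 2 \<in> f}"
      using F0 F1 m unfolding im by blast+
    then have "v0 1 \<in> v0 ` {2..Suc t}" using m(3) unfolding g by simp
    then show False using v_mem_image[OF h0, of 1 "{2..Suc t}"] tn by simp
  qed
qed

text \<open>\<open>W\<close> collects the vertices that one rotation along a path edge brings to
  either end. These rotations keep the free edges, so the bounds for a first vertex hold on all of
  \<open>W\<close>. The two halves are disjoint by \<open>XI_shift_YK\<close>.\<close>

lemma rotation_end_set:
  assumes few: "\<forall>v e. ham_path v e \<longrightarrow> card (NI v e) \<le> t - 1" and h: "ham_path v e"
  obtains W where "W \<subseteq> V" "v 1 \<in> W" "v n \<in> W" "2 * (1 + (t - 1 choose (r - 2))) \<le> card W"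
    "\<And>x. x \<in> W \<Longrightarrow> 1 + (t - 1 choose (r - 2)) \<le> card {l \<in> {1..<n}. x \<in> e l}"
    "\<And>x. x \<in> W \<Longrightarrow> card {f \<in> free_edges e. x \<in> f} \<le> t - 1 choose (r - 1)"
proof -
  let ?c = "1 + (t - 1 choose (r - 2))"
  have SM: "\<And>v e. ham_path v e \<Longrightarrow> card (NI v e) \<le> t - 1" using few by blast
  have S: "?c \<le> card (v ` BI v e) \<and> v ` BI v e \<subseteq> V \<and> v 1 \<in> v ` BI v e \<and>
      (\<forall>x\<in>v ` BI v e. ?c \<le> card {l \<in> {1..<n}. x \<in> e l} \<and> card {f \<in> free_edges e. x \<in> f} \<le> t - 1 choose (r - 1))"
    if h: "ham_path v e" for v e
  proof (intro conjI ballI)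
    show "?c \<le> card (v ` BI v e)"
      using few_free_BI[OF h SM[OF h]] card_v_image[OF h BI_sub[of v e]] by simp
    show "v ` BI v e \<subseteq> V" using hpD(7)[OF h] by (auto simp: BI_def)
    show "v 1 \<in> v ` BI v e" using one_in_BI(1)[OF h] by blast
    fix x assume "x \<in> v ` BI v e"
    then obtain i where i: "i \<in> BI v e" "x = v i" by blast
    note T = same_step[OF h i(1)]
    let ?v = "rotv i v" and ?e = "rote i (e i) e"
    show "?c \<le> card {l \<in> {1..<n}. x \<in> e l}" using few_free_BI[OF T(1) SM[OF T(1)]] T(4) i by simp
    have "card {f \<in> free_edges ?e. ?v 1 \<in> f} \<le> card (NI ?v ?e) choose (r - 1)" by (rule card_free_start[OF T(1)])
    also have "\<dots> \<le> t - 1 choose (r - 1)" by (rule binomial_right_mono[OF SM[OF T(1)]])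
    finally show "card {f \<in> free_edges e. x \<in> f} \<le> t - 1 choose (r - 1)" unfolding T(2,3) i(2) .
  qed
  let ?S = "v ` BI v e" and ?T = "revv v ` BI (revv v) (reve e)"
  note R = hp_rev[OF h]
  have rn: "revv v 1 = v n" by (simp add: revv_def)
  have disj: "?S \<inter> ?T = {}"
  proof (rule ccontr)
    assume "?S \<inter> ?T \<noteq> {}"
    then obtain i j where ij: "i \<in> BI v e" "j \<in> BI (revv v) (reve e)" "v i = revv v j" by blast
    have i: "1 \<le> i" "i < n" and j: "1 \<le> j" "j < n" using ij by (auto simp: BI_def)
    have "i = n + 1 - j" using ij(3) hpD(8)[OF h, of i "n + 1 - j"] i j unfolding revv_def by simp
    then have "2 \<le> i" "i - 1 = n - j" using j by auto
    moreover have "n - (n - j) = j" "1 \<le> n - j" "n - j < n" using j by auto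
    then have "n - j \<in> BK v e" using rev_mem(3)[OF h, of "n - j"] ij(2) by simp
    ultimately show False using XI_shift_YK[OF h, of i] ij(1) by (auto simp: XI_def YK_def)
  qed
  have pdr: "card {l \<in> {1..<n}. x \<in> reve e l} = card {l \<in> {1..<n}. x \<in> e l}" for x
    by (rule path_degree_same[OF h R])
  note S1 = S[OF h] and S2 = S[OF R(1)]
  show thesis
  proof (rule that[of "?S \<union> ?T"])
    show "?S \<union> ?T \<subseteq> V" using S1 S2 by blast
    show "v 1 \<in> ?S \<union> ?T" using S1 by blast
    show "v n \<in> ?S \<union> ?T" using S2 rn by auto
    have "card (?S \<union> ?T) = card ?S + card ?T" by (rule card_Un_disjoint[OF _ _ disj]) auto
    moreover have "?c \<le> card ?S" "?c \<le> card ?T" using S1 S2 by blast+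
    moreover have "2 * a \<le> z" if "z = x + y" "a \<le> x" "a \<le> y" for a x y z :: nat using that by linarith
    ultimately show "2 * ?c \<le> card (?S \<union> ?T)" by blast
    fix x assume x: "x \<in> ?S \<union> ?T"
    show "?c \<le> card {l \<in> {1..<n}. x \<in> e l}" using x S1 S2 unfolding pdr by blast
    show "card {f \<in> free_edges e. x \<in> f} \<le> t - 1 choose (r - 1)" using x S1 S2 unfolding R(2) by blast
  qed
qed

lemma sum_path_degree:
  assumes h: "ham_path v e"
  shows "(\<Sum>x\<in>V. card {l \<in> {1..<n}. x \<in> e l}) = r * (n - 1)"
proof -
  have "(\<Sum>x\<in>V. card {l \<in> {1..<n}. x \<in> e l}) = (\<Sum>l\<in>{1..<n}. card {x \<in> V. x \<in> e l})"
    by (rule sum_card_incidence[OF finV]) simp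
  also have "\<dots> = (\<Sum>l\<in>{1..<n}. r)"
  proof (rule sum.cong[OF refl])
    fix l assume l: "l \<in> {1..<n}"
    then have "e l \<in> E" using hpD(6)[OF h] by simp
    then have "{x \<in> V. x \<in> e l} = e l" "card (e l) = r" using EV Er by auto
    then show "card {x \<in> V. x \<in> e l} = r" by simp
  qed
  finally show ?thesis by (simp add: mult.commute)
qed

lemma sum_free_degree: "(\<Sum>x\<in>V. card {f \<in> free_edges e. x \<in> f}) = r * card (free_edges e)"
proof -
  have fF: "finite (free_edges e)" using finE by (simp add: free_edges_def)
  have "(\<Sum>x\<in>V. card {f \<in> free_edges e. x \<in> f}) = (\<Sum>f\<in>free_edges e. card {x \<in> V. x \<in> f})"
    by (rule sum_card_incidence[OF finV fF, where e = "\<lambda>f. f"])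
  also have "\<dots> = (\<Sum>f\<in>free_edges e. r)"
  proof (rule sum.cong[OF refl])
    fix f assume f: "f \<in> free_edges e"
    then have "{x \<in> V. x \<in> f} = f" "card f = r" using EV[OF Fr_sub[OF f]] Er[OF Fr_sub[OF f]] by auto
    then show "card {x \<in> V. x \<in> f} = r" by simp
  qed
  finally show ?thesis by (simp add: mult.commute)
qed

lemma inner_path_degree:
  assumes h: "ham_path v e" and p: "2 \<le> p" "p < n"
  shows "{p - 1, p} \<subseteq> {l \<in> {1..<n}. v p \<in> e l}" "2 \<le> card {l \<in> {1..<n}. v p \<in> e l}"
proof -
  have "Suc (p - 1) = p" using p by simp
  then show s: "{p - 1, p} \<subseteq> {l \<in> {1..<n}. v p \<in> e l}"
    using hpD(4)[OF h, of p] hpD(5)[OF h, of "p - 1"] p by auto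
  have "card {p - 1, p} = 2" using p by simp
  then show "2 \<le> card {l \<in> {1..<n}. v p \<in> e l}" using card_mono[OF _ s] by simp
qed

text \<open>The second part is the equality case, which pins down the values outside
  \<open>W\<close>.\<close>

lemma sum_split_bounds:
  fixes g :: "'a \<Rightarrow> nat"
  assumes W: "W \<subseteq> V" and a: "\<And>x. x \<in> W \<Longrightarrow> a \<le> g x" and b: "\<And>x. x \<in> V - W \<Longrightarrow> b \<le> g x"
  shows "card W * a + (n - card W) * b \<le> sum g V"
    "sum g V = card W * a + (n - card W) * b \<Longrightarrow> x \<in> V - W \<Longrightarrow> g x = b"
proof -
  let ?h = "\<lambda>x. if x \<in> W then a else b"
  have "sum ?h V = sum ?h W + sum ?h (V - W)" using sum.subset_diff[OF W finV, of ?h] by simp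
  also have "sum ?h W = card W * a" by simp
  also have "sum ?h (V - W) = card (V - W) * b" by simp
  also have "card (V - W) = n - card W" using card_Diff_subset[OF _ W] finite_subset[OF W finV] cardV by simp
  finally have s: "sum ?h V = card W * a + (n - card W) * b" .
  have le: "?h x \<le> g x" if "x \<in> V" for x using a b that by simp
  show "card W * a + (n - card W) * b \<le> sum g V" unfolding s[symmetric] by (rule sum_mono) (rule le)
  assume "sum g V = card W * a + (n - card W) * b" "x \<in> V - W"
  then have "sum ?h V = sum g V" "x \<in> V" using s by auto
  then have "?h x = g x" using sum_mono_inv[of ?h V g x] le finV by blast
  then show "g x = b" using \<open>x \<in> V - W\<close> by simp
qed

text \<open>Only $r = t = 4$, $n = 10$ survives the two incidence counts, and then with equality throughout.\<close>

lemma rank_four_structure: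
  assumes few: "\<forall>v e. ham_path v e \<longrightarrow> card (NI v e) \<le> t - 1" and r: "r = t" and h: "ham_path v e"
  obtains Z where "Z \<subseteq> V" "card Z = 2" "v 1 \<notin> Z" "v n \<notin> Z" "card (free_edges e) = 4"
    "\<And>x. x \<in> Z \<Longrightarrow> card {l \<in> {1..<n}. x \<in> e l} = 2" "\<And>f. f \<in> free_edges e \<Longrightarrow> Z \<subseteq> f"
    "\<And>x. x \<in> V - Z \<Longrightarrow> card {f \<in> free_edges e. x \<in> f} = 1"
proof -
  obtain W where W: "W \<subseteq> V" "v 1 \<in> W" "v n \<in> W" "2 * (1 + (t - 1 choose (r - 2))) \<le> card W"
    "\<And>x. x \<in> W \<Longrightarrow> 1 + (t - 1 choose (r - 2)) \<le> card {l \<in> {1..<n}. x \<in> e l}"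
    "\<And>x. x \<in> W \<Longrightarrow> card {f \<in> free_edges e. x \<in> f} \<le> t - 1 choose (r - 1)"
    using rotation_end_set[OF few h] by blast
  have c: "t \<le> 1 + (t - 1 choose (r - 2))" "t - 1 choose (r - 1) = 1" using choose_pred_ge(1) t3 r by auto
  have W1: "t \<le> card {l \<in> {1..<n}. x \<in> e l}" "card {f \<in> free_edges e. x \<in> f} \<le> 1" if "x \<in> W" for x
    using W(5,6)[OF that] c by auto
  have cW: "2 * t \<le> card W" by (rule order_trans[OF _ W(4)]) (use c in simp)
  have cWn: "card W \<le> n" using card_mono[OF finV W(1)] cardV by simp
  have Z2: "2 \<le> card {l \<in> {1..<n}. x \<in> e l}" if x: "x \<in> V - W" for x
  proof -
    obtain p where p: "1 \<le> p" "p \<le> n" "x = v p" using hp_idx[OF h, of x] x by blast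
    have "p \<noteq> 1" "p \<noteq> n" using p x W by auto
    then show ?thesis using inner_path_degree(2)[OF h, of p] p by simp
  qed
  let ?g = "\<lambda>x. card {l \<in> {1..<n}. x \<in> e l}" and ?k = "\<lambda>x. card {f \<in> free_edges e. x \<in> f}"
  define w where "w = card W"
  define m where "m = card (free_edges e)"
  have "card W * t + (n - card W) * 2 \<le> sum ?g V"
    by (rule sum_split_bounds(1)[OF W(1)]) (use W1(1) Z2 in blast)+
  then have A: "w * t + (n - w) * 2 \<le> t * (n - 1)" using sum_path_degree[OF h] r by (simp add: w_def)
  have fF: "finite (free_edges e)" using finE by (simp add: free_edges_def)
  \<comment> \<open>Incidences with the m free edges: at most one per vertex of \<open>W\<close>, at
    most m elsewhere.\<close>
  have B: "t * m \<le> w + (n - w) * m"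
  proof -
    have "t * m = sum ?k V" using sum_free_degree r by (simp add: m_def)
    also have "\<dots> = sum ?k W + sum ?k (V - W)" using sum.subset_diff[OF W(1) finV, of ?k] by simp
    also have "\<dots> \<le> (\<Sum>x\<in>W. 1) + (\<Sum>x\<in>V - W. m)"
    proof (rule add_mono)
      show "sum ?k W \<le> (\<Sum>x\<in>W. 1)" by (rule sum_mono) (rule W1(2))
      show "sum ?k (V - W) \<le> (\<Sum>x\<in>V - W. m)" unfolding m_def
        by (rule sum_mono) (auto intro!: card_mono[OF fF])
    qed
    also have "\<dots> = w + (n - w) * m"
      using card_Diff_subset[OF _ W(1)] finite_subset[OF W(1) finV] cardV by (simp add: w_def)
    finally show ?thesis .
  qed
  have m4: "4 \<le> m" using card_E_gt(2)[OF r] card_Fr[OF h] n4 by (simp add: m_def)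
  have n2: "n = 2 * t + 2"
  proof (rule ccontr)
    assume "n \<noteq> 2 * t + 2"
    then have n1: "n - 1 = 2 * t" "n = 2 * t + 1" using nt by auto
    show False
    proof -
      have "w = 2 * t \<and> n - w = 1 \<or> w = 2 * t + 1" using cW cWn n1 by (auto simp: w_def)
      moreover have "w * t + (n - w) * 2 \<le> 2 * (t * t)" using A n1(1) by simp
      ultimately show False using t3 by (auto simp: algebra_simps)
    qed
  qed
  have "w = 2 * t \<or> w = 2 * t + 1 \<or> w = 2 * t + 2" using cW cWn n2 by (auto simp: w_def)
  \<comment> \<open>For w = 2t, \<open>A\<close> gives t >= 4 and \<open>B\<close> reads (t - 2)(m -
    2) <= 4, so t = m = 4. Larger w contradicts \<open>B\<close> at once.\<close>
  then have w8: "w = 2 * t \<and> t = 4 \<and> m = 4"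
  proof (elim disjE)
    assume w: "w = 2 * t"
    then have "n - w = 2" using n2 by simp
    then have 1: "t * m \<le> 2 * t + 2 * m" "2 * t * t + 4 \<le> t * (n - 1)" using A B w by auto
    have "n - 1 = 2 * t + 1" using n2 by simp
    then have "t * (n - 1) = 2 * t * t + t" by (simp add: distrib_left)
    then have t4: "4 \<le> t" using 1(2) by simp
    obtain a b where ab: "t = 4 + a" "m = 4 + b" using t4 m4 le_Suc_ex by blast
    then have "a * b + 2 * a + 2 * b \<le> 0" using 1(1) by (simp add: algebra_simps)
    then show ?thesis using ab w by simp
  next
    assume w: "w = 2 * t + 1"
    then have "n - w = 1" using n2 by simp
    then have 1: "t * m \<le> 2 * t + 1 + m" using B w by simp
    obtain a b where ab: "t = 3 + a" "m = 4 + b" using t3 m4 le_Suc_ex by blast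
    show ?thesis using 1 unfolding ab by (simp add: algebra_simps)
  next
    assume w: "w = 2 * t + 2"
    then have "n - w = 0" using n2 by simp
    then have 1: "t * m \<le> 2 * t + 2" using B w by simp
    obtain a b where ab: "t = 3 + a" "m = 4 + b" using t3 m4 le_Suc_ex by blast
    show ?thesis using 1 unfolding ab by (simp add: algebra_simps)
  qed
  have nw: "n - w = 2" "n - 1 = 9" using n2 w8 by auto
  \<comment> \<open>The path count is attained: 8 times 4 plus 2 times 2 equals 4 times 9.\<close>
  have g2: "?g x = 2" if "x \<in> V - W" for x
  proof -
    have "sum ?g V = card W * t + (n - card W) * 2"
      unfolding sum_path_degree[OF h] w_def[symmetric] nw using w8 r by simp
    then show ?thesis using sum_split_bounds(2)[OF W(1), of t ?g 2 x] W1(1) Z2 that by blast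
  qed
  let ?Z = "V - W"
  have cZ: "card ?Z = 2" using card_Diff_subset[OF _ W(1)] finite_subset[OF W(1) finV] cardV nw by (simp add: w_def)
  have kV: "sum ?k V = 16" using sum_free_degree[of e] r w8 by (simp add: m_def)
  let ?h = "\<lambda>x. if x \<in> W then 1 else (4::nat)"
  have "sum ?h V = sum ?h W + sum ?h ?Z" using sum.subset_diff[OF W(1) finV, of ?h] by simp
  then have hV: "sum ?h V = 16" using cZ w8 by (simp add: w_def)
  have kle: "?k x \<le> ?h x" for x
  proof -
    have "?k x \<le> m" unfolding m_def by (rule card_mono[OF fF]) auto
    then show ?thesis using W1(2)[of x] w8 by auto
  qed
  have keq: "?k x = ?h x" if "x \<in> V" for x
    by (rule sum_mono_inv[of ?k V ?h]) (use kV hV kle that finV in auto)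
  show thesis
  proof (rule that[of ?Z])
    show "?Z \<subseteq> V" "v 1 \<notin> ?Z" "v n \<notin> ?Z" using W by auto
    show "card ?Z = 2" by (rule cZ)
    show "card (free_edges e) = 4" using w8 by (simp add: m_def)
    show "card {l \<in> {1..<n}. x \<in> e l} = 2" if "x \<in> ?Z" for x by (rule g2[OF that])
    show "card {f \<in> free_edges e. x \<in> f} = 1" if "x \<in> V - ?Z" for x using keq[of x] that W by auto
    show "?Z \<subseteq> f" if f: "f \<in> free_edges e" for f
    proof
      fix x assume x: "x \<in> ?Z"
      then have "?k x = card (free_edges e)" using keq[of x] w8 by (simp add: m_def)
      then have "{f \<in> free_edges e. x \<in> f} = free_edges e" by (intro card_subset_eq[OF fF]) auto
      then show "x \<in> f" using f by blast
    qed
  qed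
qed

text \<open>Otherwise \<open>rotation_end_set\<close> applies to every path. For 4 <= r < t the set
  \<open>W\<close> is larger than V; for r = 3 < t its 2t vertices need more incidences than the
  path has. For r = t the pair \<open>Z\<close> turns out to be the same after certain rotations,
  which forces extra incidences on its vertices.\<close>

lemma many_free_start:
  assumes h0: "ham_path v0 e0"
  shows "\<exists>v e. ham_path v e \<and> t \<le> card (NI v e)"
proof (rule ccontr)
  assume no: "\<not> ?thesis"
  have few: "\<forall>v e. ham_path v e \<longrightarrow> card (NI v e) \<le> t - 1"
  proof (intro allI impI)
    fix v e assume "ham_path v e"
    then have "\<not> t \<le> card (NI v e)" using no by blast
    then show "card (NI v e) \<le> t - 1" by simp
  qed
  obtain W where W: "W \<subseteq> V" "2 * (1 + (t - 1 choose (r - 2))) \<le> card W"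
    "\<And>x. x \<in> W \<Longrightarrow> 1 + (t - 1 choose (r - 2)) \<le> card {l \<in> {1..<n}. x \<in> e0 l}"
  proof (rule rotation_end_set[OF few h0])
    fix W assume "W \<subseteq> V" "2 * (1 + (t - 1 choose (r - 2))) \<le> card W" "\<And>x. x \<in> W \<Longrightarrow> 1 + (t - 1 choose (r - 2)) \<le> card {l \<in> {1..<n}. x \<in> e0 l}"
    then show thesis by (rule that)
  qed
  have cWn: "card W \<le> n" using card_mono[OF finV W(1)] cardV by simp
  have "\<not> (4 \<le> r \<and> r < t)"
  proof
    assume "4 \<le> r \<and> r < t"
    then have "t + 1 \<le> t - 1 choose (r - 2)" using choose_pred_ge(2) by blast
    then have "2 * (1 + (t + 1)) \<le> card W" by (intro order_trans[OF _ W(2)]) simp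
    then show False using cWn nt by arith
  qed
  moreover have "\<not> (r = 3 \<and> r < t)"
  proof
    assume r: "r = 3 \<and> r < t"
    have c: "t \<le> 1 + (t - 1 choose (r - 2))" using choose_pred_ge(1) t3 by linarith
    have tW: "t \<le> card {l \<in> {1..<n}. x \<in> e0 l}" if "x \<in> W" for x by (rule order_trans[OF c W(3)[OF that]])
    have "2 * t \<le> card W" by (rule order_trans[OF _ W(2)]) (use c in simp)
    then have tt: "2 * t * t \<le> card W * t" by (rule mult_right_mono) simp
    have "card W * t + (n - card W) * 0 \<le> (\<Sum>x\<in>V. card {l \<in> {1..<n}. x \<in> e0 l})"
      by (rule sum_split_bounds(1)[OF W(1) tW]) auto
    then have "card W * t \<le> 3 * (n - 1)" using sum_path_degree[OF h0] r by simp
    moreover note tt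
    moreover have "3 * (n - 1) \<le> 3 * (2 * t + 1)" using nt by auto
    moreover have "8 * t \<le> 2 * t * t" using r by simp
    ultimately have "8 * t \<le> 3 * (2 * t + 1)" by (meson order_trans)
    then show False using r by simp
  qed
  ultimately have r: "r = t" using r3 rt by linarith
  obtain Z where Z: "Z \<subseteq> V" "card Z = 2" "v0 1 \<notin> Z" "v0 n \<notin> Z" "card (free_edges e0) = 4"
    "\<And>x. x \<in> Z \<Longrightarrow> card {l \<in> {1..<n}. x \<in> e0 l} = 2" "\<And>f. f \<in> free_edges e0 \<Longrightarrow> Z \<subseteq> f"
    "\<And>x. x \<in> V - Z \<Longrightarrow> card {f \<in> free_edges e0. x \<in> f} = 1"
  proof (rule rank_four_structure[OF few r h0])
    fix Z assume "Z \<subseteq> V" "card Z = 2" "v0 1 \<notin> Z" "v0 n \<notin> Z" "card (free_edges e0) = 4" "\<And>x. x \<in> Z \<Longrightarrow> card {l \<in> {1..<n}. x \<in> e0 l} = 2" "\<And>f. f \<in> free_edges e0 \<Longrightarrow> Z \<subseteq> f" "\<And>x. x \<in> V - Z \<Longrightarrow> card {f \<in> free_edges e0. x \<in> f} = 1"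
    then show thesis by (rule that)
  qed
  have v1: "v0 1 \<in> V - Z" using Z hpD(7)[OF h0, of 1] n4 by simp
  obtain f where "{f \<in> free_edges e0. v0 1 \<in> f} = {f}" using Z(8)[OF v1] by (rule card_1_singletonE)
  then have f: "f \<in> free_edges e0" "v0 1 \<in> f" by auto
  have fF: "finite (free_edges e0)" using finE by (simp add: free_edges_def)
  \<comment> \<open>Rotating just before a vertex of \<open>Z\<close> releases e_(p-1). The pair
    \<open>Z'\<close> of the new path lies in three of the old free edges, so it equals
    \<open>Z\<close> and is contained in e_(p-1).\<close>
  have key: "Z \<subseteq> e0 (p - 1)" if p: "2 \<le> p" "p < n" "v0 p \<in> Z" for p
  proof -
    have i: "1 \<le> p - 1" "p - 1 < n" "Suc (p - 1) = p" using p by auto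
    have s: "rotation (p - 1) f v0 e0" using f i p Z(7)[OF f(1)] by (auto simp: rotation_def)
    note R = rotationD[OF h0 s]
    obtain Z' where Z': "Z' \<subseteq> V" "card Z' = 2" "\<And>f'. f' \<in> free_edges (rote (p - 1) f e0) \<Longrightarrow> Z' \<subseteq> f'"
    proof (rule rank_four_structure[OF few r R(1)])
      fix Z' assume "Z' \<subseteq> V" "card Z' = 2" "\<And>f'. f' \<in> free_edges (rote (p - 1) f e0) \<Longrightarrow> Z' \<subseteq> f'"
      then show thesis by (rule that)
    qed
    have "Z' \<subseteq> Z"
    proof
      fix x assume x: "x \<in> Z'"
      show "x \<in> Z"
      proof (rule ccontr)
        assume "x \<notin> Z"
        then have 1: "card {f \<in> free_edges e0. x \<in> f} = 1" using Z(8)[of x] x Z'(1) by blast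
        have "free_edges e0 - {f} \<subseteq> {f \<in> free_edges e0. x \<in> f}" using Z'(3) R(2) x by blast
        then have "card (free_edges e0 - {f}) \<le> card {f \<in> free_edges e0. x \<in> f}" by (rule card_mono[rotated]) (use fF in simp)
        then have "card (free_edges e0 - {f}) \<le> 1" using 1 by simp
        then show False using Z(5) f(1) by simp
      qed
    qed
    then have "Z' = Z" using Z(2) Z'(2) finite_subset[OF Z(1) finV] by (intro card_subset_eq) auto
    moreover have "e0 (p - 1) \<noteq> f" using path_edge_not_free[OF i(1,2)] f by blast
    then have "e0 (p - 1) \<in> free_edges (rote (p - 1) f e0)" using R(2) by blast
    ultimately show ?thesis using Z'(3) by blast
  qed
  obtain z1 z2 where z: "Z = {z1, z2}" "z1 \<noteq> z2" using Z(2) by (meson card_2_iff)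
  have pos: "\<exists>p. 2 \<le> p \<and> p < n \<and> x = v0 p" if x: "x \<in> Z" for x
  proof -
    obtain p where p: "1 \<le> p" "p \<le> n" "x = v0 p" using hp_idx[OF h0, of x] x Z(1) by blast
    have "p \<noteq> 1" "p \<noteq> n" using p x Z by auto
    then have "2 \<le> p" "p < n" using p by auto
    then show ?thesis using p by blast
  qed
  have only: "l = p - 1 \<or> l = p" if p: "2 \<le> p" "p < n" "v0 p \<in> Z" and l: "1 \<le> l" "l < n" "v0 p \<in> e0 l" for p l
  proof -
    have "card {p - 1, p} = 2" using p by simp
    then have "{p - 1, p} = {l \<in> {1..<n}. v0 p \<in> e0 l}"
      using inner_path_degree(1)[OF h0 p(1,2)] Z(6)[OF p(3)] by (intro card_subset_eq) auto
    then show ?thesis using l by auto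
  qed
  obtain p where p: "2 \<le> p" "p < n" "z1 = v0 p" using pos[of z1] z by auto
  obtain q where q: "2 \<le> q" "q < n" "z2 = v0 q" using pos[of z2] z by auto
  have pZ: "v0 p \<in> Z" "v0 q \<in> Z" using z p q by auto
  \<comment> \<open>Vertices of \<open>Z\<close> lie only in the two path edges next to them, so p
    and q would each have to immediately precede the other.\<close>
  have "q - 1 = p - 1 \<or> q - 1 = p" using only[OF p(1,2) pZ(1), of "q - 1"] key[OF q(1,2) pZ(2)] pZ q by auto
  moreover have "p - 1 = q - 1 \<or> p - 1 = q" using only[OF q(1,2) pZ(2), of "p - 1"] key[OF p(1,2) pZ(1)] pZ p by auto
  moreover have "p \<noteq> q" using z p q by auto
  ultimately show False using p q by auto
qed

lemma no_ham_path: "ham_path v e \<Longrightarrow> False"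
proof -
  assume "ham_path v e"
  then obtain v' e' where h: "ham_path v' e'" "t \<le> card (NI v' e')" using many_free_start by blast
  show False
  proof (cases "n = 2 * t + 1")
    case True then show False using odd_false h by blast
  next
    case False
    then have "n = 2 * t + 2" using nt by simp
    then show False using many_free_end_false[OF hp_rev(1)[OF h(1)]] card_rev(3)[OF h(1)] h(2) by simp
  qed
qed

end

section \<open>Saturation\<close>

lemma mod_shift_inj:
  assumes "(i + a) mod n = (i + b) mod (n::nat)" "a < b + n" "b < a + n"
  shows "a = b"
proof -
  have *: "a = b" if "a \<le> b" "b < a + n" "(i + a) mod n = (i + b) mod n" for a b
  proof -
    have "n dvd (i + b) - (i + a)" using mod_eq_dvd_iff_nat[of "i + a" "i + b" n] that by simp
    then show ?thesis using that by (auto dest: dvd_imp_le)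
  qed
  show ?thesis using *[of a b] *[of b a] assms by (cases "a \<le> b") auto
qed

context unif
begin

text \<open>Number the vertices cyclically and use the n cyclic intervals of length r as
  edges.\<close>

lemma complete_hamiltonian:
  assumes all: "\<And>f. f \<subseteq> V \<Longrightarrow> card f = r \<Longrightarrow> f \<in> E"
  shows "\<exists>vs es. hamiltonian_berge_cycle V E vs es"
proof -
  have n0: "0 < n" using n4 by simp
  obtain v where v: "bij_betw v {0..<n} V" using ex_bij_betw_nat_finite[OF finV] cardV by blast
  have vi: "inj_on v {0..<n}" and vV: "v ` {0..<n} = V" using v by (auto simp: bij_betw_def)
  define I where "I i = (\<lambda>j. (i + j) mod n) ` {..<r}" for i
  have Isub: "I i \<subseteq> {0..<n}" for i using n0 by (auto simp: I_def)
  have cI: "card (I i) = r" for i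
  proof -
    have "inj_on (\<lambda>j. (i + j) mod n) {..<r}"
    proof (rule inj_onI)
      fix a b assume "a \<in> {..<r}" "b \<in> {..<r}" "(i + a) mod n = (i + b) mod n"
      then show "a = b" using mod_shift_inj[of i a n b] rn by simp
    qed
    then show ?thesis by (simp add: I_def card_image)
  qed
  have mem: "(i + d) mod n \<in> I i \<longleftrightarrow> d < r" if "d < n" for i d
  proof
    assume "(i + d) mod n \<in> I i"
    then obtain j where "j < r" "(i + d) mod n = (i + j) mod n" by (auto simp: I_def)
    then show "d < r" using mod_shift_inj[of i d n j] that rn by simp
  qed (auto simp: I_def)
  have Iinj: "i = i'" if "i < n" "i' < n" "I i = I i'" for i i'
  proof (rule ccontr)
    assume ne: "i \<noteq> i'"
    \<comment> \<open>If intervals starting at i and i' = i + d coincide, then d < r and i + r lies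
      in the second but not in the first.\<close>
    define d where "d = (i' + n - i) mod n"
    have dn: "d < n" using n0 by (simp add: d_def)
    have id: "(i + d) mod n = i'"
    proof -
      have "(i + d) mod n = (i + (i' + n - i)) mod n" unfolding d_def by (simp add: mod_add_right_eq)
      also have "i + (i' + n - i) = i' + n" using that by simp
      finally show ?thesis using that by simp
    qed
    have d0: "0 < d" using id ne that by (cases d) auto
    have "(i' + 0) mod n \<in> I i'" using mem[of 0 i'] r3 n0 by simp
    then have "(i + d) mod n \<in> I i" using id that by simp
    then have dr: "d < r" using mem dn by blast
    have "(i + r) mod n = (i + d + (r - d)) mod n" using dr by simp
    also have "\<dots> = ((i + d) mod n + (r - d)) mod n" by (rule mod_add_left_eq[symmetric])
    finally have "(i + r) mod n = (i' + (r - d)) mod n" unfolding id .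
    moreover have "(i' + (r - d)) mod n \<in> I i'" using mem[of "r - d" i'] d0 dr rn by simp
    ultimately have "(i + r) mod n \<in> I i" using that by simp
    then show False using mem[of r i] rn by simp
  qed
  let ?vs = "map v [0..<n]" and ?es = "map (\<lambda>i. v ` I i) [0..<n]"
  have "berge_cycle V E (card V) ?vs ?es" unfolding berge_cycle_def
  proof (intro conjI allI impI)
    show "length ?vs = card V" "length ?es = card V" using cardV by auto
    show "distinct ?vs" using vi by (simp add: distinct_map)
    have "inj_on (\<lambda>i. v ` I i) {0..<n}"
    proof (rule inj_onI)
      fix i j assume ij: "i \<in> {0..<n}" "j \<in> {0..<n}" "v ` I i = v ` I j"
      then have "I i = I j" using inj_on_image_eq_iff[OF vi Isub Isub] by blast
      then show "i = j" using Iinj ij by simp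
    qed
    then show "distinct ?es" by (simp add: distinct_map)
    show "set ?vs \<subseteq> V" using vV by auto
    show "set ?es \<subseteq> E"
    proof
      fix f assume "f \<in> set ?es"
      then obtain i where f: "f = v ` I i" by auto
      have "card f = r" unfolding f using card_image[OF inj_on_subset[OF vi Isub[of i]]] cI by simp
      moreover have "f \<subseteq> V" unfolding f using Isub vV by blast
      ultimately show "f \<in> E" using all by blast
    qed
    fix i assume i: "i < card V"
    then have i': "i < n" "(i + 1) mod n < n" using cardV n0 by auto
    have "i \<in> I i" "(i + 1) mod n \<in> I i" using mem[of 0 i] mem[of 1 i] r3 rn i' by auto
    then show "{?vs ! i, ?vs ! ((i + 1) mod card V)} \<subseteq> ?es ! i" using i' cardV by simp
  qed
  then show ?thesis unfolding hamiltonian_berge_cycle_def by blast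
qed

text \<open>The deleted edge has index k, so the numbering of the path starts at k + 1.\<close>

lemma cycle_ham_path:
  assumes c: "hamiltonian_berge_cycle V (insert f E) vs es" and k: "k < n" "es ! k = f"
  shows "ham_path (\<lambda>j. vs ! ((k + j) mod n)) (\<lambda>j. es ! ((k + j) mod n))"
proof -
  let ?m = "\<lambda>j. (k + j) mod n"
  have n0: "0 < n" using n4 by simp
  have B: "length vs = n" "length es = n" "distinct vs" "distinct es" "set vs \<subseteq> V" "set es \<subseteq> insert f E"
    "\<And>i. i < n \<Longrightarrow> vs ! i \<in> es ! i \<and> vs ! ((i + 1) mod n) \<in> es ! i"
    using c cardV unfolding hamiltonian_berge_cycle_def berge_cycle_def by auto
  have m: "?m j < n" for j using n0 by simp
  have minj: "inj_on ?m {1..n}"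
  proof (rule inj_onI)
    fix a b assume "a \<in> {1..n}" "b \<in> {1..n}" "?m a = ?m b"
    then show "a = b" using mod_shift_inj[of k a n b] by simp
  qed
  show ?thesis unfolding ham_path_def
  proof (intro conjI ballI)
    have vi: "inj_on (\<lambda>j. vs ! ?m j) {1..n}"
    proof (rule inj_onI)
      fix x y assume xy: "x \<in> {1..n}" "y \<in> {1..n}" "vs ! ?m x = vs ! ?m y"
      then have "?m x = ?m y" using nth_eq_iff_index_eq[OF B(3)] m B(1) by simp
      then show "x = y" using minj xy by (auto dest: inj_onD)
    qed
    have "(\<lambda>j. vs ! ?m j) ` {1..n} \<subseteq> V" using m B(1,5) nth_mem by fastforce
    then have "(\<lambda>j. vs ! ?m j) ` {1..n} = V" using card_image[OF vi] cardV finV by (intro card_subset_eq) auto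
    then show "bij_betw (\<lambda>j. vs ! ?m j) {1..n} V" using vi by (simp add: bij_betw_def)
    show "inj_on (\<lambda>j. es ! ?m j) {1..<n}"
    proof (rule inj_onI)
      fix x y assume xy: "x \<in> {1..<n}" "y \<in> {1..<n}" "es ! ?m x = es ! ?m y"
      then have "?m x = ?m y" using nth_eq_iff_index_eq[OF B(4)] m B(2) by simp
      then show "x = y" using minj xy by (auto dest: inj_onD)
    qed
    show "(\<lambda>j. es ! ?m j) ` {1..<n} \<subseteq> E"
    proof
      fix g assume "g \<in> (\<lambda>j. es ! ?m j) ` {1..<n}"
      then obtain j where j: "1 \<le> j" "j < n" "g = es ! ?m j" by auto
      have "?m j \<noteq> k"
      proof
        assume "?m j = k"
        then have "(k + j) mod n = (k + n) mod n" using k by simp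
        then show False using mod_shift_inj[of k j n n] j by simp
      qed
      then have "g \<noteq> f" using j(3) k nth_eq_iff_index_eq[OF B(4), of "?m j" k] m B(2) by auto
      moreover have "g \<in> set es" using j m B(2) by simp
      ultimately show "g \<in> E" using B(6) by blast
    qed
    fix j assume "j \<in> {1..<n}"
    have "(?m j + 1) mod n = ?m (Suc j)" by (simp add: mod_Suc_eq One_nat_def)
    then show "vs ! ?m j \<in> es ! ?m j" "vs ! ?m (Suc j) \<in> es ! ?m j" using B(7)[OF m, of j] by auto
  qed
qed

text \<open>Induction on the number of missing r-sets: a non-hamiltonian hypergraph is not complete,
  one more edge makes it hamiltonian by induction, and that edge must lie on the cycle, whose
  remainder is a path.\<close>

lemma saturation:
  assumes path: "\<And>E'. E \<subseteq> E' \<Longrightarrow> nonham V E' n r \<Longrightarrow> \<nexists>v e. unif.ham_path V E' n v e"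
  shows "\<exists>vs es. hamiltonian_berge_cycle V E vs es"
proof -
  let ?A = "{f. f \<subseteq> V \<and> card f = r}"
  have fA: "finite ?A" by (rule finite_subset[of _ "Pow V"]) (use finV in auto)
  have "\<exists>vs es. hamiltonian_berge_cycle V E' vs es" if "E \<subseteq> E'" "E' \<subseteq> ?A" for E' using that
  proof (induction "card (?A - E')" arbitrary: E' rule: less_induct)
    case less
    interpret U: unif V E' n r
      by unfold_locales (use finV cardV r3 rn less.prems in auto)
    show ?case
    proof (rule ccontr)
      assume no: "\<not> ?case"
      then have N: "nonham V E' n r" by unfold_locales blast
      obtain f where f: "f \<subseteq> V" "card f = r" "f \<notin> E'" using U.complete_hamiltonian no by blast
      have "?A - insert f E' \<subset> ?A - E'" using f by auto
      then have "card (?A - insert f E') < card (?A - E')" using fA by (intro psubset_card_mono) auto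
      moreover have "E \<subseteq> insert f E'" "insert f E' \<subseteq> ?A" using less.prems f by auto
      ultimately have "\<exists>vs es. hamiltonian_berge_cycle V (insert f E') vs es" by (rule less.hyps)
      then obtain vs es where c: "hamiltonian_berge_cycle V (insert f E') vs es" by blast
      have "f \<in> set es"
      proof (rule ccontr)
        assume "f \<notin> set es"
        then have "hamiltonian_berge_cycle V E' vs es"
          using c unfolding hamiltonian_berge_cycle_def berge_cycle_def by auto
        then show False using no by blast
      qed
      moreover have "length es = n" using c cardV unfolding hamiltonian_berge_cycle_def berge_cycle_def by simp
      ultimately obtain k where "k < n" "es ! k = f" by (metis in_set_conv_nth)
      then show False using U.cycle_ham_path[OF c] path[OF less.prems(1) N] by blast
    qed
  qed
  then show ?thesis using EV Er by blast
qed

end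

theorem theorem1p6:
  fixes n r t :: nat and V :: "'a set" and E :: "'a set set"
  assumes "3 \<le> r" and "r < n"
    and "t = (n - 1) div 2"
    and "finite V" and "card V = n"
    and "uniform_hypergraph r V E"
    and "(r \<le> t \<and> min_hdegree V E \<ge> (t choose (r - 1)) + 1) \<or>
         (real r \<ge> real n / 2 \<and> min_hdegree V E \<ge> r)"
  shows "\<exists>vs es. hamiltonian_berge_cycle V E vs es"
proof -
  interpret unif V E n r
    using assms by unfold_locales (auto simp: uniform_hypergraph_def hypergraph_def)
  have min: "min_hdegree V E \<le> hdegree E x" if "x \<in> V" for x
    unfolding min_hdegree_def using that finV by simp
  show ?thesis
  proof (rule saturation)
    fix E' assume E': "E \<subseteq> E'" and N: "nonham V E' n r"
    interpret N: nonham V E' n r by (rule N)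
    have deg: "min_hdegree V E \<le> hdegree E' x" if "x \<in> V" for x
    proof -
      have "hdegree E x \<le> hdegree E' x" unfolding hdegree_def using E' N.finE by (intro card_mono) auto
      then show ?thesis using min[OF that] by simp
    qed
    from assms(7) show "\<nexists>v e. unif.ham_path V E' n v e"
    proof
      assume a: "r \<le> t \<and> min_hdegree V E \<ge> (t choose (r - 1)) + 1"
      have "n = 2 * t + 1 \<or> n = 2 * t + 2" using assms(3) rn by presburger
      then interpret D: dirac V E' n r t
        using a deg by unfold_locales (auto intro: order_trans)
      show ?thesis using D.no_ham_path by blast
    next
      assume b: "real r \<ge> real n / 2 \<and> min_hdegree V E \<ge> r"
      then have "n \<le> 2 * r" by linarith
      then interpret L: large_rank V E' n r
        using b deg by unfold_locales (auto intro: order_trans)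
      show ?thesis using L.no_ham_path by blast
    qed
  qed
qed

end
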